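(* Let $k$ be a natural number and let $T$ be a theory in-between $\mathsf{HA}$ and $\mathsf{PA}$. The following are pairwise equivalent: (1) $\mathrm{PNFT}_T(\neg\mathrm{E}_{k'},\neg\neg\Pi_{k'})$ for all $k'\le k$; (2) $\mathrm{PNFT}_T(\neg\neg\mathrm{U}_{k'},\neg\neg\Pi_{k'})$ for all $k'\le k$; (3) $T\vdash\mathrm{DNS}(\mathrm{U}_k^+)$.
   Context: $\mathsf{HA}$ is intuitionistic (Heyting) arithmetic in the language with function symbols for all primitive recursive functions and logical constants $\forall,\exists,\to,\land,\lor,\perp$; $\neg\varphi$ abbreviates $\varphi\to\perp$. $\mathsf{PA}$ is $\mathsf{HA}$ plus the law of excluded middle for all formulas. A theory $T$ is in-between $S$ and $S'$ if it is a theory in the language of $\mathsf{HA}$ whose theorems include those of $S$ and are included in those of $S'$. $T\vdash\mathrm{P}$ means every instance of schema $\mathrm{P}$ is provable in $T$. $\mathrm{FV}(\varphi)$ is the set of free variables. $\Sigma_0=\Pi_0$ are the quantifier-free formulas; $\Pi_{k+1}$: formulas $Q_1\bar x_1\cdots Q_{k+1}\bar x_{k+1}\varphi_{qf}$ ($Q_i=\forall$ for odd $i$, $\exists$ for even $i$); $\Sigma_{k+1}$ likewise starting with $\exists$ (blocks may be empty by the paper's convention). $\Gamma(x,y)$: formulas in $\Gamma$ with free variables among $x,y$. $\mathrm{DNS}(\Gamma)$: $\forall x(\forall y\neg\neg\varphi(x,y)\to\neg\neg\forall y\varphi(x,y))$ for $\varphi(x,y)\in\Gamma(x,y)$. For a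 class $\Gamma$, $\neg\Gamma=\{\neg\varphi:\varphi\in\Gamma\}$ and $\neg\neg\Gamma=\{\neg\neg\varphi:\varphi\in\Gamma\}$. $\mathrm{PNFT}_T(\Gamma,\Gamma')$: for every $\varphi\in\Gamma$ there is $\varphi'\in\Gamma'$ with $\mathrm{FV}(\varphi)=\mathrm{FV}(\varphi')$ and $T\vdash\varphi\leftrightarrow\varphi'$. Alternation paths: finite alternating sequences of $+,-$; $i(s)$ first symbol ($\times$ if empty), $s^\perp$ swaps signs, $l(s)$ length. $\mathrm{Alt}(\varphi)=\{\langle\rangle\}$ for quantifier-free $\varphi$; otherwise $\mathrm{Alt}(\neg\varphi_1)=\{s^\perp:s\in\mathrm{Alt}(\varphi_1)\}$, $\mathrm{Alt}(\varphi_1\land\varphi_2)=\mathrm{Alt}(\varphi_1\lor\varphi_2)=\mathrm{Alt}(\varphi_1)\cup\mathrm{Alt}(\varphi_2)$, $\mathrm{Alt}(\varphi_1\to\varphi_2)=\{s^\perp:s\in\mathrm{Alt}(\varphi_1)\}\cup\mathrm{Alt}(\varphi_2)$, $\mathrm{Alt}(\forall x\varphi_1)=\{s\in\mathrm{Alt}(\varphi_1):i(s)=-\}\cup\{-s:s\in\mathrm{Alt}(\varphi_1),i(s)\ne-\}$, $\mathrm{Alt}(\exists x\varphi_1)=\{s\in\mathrm{Alt}(\varphi_1):i(s)=+\}\cup\{+s:s\in\mathrm{Alt}(\varphi_1),i(s)\ne+\}$. $\deg\varphi=\max\{l(s):s\in\mathrm{Alt}(\varphi)\}$, $\mathrm{F}_k=\{\varphi:\deg\varphi=k\}$,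 $\mathrm{U}_0=\mathrm{E}_0=\mathrm{F}_0$, $\mathrm{U}_{k+1}=\{\varphi\in\mathrm{F}_{k+1}:i(s)=-$ for all $s\in\mathrm{Alt}(\varphi)$ with $l(s)=k+1\}$, $\mathrm{E}_{k+1}$ likewise with $+$, $\mathrm{U}_k^+=\mathrm{U}_k\cup\bigcup_{i<k}\mathrm{F}_i$. *)

theory Defs
  imports Main
begin

section \<open>The language of HA\<close>

text \<open>
  The function symbols are the derivations of primitive recursive functions.  The number stored in
  \<open>PrComp n f gs\<close> is the arity of the composition; it is not determined by \<open>gs\<close> when \<open>gs = []\<close>.
\<close>

datatype pr =
    PrZero
  | PrSuc
  | PrProj nat nat
  | PrComp nat pr "pr list"
  | PrRec pr pr

fun pr_arity :: "pr \<Rightarrow> nat" where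
  "pr_arity PrZero = 0"
| "pr_arity PrSuc = 1"
| "pr_arity (PrProj n i) = n"
| "pr_arity (PrComp n f gs) = n"
| "pr_arity (PrRec f g) = Suc (pr_arity f)"

fun wf_pr :: "pr \<Rightarrow> bool" where
  "wf_pr PrZero \<longleftrightarrow> True"
| "wf_pr PrSuc \<longleftrightarrow> True"
| "wf_pr (PrProj n i) \<longleftrightarrow> i < n"
| "wf_pr (PrComp n f gs) \<longleftrightarrow>
     wf_pr f \<and> pr_arity f = length gs \<and> (\<forall>g\<in>set gs. wf_pr g \<and> pr_arity g = n)"
| "wf_pr (PrRec f g) \<longleftrightarrow> wf_pr f \<and> wf_pr g \<and> pr_arity g = pr_arity f + 2"

text \<open>Variables are de Bruijn indices, so formulas are identified up to renaming of bound variables.\<close>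

datatype tm = Var nat | Fn pr "tm list"

datatype fm =
    Eq tm tm
  | Bot
  | Imp fm fm
  | Conj fm fm
  | Disj fm fm
  | Forall fm
  | Exists fm

definition Neg :: "fm \<Rightarrow> fm" where
  "Neg \<phi> = Imp \<phi> Bot"

definition Iff :: "fm \<Rightarrow> fm \<Rightarrow> fm" where
  "Iff \<phi> \<psi> = Conj (Imp \<phi> \<psi>) (Imp \<psi> \<phi>)"

definition zero_tm :: tm where
  "zero_tm = Fn PrZero []"

definition suc_tm :: "tm \<Rightarrow> tm" where
  "suc_tm t = Fn PrSuc [t]"

fun wf_tm :: "tm \<Rightarrow> bool" where
  "wf_tm (Var n) \<longleftrightarrow> True"
| "wf_tm (Fn f ts) \<longleftrightarrow> wf_pr f \<and> pr_arity f = length ts \<and> (\<forall>t\<in>set ts. wf_tm t)"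

fun wf_fm :: "fm \<Rightarrow> bool" where
  "wf_fm (Eq s t) \<longleftrightarrow> wf_tm s \<and> wf_tm t"
| "wf_fm Bot \<longleftrightarrow> True"
| "wf_fm (Imp \<phi> \<psi>) \<longleftrightarrow> wf_fm \<phi> \<and> wf_fm \<psi>"
| "wf_fm (Conj \<phi> \<psi>) \<longleftrightarrow> wf_fm \<phi> \<and> wf_fm \<psi>"
| "wf_fm (Disj \<phi> \<psi>) \<longleftrightarrow> wf_fm \<phi> \<and> wf_fm \<psi>"
| "wf_fm (Forall \<phi>) \<longleftrightarrow> wf_fm \<phi>"
| "wf_fm (Exists \<phi>) \<longleftrightarrow> wf_fm \<phi>"

fun FV_tm :: "tm \<Rightarrow> nat set" where
  "FV_tm (Var n) = {n}"
| "FV_tm (Fn f ts) = (\<Union>t\<in>set ts. FV_tm t)"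

fun FV :: "fm \<Rightarrow> nat set" where
  "FV (Eq s t) = FV_tm s \<union> FV_tm t"
| "FV Bot = {}"
| "FV (Imp \<phi> \<psi>) = FV \<phi> \<union> FV \<psi>"
| "FV (Conj \<phi> \<psi>) = FV \<phi> \<union> FV \<psi>"
| "FV (Disj \<phi> \<psi>) = FV \<phi> \<union> FV \<psi>"
| "FV (Forall \<phi>) = {n. Suc n \<in> FV \<phi>}"
| "FV (Exists \<phi>) = {n. Suc n \<in> FV \<phi>}"

fun subst_tm :: "(nat \<Rightarrow> tm) \<Rightarrow> tm \<Rightarrow> tm" where
  "subst_tm \<sigma> (Var n) = \<sigma> n"
| "subst_tm \<sigma> (Fn f ts) = Fn f (map (subst_tm \<sigma>) ts)"

definition up :: "(nat \<Rightarrow> tm) \<Rightarrow> nat \<Rightarrow> tm" where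
  "up \<sigma> = case_nat (Var 0) (\<lambda>n. subst_tm (\<lambda>m. Var (Suc m)) (\<sigma> n))"

fun subst :: "(nat \<Rightarrow> tm) \<Rightarrow> fm \<Rightarrow> fm" where
  "subst \<sigma> (Eq s t) = Eq (subst_tm \<sigma> s) (subst_tm \<sigma> t)"
| "subst \<sigma> Bot = Bot"
| "subst \<sigma> (Imp \<phi> \<psi>) = Imp (subst \<sigma> \<phi>) (subst \<sigma> \<psi>)"
| "subst \<sigma> (Conj \<phi> \<psi>) = Conj (subst \<sigma> \<phi>) (subst \<sigma> \<psi>)"
| "subst \<sigma> (Disj \<phi> \<psi>) = Disj (subst \<sigma> \<phi>) (subst \<sigma> \<psi>)"
| "subst \<sigma> (Forall \<phi>) = Forall (subst (up \<sigma>) \<phi>)"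
| "subst \<sigma> (Exists \<phi>) = Exists (subst (up \<sigma>) \<phi>)"

definition lift :: "fm \<Rightarrow> fm" where
  "lift = subst (\<lambda>n. Var (Suc n))"

text \<open>\<open>inst t \<phi>\<close> puts \<open>t\<close> for the outermost variable \<open>0\<close> of the body \<open>\<phi>\<close> of a quantified formula and
  lowers the other indices.\<close>

definition inst :: "tm \<Rightarrow> fm \<Rightarrow> fm" where
  "inst t = subst (case_nat t Var)"

section \<open>Intuitionistic derivability and theories\<close>

text \<open>
  Natural deduction for intuitionistic predicate logic with equality, from axioms \<open>A\<close> and open
  assumptions \<open>\<Gamma>\<close>.  The eigenvariable condition concerns \<open>\<Gamma>\<close> only (\<open>A\<close> is not lifted), so an axiom
  with free variables has the force of its universal closure.
\<close>

inductive deriv :: "fm set \<Rightarrow> fm set \<Rightarrow> fm \<Rightarrow> bool" for A :: "fm set" where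
  Axiom: "\<phi> \<in> A \<Longrightarrow> deriv A \<Gamma> \<phi>"
| Assm: "\<phi> \<in> \<Gamma> \<Longrightarrow> wf_fm \<phi> \<Longrightarrow> deriv A \<Gamma> \<phi>"
| BotE: "deriv A \<Gamma> Bot \<Longrightarrow> wf_fm \<phi> \<Longrightarrow> deriv A \<Gamma> \<phi>"
| ImpI: "wf_fm \<phi> \<Longrightarrow> deriv A (insert \<phi> \<Gamma>) \<psi> \<Longrightarrow> deriv A \<Gamma> (Imp \<phi> \<psi>)"
| ImpE: "deriv A \<Gamma> (Imp \<phi> \<psi>) \<Longrightarrow> deriv A \<Gamma> \<phi> \<Longrightarrow> deriv A \<Gamma> \<psi>"
| ConjI: "deriv A \<Gamma> \<phi> \<Longrightarrow> deriv A \<Gamma> \<psi> \<Longrightarrow> deriv A \<Gamma> (Conj \<phi> \<psi>)"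
| ConjE1: "deriv A \<Gamma> (Conj \<phi> \<psi>) \<Longrightarrow> deriv A \<Gamma> \<phi>"
| ConjE2: "deriv A \<Gamma> (Conj \<phi> \<psi>) \<Longrightarrow> deriv A \<Gamma> \<psi>"
| DisjI1: "deriv A \<Gamma> \<phi> \<Longrightarrow> wf_fm \<psi> \<Longrightarrow> deriv A \<Gamma> (Disj \<phi> \<psi>)"
| DisjI2: "deriv A \<Gamma> \<psi> \<Longrightarrow> wf_fm \<phi> \<Longrightarrow> deriv A \<Gamma> (Disj \<phi> \<psi>)"
| DisjE: "deriv A \<Gamma> (Disj \<phi> \<psi>) \<Longrightarrow> deriv A (insert \<phi> \<Gamma>) \<chi> \<Longrightarrow> deriv A (insert \<psi> \<Gamma>) \<chi> \<Longrightarrow>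
    deriv A \<Gamma> \<chi>"
| ForallI: "deriv A (lift ` \<Gamma>) \<phi> \<Longrightarrow> deriv A \<Gamma> (Forall \<phi>)"
| ForallE: "deriv A \<Gamma> (Forall \<phi>) \<Longrightarrow> wf_tm t \<Longrightarrow> deriv A \<Gamma> (inst t \<phi>)"
| ExistsI: "deriv A \<Gamma> (inst t \<phi>) \<Longrightarrow> wf_tm t \<Longrightarrow> deriv A \<Gamma> (Exists \<phi>)"
| ExistsE: "deriv A \<Gamma> (Exists \<phi>) \<Longrightarrow> deriv A (insert \<phi> (lift ` \<Gamma>)) (lift \<psi>) \<Longrightarrow> deriv A \<Gamma> \<psi>"
| EqRefl: "wf_tm t \<Longrightarrow> deriv A \<Gamma> (Eq t t)"
| EqSubst: "deriv A \<Gamma> (Eq s t) \<Longrightarrow> deriv A \<Gamma> (inst s \<phi>) \<Longrightarrow> deriv A \<Gamma> (inst t \<phi>)"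

definition provable :: "fm set \<Rightarrow> fm \<Rightarrow> bool" (infix "\<turnstile>" 50) where
  "T \<turnstile> \<phi> \<longleftrightarrow> deriv T {} \<phi>"

definition Induction :: "fm \<Rightarrow> fm" where
  "Induction \<phi> =
     Imp (Conj (inst zero_tm \<phi>)
               (Forall (Imp \<phi> (subst (case_nat (suc_tm (Var 0)) (\<lambda>n. Var (Suc n))) \<phi>))))
         (Forall \<phi>)"

inductive_set HA :: "fm set" where
  suc_nonzero: "wf_tm t \<Longrightarrow> Neg (Eq (suc_tm t) zero_tm) \<in> HA"
| suc_inject: "wf_tm s \<Longrightarrow> wf_tm t \<Longrightarrow> Imp (Eq (suc_tm s) (suc_tm t)) (Eq s t) \<in> HA"
| proj: "wf_tm (Fn (PrProj n i) ts) \<Longrightarrow> Eq (Fn (PrProj n i) ts) (ts ! i) \<in> HA"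
| comp: "wf_tm (Fn (PrComp n f gs) ts) \<Longrightarrow>
    Eq (Fn (PrComp n f gs) ts) (Fn f (map (\<lambda>g. Fn g ts) gs)) \<in> HA"
| rec_zero: "wf_tm (Fn (PrRec f g) (zero_tm # ts)) \<Longrightarrow>
    Eq (Fn (PrRec f g) (zero_tm # ts)) (Fn f ts) \<in> HA"
| rec_suc: "wf_tm (Fn (PrRec f g) (suc_tm t # ts)) \<Longrightarrow>
    Eq (Fn (PrRec f g) (suc_tm t # ts)) (Fn g (t # Fn (PrRec f g) (t # ts) # ts)) \<in> HA"
| induction: "wf_fm \<phi> \<Longrightarrow> Induction \<phi> \<in> HA"

definition PA :: "fm set" where
  "PA = HA \<union> {Disj \<phi> (Neg \<phi>) | \<phi>. wf_fm \<phi>}"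

definition in_between :: "fm set \<Rightarrow> fm set \<Rightarrow> fm set \<Rightarrow> bool" where
  "in_between T S S' \<longleftrightarrow>
     (\<forall>\<phi>\<in>T. wf_fm \<phi>) \<and> {\<phi>. S \<turnstile> \<phi>} \<subseteq> {\<phi>. T \<turnstile> \<phi>} \<and> {\<phi>. T \<turnstile> \<phi>} \<subseteq> {\<phi>. S' \<turnstile> \<phi>}"

section \<open>Classes of formulas\<close>

fun qfree :: "fm \<Rightarrow> bool" where
  "qfree (Eq s t) \<longleftrightarrow> True"
| "qfree Bot \<longleftrightarrow> True"
| "qfree (Imp \<phi> \<psi>) \<longleftrightarrow> qfree \<phi> \<and> qfree \<psi>"
| "qfree (Conj \<phi> \<psi>) \<longleftrightarrow> qfree \<phi> \<and> qfree \<psi>"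
| "qfree (Disj \<phi> \<psi>) \<longleftrightarrow> qfree \<phi> \<and> qfree \<psi>"
| "qfree (Forall \<phi>) \<longleftrightarrow> False"
| "qfree (Exists \<phi>) \<longleftrightarrow> False"

text \<open>The exponent \<open>n\<close> is the length of the leading quantifier block, possibly \<open>0\<close>.\<close>

fun Sigma_class :: "nat \<Rightarrow> fm set" and Pi_class :: "nat \<Rightarrow> fm set" where
  "Sigma_class 0 = {\<phi>. wf_fm \<phi> \<and> qfree \<phi>}"
| "Sigma_class (Suc k) = {(Exists ^^ n) \<phi> | n \<phi>. \<phi> \<in> Pi_class k}"
| "Pi_class 0 = {\<phi>. wf_fm \<phi> \<and> qfree \<phi>}"
| "Pi_class (Suc k) = {(Forall ^^ n) \<phi> | n \<phi>. \<phi> \<in> Sigma_class k}"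

datatype sign = Plus | Minus

type_synonym path = "sign list"

fun swap_sign :: "sign \<Rightarrow> sign" where
  "swap_sign Plus = Minus"
| "swap_sign Minus = Plus"

definition dual :: "path \<Rightarrow> path" where
  "dual s = map swap_sign s"

text \<open>\<open>None\<close> plays the role of the symbol \<open>\<times>\<close>.\<close>

fun initial :: "path \<Rightarrow> sign option" where
  "initial [] = None"
| "initial (a # s) = Some a"

text \<open>
  A negation has a clause of its own: the clause for implications would add the empty path coming
  from \<open>Bot\<close>.  That all quantifier-free formulas get \<open>{[]}\<close> is the lemma \<open>Alt_qfree\<close> below.
\<close>

fun Alt :: "fm \<Rightarrow> path set" where
  "Alt (Eq s t) = {[]}"
| "Alt Bot = {[]}"
| "Alt (Imp \<phi> \<psi>) = (if \<psi> = Bot then dual ` Alt \<phi> else dual ` Alt \<phi> \<union> Alt \<psi>)"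
| "Alt (Conj \<phi> \<psi>) = Alt \<phi> \<union> Alt \<psi>"
| "Alt (Disj \<phi> \<psi>) = Alt \<phi> \<union> Alt \<psi>"
| "Alt (Forall \<phi>) = {s \<in> Alt \<phi>. initial s = Some Minus} \<union>
     {Minus # s | s. s \<in> Alt \<phi> \<and> initial s \<noteq> Some Minus}"
| "Alt (Exists \<phi>) = {s \<in> Alt \<phi>. initial s = Some Plus} \<union>
     {Plus # s | s. s \<in> Alt \<phi> \<and> initial s \<noteq> Some Plus}"

lemma Alt_qfree: "qfree \<phi> \<Longrightarrow> Alt \<phi> = {[]}"
  by (induction \<phi>) (auto simp: dual_def)

lemma finite_Alt: "finite (Alt \<phi>)"
  by (induction \<phi>) auto

lemma Alt_nonempty: "Alt \<phi> \<noteq> {}"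
  by (induction \<phi>) auto

definition deg :: "fm \<Rightarrow> nat" where
  "deg \<phi> = Max (length ` Alt \<phi>)"

definition F_class :: "nat \<Rightarrow> fm set" where
  "F_class k = {\<phi>. wf_fm \<phi> \<and> deg \<phi> = k}"

fun U_class :: "nat \<Rightarrow> fm set" where
  "U_class 0 = F_class 0"
| "U_class (Suc k) =
     {\<phi> \<in> F_class (Suc k). \<forall>s\<in>Alt \<phi>. length s = Suc k \<longrightarrow> initial s = Some Minus}"

fun E_class :: "nat \<Rightarrow> fm set" where
  "E_class 0 = F_class 0"
| "E_class (Suc k) =
     {\<phi> \<in> F_class (Suc k). \<forall>s\<in>Alt \<phi>. length s = Suc k \<longrightarrow> initial s = Some Plus}"

definition U_plus :: "nat \<Rightarrow> fm set" where
  "U_plus k = U_class k \<union> (\<Union>i<k. F_class i)"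

section \<open>The principles\<close>

definition PNFT :: "fm set \<Rightarrow> fm set \<Rightarrow> fm set \<Rightarrow> bool" where
  "PNFT T G G' \<longleftrightarrow> (\<forall>\<phi>\<in>G. \<exists>\<phi>'\<in>G'. FV \<phi> = FV \<phi>' \<and> T \<turnstile> Iff \<phi> \<phi>')"

text \<open>In \<open>\<phi>(x, y)\<close> the variable \<open>y\<close> has index \<open>0\<close> and \<open>x\<close> has index \<open>1\<close>.\<close>

definition DNS :: "fm set \<Rightarrow> fm set" where
  "DNS G = {Forall (Imp (Forall (Neg (Neg \<phi>))) (Neg (Neg (Forall \<phi>)))) | \<phi>.
     \<phi> \<in> G \<and> FV \<phi> \<subseteq> {0, 1}}"

definition proves_schema :: "fm set \<Rightarrow> fm set \<Rightarrow> bool" where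
  "proves_schema T P \<longleftrightarrow> (\<forall>\<phi>\<in>P. T \<turnstile> \<phi>)"

end

theory Submission
  imports Defs
begin

text \<open>
  Let \<open>ntr A\<close> be the Goedel-Gentzen translation with \<open>A\<close> in place of falsity; it maps theorems of PA
  to theorems of HA.  Given DNS for the class U with superscript +, the translation at falsity of a
  formula of degree at most \<open>k\<close> is equivalent to its double negation.  Hence classically equivalent
  formulas of degree at most \<open>k\<close> have equivalent double negations, and (2) follows from the classical
  prenex normal form theorem.

  For the converse, by induction on \<open>k\<close>, it suffices to derive \<open>\<not>\<not>\<forall>x \<chi>\<close> from \<open>\<forall>x \<not>\<not>\<chi>\<close> for \<open>\<chi>\<close> in
  \<open>\<Sigma>\<close> of index \<open>k - 1\<close>.  By (2) the formula \<open>\<forall>x \<not>\<not>\<chi>\<close> has the same double negation as some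
  \<open>\<psi>\<close> in \<open>\<Pi>\<close> of index \<open>k\<close>, and PA proves that \<open>\<psi>\<close> implies \<open>\<chi>\<close>.  Excluded middle for formulas
  of degree at most \<open>k - 2\<close> holds under a double negation, by the DNS already available, and with it
  the translation at \<open>A = \<chi>\<close> (Friedman's trick) turns the proof in PA into a proof of \<open>\<chi>\<close> from \<open>\<psi>\<close>.
\<close>

section \<open>Substitution\<close>

text \<open>Excluded middle up to index \<open>k - 2\<close> is strong enough and still affordable.
  The translation at \<open>A\<close> of a \<Sigma> formula of index \<open>k - 1\<close> agrees
  with its double negation relative to \<open>A\<close>: the leading existential block commutes with
  that double negation, and only the part below it, of degree at most \<open>k - 2\<close>, has to
  be decided. Universal closures of such instances of excluded middle lie in U with superscript + at
  \<open>k - 1\<close>, where the shift is known by induction, so each holds under a double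
  negation; a derivation uses finitely many of them.

  Translating at falsity would turn the proof of \<chi> in PA into a proof of \<not>\<not>\<chi>
  only, which is the starting point; at \<open>A\<close> = \<chi> the result is (\<chi>
  \<rightarrow> \<chi>) \<rightarrow> \<chi>.

  Every index up to \<open>k\<close> is used in (2), since U fixes the exact degree while that of
  \<forall>x \<not>\<not>\<chi> is known only up to a bound. DNS has a single parameter, but the
  translation meets formulas with arbitrarily many; pairing inside HA closes this gap and is the
  purpose of the arithmetic of Cantor codes.\<close>

lemma wf_subst_tm: "(\<And>n. wf_tm (\<sigma> n)) \<Longrightarrow> wf_tm (subst_tm \<sigma> t) = wf_tm t"
  by (induction t) auto

lemma wf_up: "(\<And>n. wf_tm (\<sigma> n)) \<Longrightarrow> wf_tm (up \<sigma> n)"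
  by (auto simp: up_def wf_subst_tm split: nat.split)

lemma wf_subst: "(\<And>n. wf_tm (\<sigma> n)) \<Longrightarrow> wf_fm (subst \<sigma> \<phi>) = wf_fm \<phi>"
  by (induction \<phi> arbitrary: \<sigma>) (auto simp: wf_subst_tm wf_up)

lemma wf_case_nat [simp]: "wf_tm t \<Longrightarrow> (\<And>n. wf_tm (\<sigma> n)) \<Longrightarrow> wf_tm (case_nat t \<sigma> n)"
  by (auto split: nat.split)

lemma wf_inst [simp]: "wf_tm t \<Longrightarrow> wf_fm (inst t \<phi>) = wf_fm \<phi>"
  unfolding inst_def by (rule wf_subst) simp

lemma wf_lift [simp]: "wf_fm (lift \<phi>) = wf_fm \<phi>"
  by (simp add: lift_def wf_subst)

lemma wf_Neg [simp]: "wf_fm (Neg \<phi>) = wf_fm \<phi>"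
  by (simp add: Neg_def)

lemma wf_funpow_Forall [simp]: "wf_fm ((Forall ^^ n) \<phi>) = wf_fm \<phi>"
  by (induction n) auto

lemma subst_Neg [simp]: "subst \<sigma> (Neg \<phi>) = Neg (subst \<sigma> \<phi>)"
  by (simp add: Neg_def)

lemma subst_tm_cong: "(\<And>n. n \<in> FV_tm t \<Longrightarrow> \<sigma> n = \<tau> n) \<Longrightarrow> subst_tm \<sigma> t = subst_tm \<tau> t"
  by (induction t) auto

lemma subst_cong: "(\<And>n. n \<in> FV \<phi> \<Longrightarrow> \<sigma> n = \<tau> n) \<Longrightarrow> subst \<sigma> \<phi> = subst \<tau> \<phi>"
proof (induction \<phi> arbitrary: \<sigma> \<tau>)
  case (Eq s t)
  then show ?case by (auto intro: subst_tm_cong)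
next
  case (Forall \<phi>)
  have "up \<sigma> n = up \<tau> n" if "n \<in> FV \<phi>" for n
    using that Forall.prems by (cases n) (auto simp: up_def)
  then show ?case using Forall.IH[of "up \<sigma>" "up \<tau>"] by simp
next
  case (Exists \<phi>)
  have "up \<sigma> n = up \<tau> n" if "n \<in> FV \<phi>" for n
    using that Exists.prems by (cases n) (auto simp: up_def)
  then show ?case using Exists.IH[of "up \<sigma>" "up \<tau>"] by simp
next
  case (Imp \<phi> \<psi>)
  from Imp.IH[of \<sigma> \<tau>] Imp.prems show ?case by simp
next
  case (Conj \<phi> \<psi>)
  from Conj.IH[of \<sigma> \<tau>] Conj.prems show ?case by simp
next
  case (Disj \<phi> \<psi>)
  from Disj.IH[of \<sigma> \<tau>] Disj.prems show ?case by simp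
qed simp

lemma subst_tm_Var [simp]: "subst_tm Var t = t"
  by (induction t) (auto simp: map_idI)

lemma up_Var [simp]: "up Var = Var"
  by (auto simp: up_def fun_eq_iff split: nat.split)

lemma subst_Var [simp]: "subst Var \<phi> = \<phi>"
  by (induction \<phi>) auto

lemma subst_tm_subst_tm: "subst_tm \<sigma> (subst_tm \<tau> t) = subst_tm (\<lambda>n. subst_tm \<sigma> (\<tau> n)) t"
  by (induction t) auto

lemma up_comp: "(\<lambda>n. subst_tm (up \<sigma>) (up \<tau> n)) = up (\<lambda>n. subst_tm \<sigma> (\<tau> n))"
  by (auto simp: up_def fun_eq_iff subst_tm_subst_tm split: nat.split)

lemma subst_subst: "subst \<sigma> (subst \<tau> \<phi>) = subst (\<lambda>n. subst_tm \<sigma> (\<tau> n)) \<phi>"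
  by (induction \<phi> arbitrary: \<sigma> \<tau>) (auto simp: subst_tm_subst_tm up_comp)

lemma subst_tm_lift [simp]:
  "subst_tm (case_nat t \<sigma>) (subst_tm (\<lambda>n. Var (Suc n)) s) = subst_tm \<sigma> s"
  by (simp add: subst_tm_subst_tm)

lemma subst_case_nat_lift [simp]: "subst (case_nat t \<sigma>) (lift \<phi>) = subst \<sigma> \<phi>"
  by (simp add: lift_def subst_subst)

lemma inst_lift [simp]: "inst t (lift \<phi>) = \<phi>"
  by (simp add: inst_def)

lemma case_nat_up: "(\<lambda>n. subst_tm (case_nat t \<sigma>) (up \<tau> n)) = case_nat t (\<lambda>n. subst_tm \<sigma> (\<tau> n))"
  by (auto simp: up_def fun_eq_iff split: nat.split)

lemma inst_subst_up [simp]: "inst t (subst (up \<sigma>) \<phi>) = subst (case_nat t \<sigma>) \<phi>"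
  by (simp add: inst_def subst_subst case_nat_up)

lemma subst_inst: "subst \<sigma> (inst t \<phi>) = subst (case_nat (subst_tm \<sigma> t) \<sigma>) \<phi>"
proof -
  have "(\<lambda>n. subst_tm \<sigma> (case_nat t Var n)) = case_nat (subst_tm \<sigma> t) \<sigma>"
    by (auto simp: fun_eq_iff split: nat.split)
  then show ?thesis by (simp add: inst_def subst_subst)
qed

lemma subst_up_lift: "subst (up \<sigma>) (lift \<phi>) = lift (subst \<sigma> \<phi>)"
  by (simp add: lift_def subst_subst up_def)

lemma inst_Neg [simp]: "inst t (Neg \<phi>) = Neg (inst t \<phi>)"
  by (simp add: inst_def)

lemma inst_Imp [simp]: "inst t (Imp \<phi> \<psi>) = Imp (inst t \<phi>) (inst t \<psi>)"
  by (simp add: inst_def)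

section \<open>Free variables, and what substitution leaves invariant\<close>

lemma finite_FV_tm [simp]: "finite (FV_tm t)"
  by (induction t) auto

lemma finite_FV [simp]: "finite (FV \<phi>)"
proof (induction \<phi>)
  case (Forall \<phi>)
  then have "finite (Suc -` FV \<phi>)" by (intro finite_vimageI) auto
  then show ?case by (simp add: vimage_def)
next
  case (Exists \<phi>)
  then have "finite (Suc -` FV \<phi>)" by (intro finite_vimageI) auto
  then show ?case by (simp add: vimage_def)
qed auto

lemma FV_subst_tm: "FV_tm (subst_tm \<sigma> t) = (\<Union>n\<in>FV_tm t. FV_tm (\<sigma> n))"
  by (induction t) auto

lemma Suc_in_FV_up: "Suc m \<in> FV_tm (up \<sigma> n) \<longleftrightarrow> (\<exists>n'. n = Suc n' \<and> m \<in> FV_tm (\<sigma> n'))"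
  by (cases n) (auto simp: up_def FV_subst_tm)

lemma FV_subst: "FV (subst \<sigma> \<phi>) = (\<Union>n\<in>FV \<phi>. FV_tm (\<sigma> n))"
  by (induction \<phi> arbitrary: \<sigma>) (auto simp: FV_subst_tm Suc_in_FV_up)

lemma FV_lift [simp]: "FV (lift \<phi>) = Suc ` FV \<phi>"
  by (auto simp: lift_def FV_subst)

lemma FV_Neg [simp]: "FV (Neg \<phi>) = FV \<phi>"
  by (simp add: Neg_def)

lemma subst_eq_Bot [simp]: "subst \<sigma> \<phi> = Bot \<longleftrightarrow> \<phi> = Bot"
  by (cases \<phi>) auto

lemma Alt_subst [simp]: "Alt (subst \<sigma> \<phi>) = Alt \<phi>"
  by (induction \<phi> arbitrary: \<sigma>) auto

lemma qfree_subst [simp]: "qfree (subst \<sigma> \<phi>) = qfree \<phi>"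
  by (induction \<phi> arbitrary: \<sigma>) auto

text \<open>The forcing clauses for quantifiers speak of instances, which are not subformulas.
  Structural induction on all substitution instances at once gives induction hypotheses for
  them.\<close>

lemma fm_inst_induct [case_names Eq Bot Imp Conj Disj Forall Exists]:
  assumes "\<And>s t. P (Eq s t)" "P Bot"
    and "\<And>\<phi> \<psi>. P \<phi> \<Longrightarrow> P \<psi> \<Longrightarrow> P (Imp \<phi> \<psi>)"
    and "\<And>\<phi> \<psi>. P \<phi> \<Longrightarrow> P \<psi> \<Longrightarrow> P (Conj \<phi> \<psi>)"
    and "\<And>\<phi> \<psi>. P \<phi> \<Longrightarrow> P \<psi> \<Longrightarrow> P (Disj \<phi> \<psi>)"
    and "\<And>\<phi>. (\<And>t. P (inst t \<phi>)) \<Longrightarrow> P (Forall \<phi>)"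
    and "\<And>\<phi>. (\<And>t. P (inst t \<phi>)) \<Longrightarrow> P (Exists \<phi>)"
  shows "P \<phi>"
proof -
  have "P (subst \<sigma> \<phi>)" for \<sigma>
    by (induction \<phi> arbitrary: \<sigma>) (auto intro!: assms)
  from this[of Var] show ?thesis by simp
qed

section \<open>Derivations\<close>

lemma deriv_weaken: "deriv A \<Gamma> \<phi> \<Longrightarrow> \<Gamma> \<subseteq> \<Delta> \<Longrightarrow> deriv A \<Delta> \<phi>"
proof (induction arbitrary: \<Delta> rule: deriv.induct)
  case (ImpI \<phi> \<Gamma> \<psi>)
  then show ?case by (meson deriv.ImpI insert_mono)
next
  case (DisjE \<Gamma> \<phi> \<psi> \<chi>)
  then show ?case by (meson deriv.DisjE insert_mono)
next
  case (ForallI \<Gamma> \<phi>)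
  then show ?case by (meson deriv.ForallI image_mono)
next
  case (ExistsE \<Gamma> \<phi> \<psi>)
  then show ?case by (meson deriv.ExistsE insert_mono image_mono)
next
  case (Assm \<phi> \<Gamma>)
  then show ?case by (metis deriv.Assm subsetD)
next
  case Axiom
  then show ?case by (metis deriv.Axiom)
next
  case BotE
  then show ?case by (metis deriv.BotE)
next
  case ImpE
  then show ?case by (metis deriv.ImpE)
next
  case ConjI
  then show ?case by (metis deriv.ConjI)
next
  case ConjE1
  then show ?case by (metis deriv.ConjE1)
next
  case ConjE2
  then show ?case by (metis deriv.ConjE2)
next
  case DisjI1
  then show ?case by (metis deriv.DisjI1)
next
  case DisjI2
  then show ?case by (metis deriv.DisjI2)
next
  case ForallE
  then show ?case by (metis deriv.ForallE)
next
  case ExistsI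
  then show ?case by (metis deriv.ExistsI)
next
  case EqRefl
  then show ?case by (metis deriv.EqRefl)
next
  case EqSubst
  then show ?case by (metis deriv.EqSubst)
qed

text \<open>The axioms are rederived in the empty context, so that the result survives the lifting
  of contexts at the quantifier rules.\<close>

lemma deriv_axioms:
  assumes "deriv A \<Gamma> \<phi>" "\<And>\<alpha>. \<alpha> \<in> A \<Longrightarrow> deriv B {} \<alpha>"
  shows "deriv B \<Gamma> \<phi>"
  using assms(1)
proof (induction rule: deriv.induct)
  case (Axiom \<phi> \<Gamma>)
  then show ?case using assms(2) by (auto intro: deriv_weaken)
next
  case Assm
  then show ?case by (metis deriv.Assm)
next
  case ImpI
  then show ?case by (metis deriv.ImpI)
next
  case DisjE
  then show ?case by (metis deriv.DisjE)
next
  case ForallI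
  then show ?case by (metis deriv.ForallI)
next
  case ExistsE
  then show ?case by (metis deriv.ExistsE)
next
  case BotE
  then show ?case by (metis deriv.BotE)
next
  case ImpE
  then show ?case by (metis deriv.ImpE)
next
  case ConjI
  then show ?case by (metis deriv.ConjI)
next
  case ConjE1
  then show ?case by (metis deriv.ConjE1)
next
  case ConjE2
  then show ?case by (metis deriv.ConjE2)
next
  case DisjI1
  then show ?case by (metis deriv.DisjI1)
next
  case DisjI2
  then show ?case by (metis deriv.DisjI2)
next
  case ForallE
  then show ?case by (metis deriv.ForallE)
next
  case ExistsI
  then show ?case by (metis deriv.ExistsI)
next
  case EqRefl
  then show ?case by (metis deriv.EqRefl)
next
  case EqSubst
  then show ?case by (metis deriv.EqSubst)
qed

lemma deriv_wf:
  assumes "deriv A \<Gamma> \<phi>" "\<And>\<alpha>. \<alpha> \<in> A \<Longrightarrow> wf_fm \<alpha>"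
  shows "wf_fm \<phi>"
  using assms
proof (induction rule: deriv.induct)
  case (ExistsI \<Gamma> t \<phi>)
  then show ?case by simp
qed auto

text \<open>Serves to discharge an infinite context of instances of excluded middle: only finitely
  many double negations can be combined into one.\<close>

lemma deriv_finite: "deriv A \<Gamma> \<phi> \<Longrightarrow> \<exists>\<Delta>\<subseteq>\<Gamma>. finite \<Delta> \<and> deriv A \<Delta> \<phi>"
proof (induction rule: deriv.induct)
  case (Axiom \<phi> \<Gamma>)
  then show ?case by (intro exI[of _ "{}"]) (auto intro: deriv.Axiom)
next
  case (Assm \<phi> \<Gamma>)
  then show ?case by (intro exI[of _ "{\<phi>}"]) (auto intro: deriv.Assm)
next
  case (ImpI \<phi> \<Gamma> \<psi>)
  then obtain \<Delta> where "\<Delta> \<subseteq> insert \<phi> \<Gamma>" "finite \<Delta>" "deriv A \<Delta> \<psi>" by auto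
  with ImpI.hyps show ?case
    by (intro exI[of _ "\<Delta> - {\<phi>}"] conjI deriv.ImpI) (auto intro: deriv_weaken[of A \<Delta>])
next
  case (DisjE \<Gamma> \<phi> \<psi> \<chi>)
  from DisjE.IH(1) obtain \<Delta>1 where
    1: "\<Delta>1 \<subseteq> \<Gamma>" "finite \<Delta>1" "deriv A \<Delta>1 (Disj \<phi> \<psi>)" by blast
  from DisjE.IH(2) obtain \<Delta>2 where
    2: "\<Delta>2 \<subseteq> insert \<phi> \<Gamma>" "finite \<Delta>2" "deriv A \<Delta>2 \<chi>" by blast
  from DisjE.IH(3) obtain \<Delta>3 where
    3: "\<Delta>3 \<subseteq> insert \<psi> \<Gamma>" "finite \<Delta>3" "deriv A \<Delta>3 \<chi>" by blast
  from 1 2 3 show ?case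
    by (intro exI[of _ "\<Delta>1 \<union> (\<Delta>2 - {\<phi>}) \<union> (\<Delta>3 - {\<psi>})"] conjI
        deriv.DisjE[OF deriv_weaken[OF 1(3)] deriv_weaken[OF 2(3)] deriv_weaken[OF 3(3)]]) auto
next
  case (ForallI \<Gamma> \<phi>)
  then obtain \<Delta> where "\<Delta> \<subseteq> lift ` \<Gamma>" "finite \<Delta>" "deriv A \<Delta> \<phi>" by auto
  then show ?case by (metis deriv.ForallI finite_subset_image)
next
  case (ExistsE \<Gamma> \<phi> \<psi>)
  from ExistsE.IH(1) obtain \<Delta>1 where
    1: "\<Delta>1 \<subseteq> \<Gamma>" "finite \<Delta>1" "deriv A \<Delta>1 (Exists \<phi>)" by blast
  from ExistsE.IH(2) obtain \<Delta>2 where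
    2: "\<Delta>2 \<subseteq> insert \<phi> (lift ` \<Gamma>)" "finite \<Delta>2" "deriv A \<Delta>2 (lift \<psi>)" by blast
  from 2 have "\<Delta>2 - {\<phi>} \<subseteq> lift ` \<Gamma>" "finite (\<Delta>2 - {\<phi>})" by auto
  then obtain \<Delta>3 where "\<Delta>3 \<subseteq> \<Gamma>" "finite \<Delta>3" "\<Delta>2 - {\<phi>} = lift ` \<Delta>3"
    by (metis finite_subset_image)
  with 1 2 show ?case
    by (intro exI[of _ "\<Delta>1 \<union> \<Delta>3"] conjI
        deriv.ExistsE[OF deriv_weaken[OF 1(3)] deriv_weaken[OF 2(3)]]) auto
next
  case (ImpE \<Gamma> \<phi> \<psi>)
  from ImpE.IH(1) obtain \<Delta>1 where
    1: "\<Delta>1 \<subseteq> \<Gamma>" "finite \<Delta>1" "deriv A \<Delta>1 (Imp \<phi> \<psi>)" by blast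
  from ImpE.IH(2) obtain \<Delta>2 where
    2: "\<Delta>2 \<subseteq> \<Gamma>" "finite \<Delta>2" "deriv A \<Delta>2 \<phi>" by blast
  from 1 2 show ?case
    by (intro exI[of _ "\<Delta>1 \<union> \<Delta>2"] conjI
        deriv.ImpE[OF deriv_weaken[OF 1(3)] deriv_weaken[OF 2(3)]]) auto
next
  case (ConjI \<Gamma> \<phi> \<psi>)
  from ConjI.IH(1) obtain \<Delta>1 where
    1: "\<Delta>1 \<subseteq> \<Gamma>" "finite \<Delta>1" "deriv A \<Delta>1 \<phi>" by blast
  from ConjI.IH(2) obtain \<Delta>2 where
    2: "\<Delta>2 \<subseteq> \<Gamma>" "finite \<Delta>2" "deriv A \<Delta>2 \<psi>" by blast
  from 1 2 show ?case
    by (intro exI[of _ "\<Delta>1 \<union> \<Delta>2"] conjI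
        deriv.ConjI[OF deriv_weaken[OF 1(3)] deriv_weaken[OF 2(3)]]) auto
next
  case (EqSubst \<Gamma> s t \<phi>)
  from EqSubst.IH(1) obtain \<Delta>1 where
    1: "\<Delta>1 \<subseteq> \<Gamma>" "finite \<Delta>1" "deriv A \<Delta>1 (Eq s t)" by blast
  from EqSubst.IH(2) obtain \<Delta>2 where
    2: "\<Delta>2 \<subseteq> \<Gamma>" "finite \<Delta>2" "deriv A \<Delta>2 (inst s \<phi>)" by blast
  from 1 2 show ?case
    by (intro exI[of _ "\<Delta>1 \<union> \<Delta>2"] conjI
        deriv.EqSubst[OF deriv_weaken[OF 1(3)] deriv_weaken[OF 2(3)]]) auto
next
  case (EqRefl t \<Gamma>)
  then show ?case by (intro exI[of _ "{}"]) (auto intro: deriv.EqRefl)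
next
  case BotE
  then show ?case by (metis deriv.BotE)
next
  case ConjE1
  then show ?case by (metis deriv.ConjE1)
next
  case ConjE2
  then show ?case by (metis deriv.ConjE2)
next
  case DisjI1
  then show ?case by (metis deriv.DisjI1)
next
  case DisjI2
  then show ?case by (metis deriv.DisjI2)
next
  case ForallE
  then show ?case by (metis deriv.ForallE)
next
  case ExistsI
  then show ?case by (metis deriv.ExistsI)
qed

lemma deriv_instances:
  assumes "deriv A \<Gamma> ((Forall ^^ n) \<phi>)" "\<And>i. wf_tm (\<tau> i)"
  shows "deriv A \<Gamma> (subst (\<lambda>i. if i < n then \<tau> i else Var (i - n)) \<phi>)"
  using assms
proof (induction n arbitrary: \<phi> \<tau>)
  case 0
  then show ?case by simp
next
  case (Suc n)
  let ?\<rho> = "\<lambda>i. if i < n then \<tau> (Suc i) else Var (i - n)"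
  \<comment> \<open>The innermost quantifier, which binds index \<open>0\<close>, is split off; the
    outer \<open>n\<close> are instantiated by the terms from \<open>\<tau> 1\<close> on, and
    \<open>\<tau> 0\<close> comes last.\<close>
  have "deriv A \<Gamma> ((Forall ^^ n) (Forall \<phi>))"
    using Suc.prems(1) by (simp add: funpow_swap1)
  then have "deriv A \<Gamma> (Forall (subst (up ?\<rho>) \<phi>))"
    using Suc.IH[of "Forall \<phi>" "\<lambda>i. \<tau> (Suc i)"] Suc.prems(2) by simp
  from deriv.ForallE[OF this, of "\<tau> 0"] Suc.prems(2)
  have "deriv A \<Gamma> (subst (case_nat (\<tau> 0) ?\<rho>) \<phi>)" by simp
  moreover have "case_nat (\<tau> 0) ?\<rho> = (\<lambda>i. if i < Suc n then \<tau> i else Var (i - Suc n))"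
    by (auto simp: fun_eq_iff split: nat.split)
  ultimately show ?case by simp
qed

lemma FV_bound: "\<exists>n. \<forall>i\<in>FV \<phi>. i < n"
  using finite_nat_set_iff_bounded[of "FV \<phi>"] by simp

lemma deriv_closed_Foralls: "deriv A {} \<phi> \<Longrightarrow> deriv A {} ((Forall ^^ n) \<phi>)"
  by (induction n) (auto intro: deriv.ForallI)

text \<open>A theorem can be closed universally, and instantiating the closure is simultaneous
  substitution. This covers axiom sets that are not closed under substitution.\<close>

lemma deriv_theorem_subst:
  assumes "deriv A {} \<phi>" "\<And>i. wf_tm (\<tau> i)"
  shows "deriv A \<Gamma> (subst \<tau> \<phi>)"
proof -
  obtain n where n: "\<forall>i\<in>FV \<phi>. i < n" using FV_bound by blast
  have "deriv A {} (subst (\<lambda>i. if i < n then \<tau> i else Var (i - n)) \<phi>)"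
    by (rule deriv_instances[OF deriv_closed_Foralls]) (use assms in auto)
  also have "subst (\<lambda>i. if i < n then \<tau> i else Var (i - n)) \<phi> = subst \<tau> \<phi>"
    by (rule subst_cong) (use n in auto)
  finally show ?thesis by (rule deriv_weaken) simp
qed

lemma deriv_subst:
  assumes "deriv A \<Gamma> \<phi>" "\<And>i. wf_tm (\<tau> i)"
  shows "deriv A (subst \<tau> ` \<Gamma>) (subst \<tau> \<phi>)"
  using assms
proof (induction arbitrary: \<tau> rule: deriv.induct)
  case (Axiom \<phi> \<Gamma>)
  then show ?case by (intro deriv_theorem_subst deriv.Axiom) simp_all
next
  case (Assm \<phi> \<Gamma>)
  then show ?case by (intro deriv.Assm) (simp_all add: wf_subst)
next
  case (BotE \<Gamma> \<phi>)
  then show ?case using deriv.BotE[of A "subst \<tau> ` \<Gamma>" "subst \<tau> \<phi>" ] by (simp add: wf_subst)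
next
  case (ImpI \<phi> \<Gamma> \<psi>)
  then show ?case using deriv.ImpI[of "subst \<tau> \<phi>" A "subst \<tau> ` \<Gamma>" "subst \<tau> \<psi>"] by (simp add: wf_subst)
next
  case (ImpE \<Gamma> \<phi> \<psi>)
  then show ?case using deriv.ImpE[of A "subst \<tau> ` \<Gamma>" "subst \<tau> \<phi>" "subst \<tau> \<psi>"] by simp
next
  case (ConjI \<Gamma> \<phi> \<psi>)
  then show ?case using deriv.ConjI[of A "subst \<tau> ` \<Gamma>" "subst \<tau> \<phi>" "subst \<tau> \<psi>"] by simp
next
  case (ConjE1 \<Gamma> \<phi> \<psi>)
  then show ?case using deriv.ConjE1[of A "subst \<tau> ` \<Gamma>" "subst \<tau> \<phi>" "subst \<tau> \<psi>"] by simp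
next
  case (ConjE2 \<Gamma> \<phi> \<psi>)
  then show ?case using deriv.ConjE2[of A "subst \<tau> ` \<Gamma>" "subst \<tau> \<phi>" "subst \<tau> \<psi>"] by simp
next
  case (DisjI1 \<Gamma> \<phi> \<psi>)
  then show ?case using deriv.DisjI1[of A "subst \<tau> ` \<Gamma>" "subst \<tau> \<phi>" "subst \<tau> \<psi>"] by (simp add: wf_subst)
next
  case (DisjI2 \<Gamma> \<phi> \<psi>)
  then show ?case using deriv.DisjI2[of A "subst \<tau> ` \<Gamma>" "subst \<tau> \<phi>" "subst \<tau> \<psi>"] by (simp add: wf_subst)
next
  case (DisjE \<Gamma> \<phi> \<psi> \<chi>)
  then show ?case using deriv.DisjE[of A "subst \<tau> ` \<Gamma>" "subst \<tau> \<phi>" "subst \<tau> \<psi>"] by simp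
next
  case (ForallI \<Gamma> \<phi>)
  have "deriv A (subst (up \<tau>) ` lift ` \<Gamma>) (subst (up \<tau>) \<phi>)"
    using ForallI by (simp add: wf_up)
  then show ?case using deriv.ForallI[of A "subst \<tau> ` \<Gamma>" "subst (up \<tau>) \<phi>"] by (simp add: image_image subst_up_lift)
next
  case (ForallE \<Gamma> \<phi> t)
  then show ?case
    using deriv.ForallE[of A "subst \<tau> ` \<Gamma>" "subst (up \<tau>) \<phi>" "subst_tm \<tau> t"]
    by (simp add: subst_inst wf_subst_tm)
next
  case (ExistsI \<Gamma> t \<phi>)
  then show ?case
    using deriv.ExistsI[of A "subst \<tau> ` \<Gamma>" "subst_tm \<tau> t" "subst (up \<tau>) \<phi>"]
    by (simp add: subst_inst wf_subst_tm)
next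
  case (ExistsE \<Gamma> \<phi> \<psi>)
  have "deriv A (subst (up \<tau>) ` insert \<phi> (lift ` \<Gamma>)) (subst (up \<tau>) (lift \<psi>))"
    using ExistsE by (simp add: wf_up)
  then have "deriv A (insert (subst (up \<tau>) \<phi>) (lift ` subst \<tau> ` \<Gamma>)) (lift (subst \<tau> \<psi>))"
    by (simp add: image_image subst_up_lift)
  then show ?case using ExistsE.IH(1)[of \<tau>] ExistsE.prems by (simp add: deriv.ExistsE)
next
  case (EqRefl t \<Gamma>)
  then show ?case by (simp add: deriv.EqRefl wf_subst_tm)
next
  case (EqSubst \<Gamma> s t \<phi>)
  then show ?case
    using deriv.EqSubst[of A "subst \<tau> ` \<Gamma>" "subst_tm \<tau> s" "subst_tm \<tau> t" "subst (up \<tau>) \<phi>"]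
    by (simp add: subst_inst)
qed

section \<open>Forcing\<close>

text \<open>
  Contexts with finitely many free variables always leave a fresh variable.  Over them derivability
  obeys the clauses of Kripke forcing with the terms as domain, for all connectives but
  disjunction and existence, which keep their elimination rules.
\<close>

typedef world = "{\<Gamma> :: fm set. finite (\<Union>(FV ` \<Gamma>))}"
  morphisms hyps World
  by (intro exI[of _ "{}"]) simp

instantiation world :: order
begin

definition less_eq_world :: "world \<Rightarrow> world \<Rightarrow> bool" where
  "v \<le> w \<longleftrightarrow> hyps v \<subseteq> hyps w"

definition less_world :: "world \<Rightarrow> world \<Rightarrow> bool" where
  "v < w \<longleftrightarrow> hyps v \<subset> hyps w"

instance
  by standard (auto simp: less_eq_world_def less_world_def hyps_inject)

end

definition extend :: "fm \<Rightarrow> world \<Rightarrow> world" where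
  "extend \<phi> w = World (insert \<phi> (hyps w))"

lemma finite_hyps: "finite (\<Union>(FV ` hyps w))"
  using hyps[of w] by simp

lemma hyps_extend [simp]: "hyps (extend \<phi> w) = insert \<phi> (hyps w)"
  unfolding extend_def by (rule World_inverse) (use finite_hyps in simp)

lemma extend_ge [simp]: "w \<le> extend \<phi> w"
  by (auto simp: less_eq_world_def)

text \<open>Stated for any theory above HA because it is used twice: for \<open>T\<close> itself,
  and for PA, where prenex normal forms are computed.\<close>

locale arithmetic =
  fixes T :: "fm set"
  assumes wf_T: "\<phi> \<in> T \<Longrightarrow> wf_fm \<phi>"
    and HA_T: "deriv HA {} \<phi> \<Longrightarrow> deriv T {} \<phi>"
begin

definition forces :: "world \<Rightarrow> fm \<Rightarrow> bool" (infix "\<Turnstile>" 50) where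
  "w \<Turnstile> \<phi> \<longleftrightarrow> deriv T (hyps w) \<phi>"

lemma forces_wf: "w \<Turnstile> \<phi> \<Longrightarrow> wf_fm \<phi>"
  unfolding forces_def using deriv_wf wf_T by blast

lemma forces_mono: "w \<Turnstile> \<phi> \<Longrightarrow> w \<le> w' \<Longrightarrow> w' \<Turnstile> \<phi>"
  unfolding forces_def less_eq_world_def by (rule deriv_weaken)

lemma forces_extend: "wf_fm \<phi> \<Longrightarrow> extend \<phi> w \<Turnstile> \<phi>"
  unfolding forces_def by (auto intro: deriv.Assm)

lemma forces_theorem: "deriv T {} \<phi> \<Longrightarrow> w \<Turnstile> \<phi>"
  unfolding forces_def by (rule deriv_weaken) auto

lemma forces_theorem_subst: "deriv T {} \<phi> \<Longrightarrow> (\<And>n. wf_tm (\<sigma> n)) \<Longrightarrow> w \<Turnstile> subst \<sigma> \<phi>"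
  unfolding forces_def by (rule deriv_theorem_subst)

lemma forces_HA: "\<phi> \<in> HA \<Longrightarrow> w \<Turnstile> \<phi>"
  by (intro forces_theorem HA_T deriv.Axiom)

lemma theorem_iff_forces: "deriv T {} \<phi> \<longleftrightarrow> (\<forall>w. w \<Turnstile> \<phi>)"
proof
  assume "\<forall>w. w \<Turnstile> \<phi>"
  then have "World {} \<Turnstile> \<phi>" by blast
  then show "deriv T {} \<phi>" by (simp add: forces_def World_inverse)
qed (blast intro: forces_theorem)

lemma forces_Imp:
  assumes "wf_fm \<phi>"
  shows "w \<Turnstile> Imp \<phi> \<psi> \<longleftrightarrow> (\<forall>w'\<ge>w. w' \<Turnstile> \<phi> \<longrightarrow> w' \<Turnstile> \<psi>)"
proof
  assume "w \<Turnstile> Imp \<phi> \<psi>"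
  then show "\<forall>w'\<ge>w. w' \<Turnstile> \<phi> \<longrightarrow> w' \<Turnstile> \<psi>"
    using forces_mono unfolding forces_def by (blast intro: deriv.ImpE)
next
  assume "\<forall>w'\<ge>w. w' \<Turnstile> \<phi> \<longrightarrow> w' \<Turnstile> \<psi>"
  \<comment> \<open>The extension by \<open>\<phi>\<close> is the generic world above
    \<open>w\<close> at which \<open>\<phi>\<close> holds.\<close>
  then have "extend \<phi> w \<Turnstile> \<psi>" using forces_extend[OF assms] by simp
  then show "w \<Turnstile> Imp \<phi> \<psi>"
    unfolding forces_def using assms by (auto intro: deriv.ImpI)
qed

lemma forces_ImpI: "wf_fm \<phi> \<Longrightarrow> (\<And>w'. w \<le> w' \<Longrightarrow> w' \<Turnstile> \<phi> \<Longrightarrow> w' \<Turnstile> \<psi>) \<Longrightarrow> w \<Turnstile> Imp \<phi> \<psi>"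
  by (simp add: forces_Imp)

lemma forces_mp: "w \<Turnstile> Imp \<phi> \<psi> \<Longrightarrow> w \<Turnstile> \<phi> \<Longrightarrow> w \<Turnstile> \<psi>"
  unfolding forces_def by (rule deriv.ImpE)

lemma forces_Conj: "w \<Turnstile> Conj \<phi> \<psi> \<longleftrightarrow> w \<Turnstile> \<phi> \<and> w \<Turnstile> \<psi>"
  unfolding forces_def by (meson deriv.ConjI deriv.ConjE1 deriv.ConjE2)

lemma forces_Bot: "w \<Turnstile> Bot \<Longrightarrow> wf_fm \<phi> \<Longrightarrow> w \<Turnstile> \<phi>"
  unfolding forces_def by (rule deriv.BotE)

lemma forces_DisjI1: "w \<Turnstile> \<phi> \<Longrightarrow> wf_fm \<psi> \<Longrightarrow> w \<Turnstile> Disj \<phi> \<psi>"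
  unfolding forces_def by (rule deriv.DisjI1)

lemma forces_DisjI2: "w \<Turnstile> \<psi> \<Longrightarrow> wf_fm \<phi> \<Longrightarrow> w \<Turnstile> Disj \<phi> \<psi>"
  unfolding forces_def by (rule deriv.DisjI2)

lemma forces_DisjE:
  assumes "w \<Turnstile> Disj \<phi> \<psi>"
    and "\<And>w'. w \<le> w' \<Longrightarrow> w' \<Turnstile> \<phi> \<Longrightarrow> w' \<Turnstile> \<chi>" "\<And>w'. w \<le> w' \<Longrightarrow> w' \<Turnstile> \<psi> \<Longrightarrow> w' \<Turnstile> \<chi>"
  shows "w \<Turnstile> \<chi>"
proof -
  have "wf_fm \<phi>" "wf_fm \<psi>" using forces_wf[OF assms(1)] by auto
  then have "extend \<phi> w \<Turnstile> \<chi>" "extend \<psi> w \<Turnstile> \<chi>"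
    using assms(2,3) forces_extend extend_ge by blast+
  then show ?thesis using assms(1) unfolding forces_def by (auto intro: deriv.DisjE)
qed

lemma fresh_variable: "\<exists>x. x \<notin> FV \<phi> \<and> x \<notin> FV \<psi> \<and> (\<forall>\<gamma>\<in>hyps w. x \<notin> FV \<gamma>)"
proof -
  have "finite (FV \<phi> \<union> FV \<psi> \<union> \<Union>(FV ` hyps w))" using finite_hyps by simp
  from ex_new_if_finite[OF infinite_UNIV_nat this]
  obtain x where "x \<notin> FV \<phi> \<union> FV \<psi> \<union> \<Union>(FV ` hyps w)" ..
  then show ?thesis by auto
qed

text \<open>Renaming the fresh variable \<open>x\<close> to \<open>0\<close> and shifting the others undoes \<open>inst (Var x)\<close>.\<close>

lemma subst_fresh:
  fixes x :: nat
  defines "\<sigma> \<equiv> \<lambda>n. if n = x then Var 0 else Var (Suc n)"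
  shows "x \<notin> FV \<phi> \<Longrightarrow> subst \<sigma> \<phi> = lift \<phi>"
    and "x \<notin> FV (Forall \<phi>) \<Longrightarrow> subst \<sigma> (inst (Var x) \<phi>) = \<phi>"
proof -
  show "subst \<sigma> \<phi> = lift \<phi>" if "x \<notin> FV \<phi>"
    unfolding lift_def by (rule subst_cong) (use that in \<open>auto simp: \<sigma>_def\<close>)
  assume x: "x \<notin> FV (Forall \<phi>)"
  have "subst (case_nat (subst_tm \<sigma> (Var x)) \<sigma>) \<phi> = subst Var \<phi>"
  proof (rule subst_cong)
    fix n assume "n \<in> FV \<phi>"
    with x show "case_nat (subst_tm \<sigma> (Var x)) \<sigma> n = Var n"
      by (cases n) (auto simp: \<sigma>_def)
  qed
  then show "subst \<sigma> (inst (Var x) \<phi>) = \<phi>" by (simp add: subst_inst)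
qed

lemma forces_Forall: "w \<Turnstile> Forall \<phi> \<longleftrightarrow> (\<forall>t. wf_tm t \<longrightarrow> w \<Turnstile> inst t \<phi>)"
proof
  assume "w \<Turnstile> Forall \<phi>"
  then show "\<forall>t. wf_tm t \<longrightarrow> w \<Turnstile> inst t \<phi>"
    unfolding forces_def by (blast intro: deriv.ForallE)
next
  assume *: "\<forall>t. wf_tm t \<longrightarrow> w \<Turnstile> inst t \<phi>"
  obtain x where x: "x \<notin> FV (Forall \<phi>)" "\<forall>\<gamma>\<in>hyps w. x \<notin> FV \<gamma>" using fresh_variable by blast
  let ?\<sigma> = "\<lambda>n. if n = x then Var 0 else Var (Suc n)"
  \<comment> \<open>The instance at a fresh variable is generic: renaming that variable to
    \<open>0\<close> and shifting the others yields exactly the premise of the introduction rule,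
    with the context lifted.\<close>
  have "deriv T (subst ?\<sigma> ` hyps w) (subst ?\<sigma> (inst (Var x) \<phi>))"
    by (rule deriv_subst) (use * in \<open>auto simp: forces_def\<close>)
  moreover have "subst ?\<sigma> ` hyps w = lift ` hyps w"
    by (rule image_cong) (use x(2) in \<open>auto simp: subst_fresh(1)\<close>)
  ultimately have "deriv T (lift ` hyps w) \<phi>" using x(1) subst_fresh(2)[of x \<phi>] by simp
  then show "w \<Turnstile> Forall \<phi>" unfolding forces_def by (rule deriv.ForallI)
qed

lemma forces_ExistsI: "w \<Turnstile> inst t \<phi> \<Longrightarrow> wf_tm t \<Longrightarrow> w \<Turnstile> Exists \<phi>"
  unfolding forces_def by (rule deriv.ExistsI)

lemma forces_ExistsE:
  assumes "w \<Turnstile> Exists \<phi>"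
    and "\<And>w' t. w \<le> w' \<Longrightarrow> wf_tm t \<Longrightarrow> w' \<Turnstile> inst t \<phi> \<Longrightarrow> w' \<Turnstile> \<chi>"
  shows "w \<Turnstile> \<chi>"
proof -
  obtain x where x: "x \<notin> FV (Forall \<phi>)" "x \<notin> FV \<chi>" "\<forall>\<gamma>\<in>hyps w. x \<notin> FV \<gamma>"
    using fresh_variable by blast
  let ?\<sigma> = "\<lambda>n. if n = x then Var 0 else Var (Suc n)"
  have "wf_fm (inst (Var x) \<phi>)" using forces_wf[OF assms(1)] by simp
  then have "extend (inst (Var x) \<phi>) w \<Turnstile> \<chi>" by (intro assms(2)[of _ "Var x"] forces_extend) auto
  then have "deriv T (subst ?\<sigma> ` insert (inst (Var x) \<phi>) (hyps w)) (subst ?\<sigma> \<chi>)"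
    by (intro deriv_subst) (auto simp: forces_def)
  moreover have "subst ?\<sigma> ` insert (inst (Var x) \<phi>) (hyps w) = insert \<phi> (lift ` hyps w)"
    using x(3) subst_fresh(2)[OF x(1)] by (auto simp: subst_fresh(1) image_iff)
  ultimately have "deriv T (insert \<phi> (lift ` hyps w)) (lift \<chi>)" using x(2) subst_fresh(1) by simp
  then show ?thesis using assms(1) unfolding forces_def by (auto intro: deriv.ExistsE)
qed

lemma forces_Eq_refl: "wf_tm t \<Longrightarrow> w \<Turnstile> Eq t t"
  unfolding forces_def by (rule deriv.EqRefl)

lemma forces_Eq_subst: "w \<Turnstile> Eq s t \<Longrightarrow> w \<Turnstile> inst s \<phi> \<Longrightarrow> w \<Turnstile> inst t \<phi>"
  unfolding forces_def by (rule deriv.EqSubst)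

lemma forces_Neg: "wf_fm \<phi> \<Longrightarrow> w \<Turnstile> Neg \<phi> \<longleftrightarrow> (\<forall>w'\<ge>w. w' \<Turnstile> \<phi> \<longrightarrow> w' \<Turnstile> Bot)"
  unfolding Neg_def by (rule forces_Imp)

lemma forces_Iff:
  assumes "wf_fm \<phi>" "wf_fm \<psi>"
  shows "w \<Turnstile> Iff \<phi> \<psi> \<longleftrightarrow> (\<forall>w'\<ge>w. w' \<Turnstile> \<phi> \<longleftrightarrow> w' \<Turnstile> \<psi>)"
  unfolding Iff_def by (auto simp: forces_Conj forces_Imp assms)

lemma theorem_Iff:
  assumes "wf_fm \<phi>" "wf_fm \<psi>"
  shows "deriv T {} (Iff \<phi> \<psi>) \<longleftrightarrow> (\<forall>w. w \<Turnstile> \<phi> \<longleftrightarrow> w \<Turnstile> \<psi>)"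
  by (auto simp: theorem_iff_forces forces_Iff[OF assms])

subsection \<open>Double negation relative to a formula\<close>

text \<open>The continuation monad with answer formula \<open>A\<close>: \<open>dnegI\<close> is its
  unit and \<open>dneg_bind\<close> its bind.\<close>

definition dneg :: "fm \<Rightarrow> fm \<Rightarrow> fm" where
  "dneg A \<phi> = Imp (Imp \<phi> A) A"

lemma wf_dneg [simp]: "wf_fm A \<Longrightarrow> wf_fm (dneg A \<phi>) = wf_fm \<phi>"
  by (simp add: dneg_def)

lemma inst_dneg: "inst t (dneg A \<phi>) = dneg (inst t A) (inst t \<phi>)"
  by (simp add: dneg_def)

lemma Neg_Neg: "Neg (Neg \<phi>) = dneg Bot \<phi>"
  by (simp add: Neg_def dneg_def)

lemma dnegI: "w \<Turnstile> \<phi> \<Longrightarrow> wf_fm A \<Longrightarrow> w \<Turnstile> dneg A \<phi>"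
  unfolding dneg_def using forces_wf[of w \<phi>] forces_mono
  by (auto intro!: forces_ImpI intro: forces_mp)

lemma forces_dneg:
  assumes "wf_fm \<phi>" "wf_fm A"
  shows "w \<Turnstile> dneg A \<phi> \<longleftrightarrow>
    (\<forall>w'\<ge>w. (\<forall>w''\<ge>w'. w'' \<Turnstile> \<phi> \<longrightarrow> w'' \<Turnstile> A) \<longrightarrow> w' \<Turnstile> A)"
  unfolding dneg_def by (simp add: forces_Imp assms)

lemma dnegE:
  assumes "w \<Turnstile> dneg A \<phi>" "\<And>w'. w \<le> w' \<Longrightarrow> w' \<Turnstile> \<phi> \<Longrightarrow> w' \<Turnstile> A"
  shows "w \<Turnstile> A"
proof -
  have "wf_fm \<phi>" using forces_wf[OF assms(1)] by (simp add: dneg_def)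
  then have "w \<Turnstile> Imp \<phi> A" by (rule forces_ImpI) (rule assms(2))
  with assms(1) show ?thesis unfolding dneg_def by (rule forces_mp)
qed

lemma dneg_bind:
  assumes "w \<Turnstile> dneg A \<phi>" "wf_fm \<psi>" "\<And>w'. w \<le> w' \<Longrightarrow> w' \<Turnstile> \<phi> \<Longrightarrow> w' \<Turnstile> dneg A \<psi>"
  shows "w \<Turnstile> dneg A \<psi>"
proof -
  have wf: "wf_fm \<phi>" "wf_fm A" using forces_wf[OF assms(1)] by (simp_all add: dneg_def)
  show ?thesis
    using assms unfolding forces_dneg[OF wf] forces_dneg[OF assms(2) wf(2)] by (meson order_trans)
qed

lemma dneg_map:
  assumes "w \<Turnstile> dneg A \<phi>" "wf_fm \<psi>" "\<And>w'. w \<le> w' \<Longrightarrow> w' \<Turnstile> \<phi> \<Longrightarrow> w' \<Turnstile> \<psi>"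
  shows "w \<Turnstile> dneg A \<psi>"
proof -
  have "wf_fm A" using forces_wf[OF assms(1)] by (simp add: dneg_def)
  with assms show ?thesis by (auto intro: dneg_bind dnegI)
qed

lemma dneg_A: "w \<Turnstile> A \<Longrightarrow> wf_fm \<phi> \<Longrightarrow> w \<Turnstile> dneg A \<phi>"
  unfolding dneg_def using forces_wf[of w A] by (auto intro!: forces_ImpI intro: forces_mono)

lemma dneg_Bot: "w \<Turnstile> Bot \<Longrightarrow> wf_fm \<phi> \<Longrightarrow> wf_fm A \<Longrightarrow> w \<Turnstile> dneg A \<phi>"
  by (rule forces_Bot) auto

end

section \<open>The negative translation relative to a formula\<close>

text \<open>The Goedel-Gentzen translation with \<open>A\<close> in place of falsity (Friedman's A-translation of it).\<close>

fun ntr :: "fm \<Rightarrow> fm \<Rightarrow> fm" where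
  "ntr A (Eq s t) = Imp (Imp (Eq s t) A) A"
| "ntr A Bot = A"
| "ntr A (Imp \<phi> \<psi>) = Imp (ntr A \<phi>) (ntr A \<psi>)"
| "ntr A (Conj \<phi> \<psi>) = Conj (ntr A \<phi>) (ntr A \<psi>)"
| "ntr A (Disj \<phi> \<psi>) = Imp (Imp (Disj (ntr A \<phi>) (ntr A \<psi>)) A) A"
| "ntr A (Forall \<phi>) = Forall (ntr (lift A) \<phi>)"
| "ntr A (Exists \<phi>) = Imp (Imp (Exists (ntr (lift A) \<phi>)) A) A"

lemma wf_ntr [simp]: "wf_fm A \<Longrightarrow> wf_fm (ntr A \<phi>) = wf_fm \<phi>"
  by (induction \<phi> arbitrary: A) auto

lemma ntr_subst: "ntr (subst \<sigma> A) (subst \<sigma> \<phi>) = subst \<sigma> (ntr A \<phi>)"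
  by (induction \<phi> arbitrary: A \<sigma>) (auto simp flip: subst_up_lift)

text \<open>\<open>A\<close> is lifted under each binder, so instantiation gives \<open>A\<close>
  back unchanged; forcing arguments can therefore keep one fixed \<open>A\<close>.\<close>

lemma inst_ntr [simp]: "inst t (ntr (lift A) \<phi>) = ntr A (inst t \<phi>)"
  by (metis inst_def inst_lift ntr_subst)

lemma subst_Induction: "subst \<sigma> (Induction \<phi>) = Induction (subst (up \<sigma>) \<phi>)"
proof -
  have "(\<lambda>n. subst_tm (up \<sigma>) (case_nat (suc_tm (Var 0)) (\<lambda>n. Var (Suc n)) n)) =
    (\<lambda>n. subst_tm (case_nat (suc_tm (Var 0)) (\<lambda>n. Var (Suc n))) (up \<sigma> n))"
    by (auto simp: fun_eq_iff up_def suc_tm_def subst_tm_subst_tm split: nat.split)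
  then show ?thesis
    by (simp add: Induction_def subst_inst zero_tm_def) (simp add: subst_subst)
qed

text \<open>The schema is closed under the translation because the successor substitution acts on
  index \<open>0\<close> alone, which does not occur in \<open>lift A\<close>.\<close>

lemma ntr_Induction: "ntr A (Induction \<phi>) = Induction (ntr (lift A) \<phi>)"
proof -
  have "ntr (lift A) (subst (case_nat (suc_tm (Var 0)) (\<lambda>n. Var (Suc n))) \<phi>) =
    subst (case_nat (suc_tm (Var 0)) (\<lambda>n. Var (Suc n))) (ntr (lift A) \<phi>)"
    unfolding ntr_subst[symmetric] by (simp add: lift_def subst_subst)
  then show ?thesis by (simp add: Induction_def)
qed

lemma HA_wf: "\<phi> \<in> HA \<Longrightarrow> wf_fm \<phi>"
proof (induction rule: HA.induct)
  case (induction \<phi>)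
  then show ?case
    by (auto simp: Induction_def zero_tm_def suc_tm_def wf_subst)
qed (auto simp: suc_tm_def zero_tm_def)

lemma PA_wf: "\<phi> \<in> PA \<Longrightarrow> wf_fm \<phi>"
  by (auto simp: PA_def HA_wf)

lemma HA_subst: "\<phi> \<in> HA \<Longrightarrow> (\<And>n. wf_tm (\<sigma> n)) \<Longrightarrow> subst \<sigma> \<phi> \<in> HA"
proof (induction rule: HA.induct)
  case (suc_nonzero t)
  then show ?case using HA.suc_nonzero[of "subst_tm \<sigma> t"] by (simp add: suc_tm_def zero_tm_def wf_subst_tm)
next
  case (suc_inject s t)
  then show ?case using HA.suc_inject[of "subst_tm \<sigma> s" "subst_tm \<sigma> t"] by (simp add: suc_tm_def wf_subst_tm)
next
  case (proj n i ts)
  then show ?case using HA.proj[of n i "map (subst_tm \<sigma>) ts"] by (simp add: wf_subst_tm)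
next
  case (comp n f gs ts)
  then show ?case using HA.comp[of n f gs "map (subst_tm \<sigma>) ts"] by (simp add: wf_subst_tm o_def)
next
  case (rec_zero f g ts)
  then show ?case using HA.rec_zero[of f g "map (subst_tm \<sigma>) ts"] by (simp add: wf_subst_tm zero_tm_def)
next
  case (rec_suc f g t ts)
  then show ?case using HA.rec_suc[of f g "subst_tm \<sigma> t" "map (subst_tm \<sigma>) ts"]
    by (simp add: wf_subst_tm suc_tm_def)
next
  case (induction \<phi>)
  then show ?case using HA.induction[of "subst (up \<sigma>) \<phi>"] by (simp add: subst_Induction wf_subst wf_up)
qed

section \<open>Stability and soundness of the translation\<close>

context arithmetic
begin

text \<open>Each clause is either a double negation relative to \<open>A\<close>, or
  \<open>A\<close> itself, or built by implication, conjunction or universal quantification, which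
  preserve stability.\<close>

lemma ntr_stable: "w \<Turnstile> dneg A (ntr A \<phi>) \<Longrightarrow> wf_fm A \<Longrightarrow> w \<Turnstile> ntr A \<phi>"
proof (induction \<phi> arbitrary: w rule: fm_inst_induct)
  case (Eq s t)
  then have wf: "wf_fm (Eq s t)" using forces_wf by fastforce
  show ?case
    unfolding ntr.simps
    by (fold dneg_def, rule dneg_bind[OF Eq(1) wf]) (simp add: dneg_def)
next
  case Bot
  then show ?case by (auto elim: dnegE)
next
  case (Imp \<phi> \<psi>)
  then have wf: "wf_fm \<phi>" "wf_fm \<psi>" using forces_wf by fastforce+
  have "w' \<Turnstile> ntr A \<psi>" if w: "w \<le> w'" "w' \<Turnstile> ntr A \<phi>" for w'
  proof (rule Imp.IH(2)[OF _ Imp.prems(2)])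
    show "w' \<Turnstile> dneg A (ntr A \<psi>)"
      by (rule dneg_map[OF forces_mono[OF Imp.prems(1) w(1)]])
        (use wf w Imp.prems in \<open>auto intro: forces_mp forces_mono\<close>)
  qed
  then show ?case using wf Imp.prems by (auto intro: forces_ImpI)
next
  case (Conj \<phi> \<psi>)
  then have wf: "wf_fm \<phi>" "wf_fm \<psi>" using forces_wf by fastforce+
  have "w \<Turnstile> dneg A (ntr A \<phi>)" "w \<Turnstile> dneg A (ntr A \<psi>)"
    by (rule dneg_map[OF Conj.prems(1)]; use wf Conj.prems(2) in \<open>simp add: forces_Conj\<close>)+
  then show ?case using Conj by (simp add: forces_Conj)
next
  case (Disj \<phi> \<psi>)
  then have wf: "wf_fm \<phi>" "wf_fm \<psi>" using forces_wf by fastforce+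
  show ?case
    unfolding ntr.simps
    by (fold dneg_def, rule dneg_bind[OF Disj.prems(1)]) (use wf Disj.prems(2) in \<open>simp_all add: dneg_def\<close>)
next
  case (Forall \<phi>)
  then have wf: "wf_fm \<phi>" using forces_wf by fastforce
  have "w \<Turnstile> ntr A (inst t \<phi>)" if "wf_tm t" for t
  proof (rule Forall.IH[OF _ Forall.prems(2)])
    show "w \<Turnstile> dneg A (ntr A (inst t \<phi>))"
      by (rule dneg_map[OF Forall.prems(1)]) (use wf that Forall.prems(2) in \<open>simp_all add: forces_Forall\<close>)
  qed
  then show ?case by (simp add: forces_Forall)
next
  case (Exists \<phi>)
  then have wf: "wf_fm \<phi>" using forces_wf by fastforce
  show ?case
    unfolding ntr.simps
    by (fold dneg_def, rule dneg_bind[OF Exists.prems(1)]) (use wf Exists.prems(2) in \<open>simp_all add: dneg_def\<close>)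
qed

lemma ntr_A: "w \<Turnstile> A \<Longrightarrow> wf_fm \<phi> \<Longrightarrow> w \<Turnstile> ntr A \<phi>"
  using forces_wf[of w A] by (intro ntr_stable dneg_A) auto

lemma ntr_bind:
  assumes "w \<Turnstile> dneg A \<phi>" "wf_fm \<psi>" "\<And>w'. w \<le> w' \<Longrightarrow> w' \<Turnstile> \<phi> \<Longrightarrow> w' \<Turnstile> ntr A \<psi>"
  shows "w \<Turnstile> ntr A \<psi>"
proof -
  have wf: "wf_fm A" using forces_wf[OF assms(1)] by (simp add: dneg_def)
  show ?thesis
    by (rule ntr_stable[OF dneg_map[OF assms(1)]]) (use assms wf in auto)
qed

text \<open>Allows the double negations in (2) to be dropped as soon as both sides are
  translated.\<close>

lemma ntr_dneg_iff:
  assumes "wf_fm A" "wf_fm \<phi>"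
  shows "w \<Turnstile> ntr A (Neg (Neg \<phi>)) \<longleftrightarrow> w \<Turnstile> ntr A \<phi>"
  using assms ntr_stable[of w A \<phi>] dnegI[of w "ntr A \<phi>" A]
  by (auto simp: Neg_def dneg_def)

text \<open>The equations pass through the unit of the monad, the successor axioms through its
  functoriality and ex falso, and induction goes to induction.\<close>

lemma ntr_HA:
  assumes "\<phi> \<in> HA" "wf_fm A"
  shows "w \<Turnstile> ntr A \<phi>"
  using assms(1)
proof cases
  case (suc_nonzero t)
  have *: "w' \<Turnstile> A" if "w' \<Turnstile> Eq (suc_tm t) zero_tm" for w'
    using forces_mp[OF forces_HA[OF assms(1)[unfolded suc_nonzero Neg_def]] that] assms(2)
    by (rule forces_Bot)
  have "w' \<Turnstile> A" if "w' \<Turnstile> dneg A (Eq (suc_tm t) zero_tm)" for w'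
    using that by (rule dnegE) (rule *)
  then show ?thesis
    using suc_nonzero HA_wf[OF assms(1)] assms(2)
    by (auto simp: Neg_def dneg_def intro: forces_ImpI)
next
  case (suc_inject s t)
  have "w' \<Turnstile> dneg A (Eq s t)" if "w' \<Turnstile> dneg A (Eq (suc_tm s) (suc_tm t))" for w'
    using that by (rule dneg_map)
      (use suc_inject assms forces_mp[OF forces_HA[OF assms(1)[unfolded suc_inject]]] in auto)
  then show ?thesis
    using suc_inject HA_wf[OF assms(1)] assms(2) by (auto simp: dneg_def intro: forces_ImpI)
next
  case (proj n i ts)
  then show ?thesis using dnegI[OF forces_HA[OF assms(1)] assms(2)] by (simp add: dneg_def)
next
  case (comp n f gs ts)
  then show ?thesis using dnegI[OF forces_HA[OF assms(1)] assms(2)] by (simp add: dneg_def)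
next
  case (rec_zero f g ts)
  then show ?thesis using dnegI[OF forces_HA[OF assms(1)] assms(2)] by (simp add: dneg_def)
next
  case (rec_suc f g t ts)
  then show ?thesis using dnegI[OF forces_HA[OF assms(1)] assms(2)] by (simp add: dneg_def)
next
  case (induction \<phi>)
  then show ?thesis using assms(2) by (auto simp: ntr_Induction intro!: forces_HA HA.induction)
qed

lemma ntr_excluded_middle:
  assumes "wf_fm A" "wf_fm \<phi>"
  shows "w \<Turnstile> ntr A (Disj \<phi> (Neg \<phi>))"
proof -
  let ?D = "Disj (ntr A \<phi>) (Imp (ntr A \<phi>) A)"
  have "w' \<Turnstile> A" if w': "w' \<Turnstile> Imp ?D A" for w'
  proof -
    have "w'' \<Turnstile> A" if "w' \<le> w''" "w'' \<Turnstile> ntr A \<phi>" for w''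
      \<comment> \<open>The usual argument: refuting the disjunction refutes its left side, which is
        the right side.\<close>
      by (rule forces_mp[OF forces_mono[OF w' that(1)] forces_DisjI1[OF that(2)]]) (use assms in simp)
    then have "w' \<Turnstile> Imp (ntr A \<phi>) A" using assms by (auto intro: forces_ImpI)
    from forces_mp[OF w' forces_DisjI2[OF this]] assms show ?thesis by simp
  qed
  then show ?thesis using assms by (auto simp: Neg_def intro: forces_ImpI)
qed

text \<open>Generalized over \<open>\<sigma>\<close> so that at the quantifier rules the
  eigenvariable can be sent to any term, by \<open>case_nat t \<sigma>\<close>. A lifted context
  then has the same instances as before, and \<open>A\<close> stays fixed throughout.\<close>

theorem ntr_sound_context:
  assumes "deriv PA \<Gamma> \<phi>" "wf_fm A" "\<And>n. wf_tm (\<sigma> n)" "\<And>\<gamma>. \<gamma> \<in> \<Gamma> \<Longrightarrow> w \<Turnstile> ntr A (subst \<sigma> \<gamma>)"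
  shows "w \<Turnstile> ntr A (subst \<sigma> \<phi>)"
  using assms(1,3,4)
proof (induction arbitrary: \<sigma> w rule: deriv.induct)
  case (Axiom \<phi> \<Gamma>)
  then consider "\<phi> \<in> HA" | \<psi> where "\<phi> = Disj \<psi> (Neg \<psi>)" "wf_fm \<psi>"
    by (auto simp: PA_def)
  then show ?case
  proof cases
    case 1
    then show ?thesis using assms(2) Axiom.prems(1) by (intro ntr_HA HA_subst)
  next
    case 2
    then show ?thesis
      using assms(2) Axiom.prems(1) ntr_excluded_middle[of A "subst \<sigma> \<psi>" w] by (simp add: wf_subst)
  qed
next
  case (Assm \<phi> \<Gamma>)
  then show ?case by blast
next
  case (BotE \<Gamma> \<phi>)
  from BotE.IH[of \<sigma> w] BotE.prems have "w \<Turnstile> A" by simp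
  then show ?case using BotE by (intro ntr_A) (simp_all add: wf_subst)
next
  case (ImpI \<phi> \<Gamma> \<psi>)
  have "w' \<Turnstile> ntr A (subst \<sigma> \<psi>)" if "w \<le> w'" "w' \<Turnstile> ntr A (subst \<sigma> \<phi>)" for w'
    using that ImpI.prems(1) by (intro ImpI.IH) (auto intro: forces_mono[OF ImpI.prems(2)])
  then show ?case using ImpI.hyps ImpI.prems(1) assms(2) by (auto simp: wf_subst intro: forces_ImpI)
next
  case (ImpE \<Gamma> \<phi> \<psi>)
  from ImpE.IH(1)[of \<sigma> w] ImpE.IH(2)[of \<sigma> w] ImpE.prems show ?case by (auto intro: forces_mp)
next
  case (ConjI \<Gamma> \<phi> \<psi>)
  from ConjI.IH(1)[of \<sigma> w] ConjI.IH(2)[of \<sigma> w] ConjI.prems show ?case by (simp add: forces_Conj)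
next
  case (ConjE1 \<Gamma> \<phi> \<psi>)
  from ConjE1.IH[of \<sigma> w] ConjE1.prems show ?case by (simp add: forces_Conj)
next
  case (ConjE2 \<Gamma> \<phi> \<psi>)
  from ConjE2.IH[of \<sigma> w] ConjE2.prems show ?case by (simp add: forces_Conj)
next
  case (DisjI1 \<Gamma> \<phi> \<psi>)
  then have "w \<Turnstile> Disj (ntr A (subst \<sigma> \<phi>)) (ntr A (subst \<sigma> \<psi>))"
    using assms(2) by (auto intro!: forces_DisjI1 simp: wf_subst)
  from dnegI[OF this assms(2)] show ?case by (simp add: dneg_def)
next
  case (DisjI2 \<Gamma> \<psi> \<phi>)
  then have "w \<Turnstile> Disj (ntr A (subst \<sigma> \<phi>)) (ntr A (subst \<sigma> \<psi>))"
    using assms(2) by (auto intro!: forces_DisjI2 simp: wf_subst)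
  from dnegI[OF this assms(2)] show ?case by (simp add: dneg_def)
next
  case (DisjE \<Gamma> \<phi> \<psi> \<chi>)
  have "wf_fm \<chi>" using deriv_wf[OF DisjE.hyps(2) PA_wf] .
  have "w \<Turnstile> dneg A (Disj (ntr A (subst \<sigma> \<phi>)) (ntr A (subst \<sigma> \<psi>)))"
    using DisjE.IH(1)[of \<sigma> w] DisjE.prems by (simp add: dneg_def)
  then show ?case
  proof (rule ntr_bind)
    fix w' assume w': "w \<le> w'" "w' \<Turnstile> Disj (ntr A (subst \<sigma> \<phi>)) (ntr A (subst \<sigma> \<psi>))"
    show "w' \<Turnstile> ntr A (subst \<sigma> \<chi>)"
      using w'(2)
    proof (rule forces_DisjE)
      fix w'' assume w'': "w' \<le> w''" "w'' \<Turnstile> ntr A (subst \<sigma> \<phi>)"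
      show "w'' \<Turnstile> ntr A (subst \<sigma> \<chi>)"
        using DisjE.prems(1) w''(2)
        by (intro DisjE.IH(2)) (auto intro: forces_mono[OF DisjE.prems(2) order_trans[OF w'(1) w''(1)]])
    next
      fix w'' assume w'': "w' \<le> w''" "w'' \<Turnstile> ntr A (subst \<sigma> \<psi>)"
      show "w'' \<Turnstile> ntr A (subst \<sigma> \<chi>)"
        using DisjE.prems(1) w''(2)
        by (intro DisjE.IH(3)) (auto intro: forces_mono[OF DisjE.prems(2) order_trans[OF w'(1) w''(1)]])
    qed
  qed (use \<open>wf_fm \<chi>\<close> DisjE.prems(1) in \<open>simp add: wf_subst\<close>)
next
  case (ForallI \<Gamma> \<phi>)
  have "w \<Turnstile> ntr A (subst (case_nat t \<sigma>) \<phi>)" if "wf_tm t" for t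
    using that ForallI.prems by (intro ForallI.IH) auto
  then show ?case by (simp add: forces_Forall)
next
  case (ForallE \<Gamma> \<phi> t)
  from ForallE.IH[of \<sigma> w] ForallE.prems ForallE.hyps show ?case
    by (simp add: forces_Forall subst_inst wf_subst_tm)
next
  case (ExistsI \<Gamma> t \<phi>)
  from ExistsI.IH[of \<sigma> w] ExistsI.prems
  have "w \<Turnstile> inst (subst_tm \<sigma> t) (ntr (lift A) (subst (up \<sigma>) \<phi>))" by (simp add: subst_inst)
  then have "w \<Turnstile> Exists (ntr (lift A) (subst (up \<sigma>) \<phi>))"
    by (rule forces_ExistsI) (use ExistsI in \<open>simp add: wf_subst_tm\<close>)
  from dnegI[OF this assms(2)] show ?case by (simp add: dneg_def)
next
  case (ExistsE \<Gamma> \<phi> \<psi>)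
  have "wf_fm (lift \<psi>)" using deriv_wf[OF ExistsE.hyps(2) PA_wf] .
  have "w \<Turnstile> dneg A (Exists (ntr (lift A) (subst (up \<sigma>) \<phi>)))"
    using ExistsE.IH(1)[of \<sigma> w] ExistsE.prems by (simp add: dneg_def)
  then show ?case
  proof (rule ntr_bind)
    fix w' assume w': "w \<le> w'" "w' \<Turnstile> Exists (ntr (lift A) (subst (up \<sigma>) \<phi>))"
    show "w' \<Turnstile> ntr A (subst \<sigma> \<psi>)"
      using w'(2)
    proof (rule forces_ExistsE)
      fix w'' t assume w'': "w' \<le> w''" "wf_tm t" "w'' \<Turnstile> inst t (ntr (lift A) (subst (up \<sigma>) \<phi>))"
      have "w'' \<Turnstile> ntr A (subst (case_nat t \<sigma>) (lift \<psi>))"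
        using w''(2,3) ExistsE.prems(1)
        by (intro ExistsE.IH(2)) (auto intro: forces_mono[OF ExistsE.prems(2) order_trans[OF w'(1) w''(1)]])
      then show "w'' \<Turnstile> ntr A (subst \<sigma> \<psi>)" by simp
    qed
  qed (use \<open>wf_fm (lift \<psi>)\<close> ExistsE.prems(1) in \<open>simp add: wf_subst\<close>)
next
  case (EqRefl t \<Gamma>)
  then show ?case
    using dnegI[OF forces_Eq_refl[of "subst_tm \<sigma> t" w] assms(2)] by (simp add: dneg_def wf_subst_tm)
next
  case (EqSubst \<Gamma> s t \<phi>)
  have wf: "wf_fm (inst s \<phi>)" "wf_fm (Eq s t)"
    using deriv_wf[OF EqSubst.hyps(1) PA_wf] deriv_wf[OF EqSubst.hyps(2) PA_wf] by blast+
  have "w \<Turnstile> dneg A (Eq (subst_tm \<sigma> s) (subst_tm \<sigma> t))"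
    using EqSubst.IH(1)[of \<sigma> w] EqSubst.prems by (simp add: dneg_def)
  then show ?case
  proof (rule ntr_bind)
    fix w' assume w': "w \<le> w'" "w' \<Turnstile> Eq (subst_tm \<sigma> s) (subst_tm \<sigma> t)"
    have "w' \<Turnstile> inst (subst_tm \<sigma> s) (ntr (lift A) (subst (up \<sigma>) \<phi>))"
      using forces_mono[OF EqSubst.IH(2)[of \<sigma> w] w'(1)] EqSubst.prems by (simp add: subst_inst)
    from forces_Eq_subst[OF w'(2) this] show "w' \<Turnstile> ntr A (subst \<sigma> (inst t \<phi>))"
      by (simp add: subst_inst)
  qed (use wf EqSubst.prems(1) in \<open>simp add: wf_subst\<close>)
qed

theorem ntr_sound: "deriv PA {} \<phi> \<Longrightarrow> wf_fm A \<Longrightarrow> w \<Turnstile> ntr A \<phi>"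
  using ntr_sound_context[of "{}" \<phi> A Var w] by simp

end

section \<open>Arithmetic\<close>

lemma zero_tm_simps [simp]: "subst_tm \<sigma> zero_tm = zero_tm" "wf_tm zero_tm" "FV_tm zero_tm = {}"
  by (simp_all add: zero_tm_def)

lemma suc_tm_simps [simp]:
  "subst_tm \<sigma> (suc_tm t) = suc_tm (subst_tm \<sigma> t)" "wf_tm (suc_tm t) = wf_tm t" "FV_tm (suc_tm t) = FV_tm t"
  by (simp_all add: suc_tm_def)

text \<open>In a recursion step, argument \<open>0\<close> is the recursion variable, argument
  \<open>1\<close> the previous value, and the parameters follow.\<close>

definition add_pr :: pr where
  "add_pr = PrRec (PrProj 1 0) (PrComp 3 PrSuc [PrProj 3 1])"

definition pred_pr :: pr where
  "pred_pr = PrRec PrZero (PrProj 2 0)"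

text \<open>Truncated subtraction with the arguments swapped: \<open>sub_pr\<close> maps \<open>(n, x)\<close> to \<open>x - n\<close>.\<close>

definition sub_pr :: pr where
  "sub_pr = PrRec (PrProj 1 0) (PrComp 3 pred_pr [PrProj 3 1])"

definition is_zero_pr :: pr where
  "is_zero_pr = PrRec (PrComp 0 PrSuc [PrZero]) (PrComp 2 PrZero [])"

text \<open>\<open>tri_pr\<close> gives the triangular numbers and \<open>root_pr z\<close> the largest \<open>s\<close> with \<open>tri s \<le> z\<close>.\<close>

definition tri_pr :: pr where
  "tri_pr = PrRec PrZero (PrComp 2 PrSuc [PrComp 2 add_pr [PrProj 2 0, PrProj 2 1]])"

definition root_pr :: pr where
  "root_pr = PrRec PrZero
     (PrComp 2 add_pr
       [PrComp 2 is_zero_pr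
         [PrComp 2 sub_pr [PrComp 2 sub_pr [PrComp 2 tri_pr [PrProj 2 1], PrProj 2 0], PrProj 2 1]],
        PrProj 2 1])"

lemma pr_arities [simp]:
  "pr_arity add_pr = 2" "pr_arity pred_pr = 1" "pr_arity sub_pr = 2" "pr_arity is_zero_pr = 1"
  "pr_arity tri_pr = 1" "pr_arity root_pr = 1"
  by (simp_all add: add_pr_def pred_pr_def sub_pr_def is_zero_pr_def tri_pr_def root_pr_def)

lemma wf_prs [simp]:
  "wf_pr add_pr" "wf_pr pred_pr" "wf_pr sub_pr" "wf_pr is_zero_pr" "wf_pr tri_pr" "wf_pr root_pr"
proof -
  show "wf_pr pred_pr" by (simp add: pred_pr_def)
  then show "wf_pr sub_pr" by (simp add: sub_pr_def)
  show "wf_pr add_pr" by (simp add: add_pr_def)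
  then show "wf_pr tri_pr" by (simp add: tri_pr_def)
  show "wf_pr is_zero_pr" by (simp add: is_zero_pr_def)
  with \<open>wf_pr sub_pr\<close> \<open>wf_pr add_pr\<close> \<open>wf_pr tri_pr\<close> show "wf_pr root_pr" by (simp add: root_pr_def)
qed

abbreviation add :: "tm \<Rightarrow> tm \<Rightarrow> tm" where "add s t \<equiv> Fn add_pr [s, t]"
abbreviation pred :: "tm \<Rightarrow> tm" where "pred t \<equiv> Fn pred_pr [t]"
abbreviation sub :: "tm \<Rightarrow> tm \<Rightarrow> tm" where "sub s t \<equiv> Fn sub_pr [s, t]"
abbreviation is_zero :: "tm \<Rightarrow> tm" where "is_zero t \<equiv> Fn is_zero_pr [t]"
abbreviation tri :: "tm \<Rightarrow> tm" where "tri t \<equiv> Fn tri_pr [t]"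
abbreviation root :: "tm \<Rightarrow> tm" where "root t \<equiv> Fn root_pr [t]"

text \<open>Cantor's pairing function.\<close>

definition pair :: "tm \<Rightarrow> tm \<Rightarrow> tm" where
  "pair s t = add t (tri (add t s))"

definition pair_snd :: "tm \<Rightarrow> tm" where
  "pair_snd z = sub (tri (root z)) z"

definition pair_fst :: "tm \<Rightarrow> tm" where
  "pair_fst z = sub (pair_snd z) (root z)"

context arithmetic
begin

subsection \<open>Equality\<close>

definition eqv :: "world \<Rightarrow> tm \<Rightarrow> tm \<Rightarrow> bool" where
  "eqv w s t \<longleftrightarrow> w \<Turnstile> Eq s t"

lemma eqv_wf: "eqv w s t \<Longrightarrow> wf_tm s \<and> wf_tm t"
  unfolding eqv_def using forces_wf by fastforce

lemma eqv_mono: "eqv w s t \<Longrightarrow> w \<le> w' \<Longrightarrow> eqv w' s t"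
  unfolding eqv_def by (rule forces_mono)

lemma eqv_refl: "wf_tm t \<Longrightarrow> eqv w t t"
  unfolding eqv_def by (rule forces_Eq_refl)

lemma eqv_sym:
  assumes "eqv w s t"
  shows "eqv w t s"
proof -
  let ?\<phi> = "Eq (Var 0) (subst_tm (\<lambda>n. Var (Suc n)) s)"
  have "w \<Turnstile> inst s ?\<phi>" using assms eqv_wf by (simp add: inst_def forces_Eq_refl)
  from forces_Eq_subst[OF assms[unfolded eqv_def] this] show ?thesis by (simp add: inst_def eqv_def)
qed

lemma eqv_trans [trans]:
  assumes "eqv w s t" "eqv w t u"
  shows "eqv w s u"
proof -
  let ?\<phi> = "Eq (subst_tm (\<lambda>n. Var (Suc n)) s) (Var 0)"
  have "w \<Turnstile> inst t ?\<phi>" using assms(1) by (simp add: inst_def eqv_def)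
  from forces_Eq_subst[OF assms(2)[unfolded eqv_def] this] show ?thesis by (simp add: inst_def eqv_def)
qed

text \<open>The equality rule replaces one term at a time. The substitutions that follow
  \<open>\<tau>\<close> below \<open>i\<close> and \<open>\<sigma>\<close> from \<open>i\<close> on
  interpolate between the two, and the bound on free variables makes finitely many steps
  enough.\<close>

lemma forces_subst_eqv:
  assumes "\<And>n. eqv w (\<sigma> n) (\<tau> n)" "w \<Turnstile> subst \<sigma> \<phi>"
  shows "w \<Turnstile> subst \<tau> \<phi>"
proof -
  have *: "w \<Turnstile> subst (\<lambda>n. if n < i then \<tau> n else \<sigma> n) \<phi>" for i
  proof (induction i)
    case 0
    then show ?case using assms(2) by simp
  next
    case (Suc i)
    let ?s = "\<lambda>t. subst_tm (\<lambda>n. Var (Suc n)) t"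
    let ?\<phi> = "subst (\<lambda>n. if n < i then ?s (\<tau> n) else if n = i then Var 0 else ?s (\<sigma> n)) \<phi>"
    have inst: "inst t ?\<phi> = subst (\<lambda>n. if n < i then \<tau> n else if n = i then t else \<sigma> n) \<phi>" for t
      unfolding inst_def subst_subst by (rule subst_cong) simp
    have "w \<Turnstile> inst (\<sigma> i) ?\<phi>"
    proof -
      have "(\<lambda>n. if n < i then \<tau> n else if n = i then \<sigma> i else \<sigma> n) =
        (\<lambda>n. if n < i then \<tau> n else \<sigma> n)" by auto
      then show ?thesis using Suc unfolding inst by simp
    qed
    from forces_Eq_subst[OF assms(1)[of i, unfolded eqv_def] this] have "w \<Turnstile> inst (\<tau> i) ?\<phi>" .
    moreover have "(\<lambda>n. if n < i then \<tau> n else if n = i then \<tau> i else \<sigma> n) =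
        (\<lambda>n. if n < Suc i then \<tau> n else \<sigma> n)" by (auto simp: fun_eq_iff less_Suc_eq)
    ultimately show ?case unfolding inst by simp
  qed
  obtain m where m: "\<forall>i\<in>FV \<phi>. i < m" using FV_bound by blast
  have "subst (\<lambda>n. if n < m then \<tau> n else \<sigma> n) \<phi> = subst \<tau> \<phi>"
    by (rule subst_cong) (use m in auto)
  with *[of m] show ?thesis by simp
qed

text \<open>Replacement is applied to an equation between two copies of \<open>u\<close> with
  disjoint variables, even ones on the left and odd ones on the right. Starting from reflexivity,
  only the odd ones are changed.\<close>

lemma eqv_subst_tm:
  assumes "\<And>n. eqv w (\<sigma> n) (\<tau> n)" "wf_tm u"
  shows "eqv w (subst_tm \<sigma> u) (subst_tm \<tau> u)"
proof -
  let ?\<phi> = "Eq (subst_tm (\<lambda>n. Var (2 * n)) u) (subst_tm (\<lambda>n. Var (2 * n + 1)) u)"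
  have wf: "wf_tm (\<sigma> n)" for n using eqv_wf[OF assms(1)[of n]] by simp
  have "w \<Turnstile> subst (\<lambda>n. \<sigma> (n div 2)) ?\<phi>"
    using wf assms(2) by (simp add: subst_tm_subst_tm forces_Eq_refl wf_subst_tm)
  then have "w \<Turnstile> subst (\<lambda>n. if even n then \<sigma> (n div 2) else \<tau> (n div 2)) ?\<phi>"
    by (rule forces_subst_eqv[rotated]) (use assms(1) wf in \<open>auto intro: eqv_refl\<close>)
  then show ?thesis by (simp add: subst_tm_subst_tm eqv_def)
qed

lemma eqv_Fn:
  assumes "wf_tm (Fn f ss)" "list_all2 (eqv w) ss ts"
  shows "eqv w (Fn f ss) (Fn f ts)"
proof -
  \<comment> \<open>The default \<open>zero_tm\<close> beyond the list keeps the substitution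
    well-formed at every index.\<close>
  let ?v = "\<lambda>us i. if i < length us then us ! i else zero_tm"
  let ?u = "Fn f (map Var [0..<length ss])"
  have len: "length ts = length ss" using assms(2) by (simp add: list_all2_lengthD)
  have "eqv w (subst_tm (?v ss) ?u) (subst_tm (?v ts) ?u)"
    by (rule eqv_subst_tm)
      (use assms len in \<open>auto simp: list_all2_conv_all_nth intro: eqv_refl\<close>)
  moreover have "map (subst_tm (?v ss)) (map Var [0..<length ss]) = ss"
    by (rule nth_equalityI) auto
  moreover have "map (subst_tm (?v ts)) (map Var [0..<length ss]) = ts"
    by (rule nth_equalityI) (auto simp: len)
  ultimately show ?thesis by simp
qed

lemma eqv_Fn1: "wf_pr f \<Longrightarrow> pr_arity f = 1 \<Longrightarrow> eqv w s t \<Longrightarrow> eqv w (Fn f [s]) (Fn f [t])"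
  using eqv_wf by (intro eqv_Fn) auto

lemma eqv_Fn2:
  "wf_pr f \<Longrightarrow> pr_arity f = 2 \<Longrightarrow> eqv w s t \<Longrightarrow> eqv w s' t' \<Longrightarrow> eqv w (Fn f [s, s']) (Fn f [t, t'])"
  using eqv_wf by (intro eqv_Fn) auto

lemma eqv_suc: "eqv w s t \<Longrightarrow> eqv w (suc_tm s) (suc_tm t)"
  unfolding suc_tm_def by (rule eqv_Fn1) auto

lemma eqv_suc_inject: "eqv w (suc_tm s) (suc_tm t) \<Longrightarrow> eqv w s t"
  using eqv_wf[of w "suc_tm s" "suc_tm t"] forces_mp[OF forces_HA[OF HA.suc_inject]]
  by (auto simp: eqv_def)

lemma eqv_suc_zero: "eqv w (suc_tm s) zero_tm \<Longrightarrow> w \<Turnstile> Bot"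
  using eqv_wf[of w "suc_tm s" zero_tm] forces_mp[OF forces_HA[OF HA.suc_nonzero, unfolded Neg_def]]
  by (auto simp: eqv_def)

subsection \<open>Induction and evaluation\<close>

text \<open>The step is proved at later worlds since it is an implication of the object language;
  \<open>\<sigma>\<close> carries the parameters.\<close>

lemma forces_induct:
  assumes "wf_fm \<phi>" "\<And>n. wf_tm (\<sigma> n)"
    and base: "w \<Turnstile> subst (case_nat zero_tm \<sigma>) \<phi>"
    and step: "\<And>w' t. w \<le> w' \<Longrightarrow> wf_tm t \<Longrightarrow> w' \<Turnstile> subst (case_nat t \<sigma>) \<phi> \<Longrightarrow>
      w' \<Turnstile> subst (case_nat (suc_tm t) \<sigma>) \<phi>"
    and "wf_tm t"
  shows "w \<Turnstile> subst (case_nat t \<sigma>) \<phi>"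
proof -
  let ?\<psi> = "subst (up \<sigma>) \<phi>"
  let ?s = "case_nat (suc_tm (Var 0)) (\<lambda>n. Var (Suc n))"
  have wf: "wf_fm ?\<psi>" using assms(1,2) by (simp add: wf_subst wf_up)
  have "inst t (subst ?s ?\<psi>) = inst (suc_tm t) ?\<psi>" for t
  proof -
    have "(\<lambda>n. subst_tm (case_nat t Var) (?s n)) = case_nat (suc_tm t) Var"
      by (auto simp: fun_eq_iff split: nat.split)
    then show ?thesis by (simp add: inst_def subst_subst[of "case_nat t Var" ?s])
  qed
  then have "w \<Turnstile> Forall (Imp ?\<psi> (subst ?s ?\<psi>))"
    using assms(1,2) step by (auto simp: forces_Forall wf_subst intro!: forces_ImpI)
  then have "w \<Turnstile> Forall ?\<psi>"
    using forces_mp[OF forces_HA[OF HA.induction[OF wf], unfolded Induction_def]] base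
    by (simp add: forces_Conj)
  then show ?thesis using \<open>wf_tm t\<close> by (simp add: forces_Forall)
qed

lemma eqv_induct:
  assumes "wf_tm a" "wf_tm b" "\<And>n. wf_tm (\<sigma> n)"
    and "eqv w (subst_tm (case_nat zero_tm \<sigma>) a) (subst_tm (case_nat zero_tm \<sigma>) b)"
    and "\<And>w' t. w \<le> w' \<Longrightarrow> wf_tm t \<Longrightarrow>
      eqv w' (subst_tm (case_nat t \<sigma>) a) (subst_tm (case_nat t \<sigma>) b) \<Longrightarrow>
      eqv w' (subst_tm (case_nat (suc_tm t) \<sigma>) a) (subst_tm (case_nat (suc_tm t) \<sigma>) b)"
    and "wf_tm t"
  shows "eqv w (subst_tm (case_nat t \<sigma>) a) (subst_tm (case_nat t \<sigma>) b)"
  using forces_induct[of "Eq a b" \<sigma> w t] assms unfolding eqv_def by simp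

lemma eqv_proj: "wf_tm (Fn (PrProj n i) ts) \<Longrightarrow> ts ! i = u \<Longrightarrow> eqv w (Fn (PrProj n i) ts) u"
  unfolding eqv_def using forces_HA[OF HA.proj] by blast

lemma eqv_comp:
  assumes "wf_tm (Fn (PrComp n f gs) ts)" "list_all2 (\<lambda>g. eqv w (Fn g ts)) gs us"
  shows "eqv w (Fn (PrComp n f gs) ts) (Fn f us)"
proof -
  have "eqv w (Fn (PrComp n f gs) ts) (Fn f (map (\<lambda>g. Fn g ts) gs))"
    unfolding eqv_def by (intro forces_HA HA.comp assms(1))
  also have "eqv w \<dots> (Fn f us)"
    by (rule eqv_Fn) (use assms in \<open>auto simp: list_all2_map1\<close>)
  finally show ?thesis .
qed

lemma eqv_rec_zero:
  "wf_tm (Fn (PrRec f g) (zero_tm # ts)) \<Longrightarrow> eqv w (Fn f ts) u \<Longrightarrow>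
    eqv w (Fn (PrRec f g) (zero_tm # ts)) u"
  using eqv_trans[of w "Fn (PrRec f g) (zero_tm # ts)" "Fn f ts" u] forces_HA[OF HA.rec_zero, of f g ts w]
  by (simp add: eqv_def)

lemma eqv_rec_suc:
  "wf_tm (Fn (PrRec f g) (suc_tm t # ts)) \<Longrightarrow>
    eqv w (Fn g (t # Fn (PrRec f g) (t # ts) # ts)) u \<Longrightarrow> eqv w (Fn (PrRec f g) (suc_tm t # ts)) u"
  using eqv_trans[of w "Fn (PrRec f g) (suc_tm t # ts)" "Fn g (t # Fn (PrRec f g) (t # ts) # ts)" u]
    forces_HA[OF HA.rec_suc, of f g t ts w]
  by (simp add: eqv_def)

lemma add_zero: "wf_tm x \<Longrightarrow> eqv w (add zero_tm x) x"
  unfolding add_pr_def by (rule eqv_rec_zero) (simp_all add: eqv_proj)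

lemma add_suc: "wf_tm n \<Longrightarrow> wf_tm x \<Longrightarrow> eqv w (add (suc_tm n) x) (suc_tm (add n x))"
  unfolding add_pr_def suc_tm_def[of "Fn _ _"]
  by (rule eqv_rec_suc) (auto intro!: eqv_comp eqv_proj)

lemma pred_suc: "wf_tm n \<Longrightarrow> eqv w (pred (suc_tm n)) n"
  unfolding pred_pr_def by (rule eqv_rec_suc) (auto intro!: eqv_proj)

lemma sub_zero: "wf_tm x \<Longrightarrow> eqv w (sub zero_tm x) x"
  unfolding sub_pr_def by (rule eqv_rec_zero) (simp_all add: eqv_proj)

lemma sub_suc: "wf_tm n \<Longrightarrow> wf_tm x \<Longrightarrow> eqv w (sub (suc_tm n) x) (pred (sub n x))"
  unfolding sub_pr_def by (rule eqv_rec_suc) (auto intro!: eqv_comp eqv_proj)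

lemma is_zero_zero: "eqv w (is_zero zero_tm) (suc_tm zero_tm)"
  unfolding is_zero_pr_def suc_tm_def zero_tm_def[symmetric]
  by (rule eqv_rec_zero) (auto intro!: eqv_comp simp: zero_tm_def eqv_refl)

lemma is_zero_suc: "wf_tm n \<Longrightarrow> eqv w (is_zero (suc_tm n)) zero_tm"
  unfolding is_zero_pr_def by (rule eqv_rec_suc) (auto intro!: eqv_comp simp: zero_tm_def)

lemma tri_zero: "eqv w (tri zero_tm) zero_tm"
  unfolding tri_pr_def by (rule eqv_rec_zero) (auto intro!: eqv_refl simp: zero_tm_def)

lemma tri_suc: "wf_tm n \<Longrightarrow> eqv w (tri (suc_tm n)) (suc_tm (add n (tri n)))"
  unfolding tri_pr_def suc_tm_def[of "add _ _"]
  by (rule eqv_rec_suc) (auto intro!: eqv_comp eqv_proj)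

lemma root_zero: "eqv w (root zero_tm) zero_tm"
  unfolding root_pr_def by (rule eqv_rec_zero) (auto intro!: eqv_refl simp: zero_tm_def)

text \<open>With \<open>s\<close> for \<open>root z\<close>, the inner difference is z - tri s, the
  second component of the pair coded by \<open>z\<close>, and the outer one is \<open>s\<close>
  minus that, the first component. The root grows exactly when the first component is zero, at the
  end of a diagonal.\<close>

lemma root_suc:
  "wf_tm z \<Longrightarrow>
    eqv w (root (suc_tm z)) (add (is_zero (sub (sub (tri (root z)) z) (root z))) (root z))"
  unfolding root_pr_def
  by (rule eqv_rec_suc) (auto intro!: eqv_comp eqv_proj)

lemma add_right_zero: "wf_tm n \<Longrightarrow> eqv w (add n zero_tm) n"
  using eqv_induct[of "add (Var 0) zero_tm" "Var 0" Var w n]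
  by (simp add: add_zero) (meson add_suc eqv_suc eqv_trans zero_tm_simps(2))

lemma add_right_suc:
  assumes "wf_tm n" "wf_tm x"
  shows "eqv w (add n (suc_tm x)) (suc_tm (add n x))"
proof -
  let ?\<sigma> = "\<lambda>_ :: nat. x"
  have "eqv w (subst_tm (case_nat n ?\<sigma>) (add (Var 0) (suc_tm (Var 1))))
    (subst_tm (case_nat n ?\<sigma>) (suc_tm (add (Var 0) (Var 1))))"
  proof (rule eqv_induct)
    have "eqv w (add zero_tm (suc_tm x)) (suc_tm x)" using assms by (simp add: add_zero)
    also have "eqv w \<dots> (suc_tm (add zero_tm x))" using assms by (intro eqv_suc eqv_sym[OF add_zero])
    finally show "eqv w (subst_tm (case_nat zero_tm ?\<sigma>) (add (Var 0) (suc_tm (Var 1))))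
      (subst_tm (case_nat zero_tm ?\<sigma>) (suc_tm (add (Var 0) (Var 1))))" by simp
  next
    fix w' t
    assume t: "wf_tm t" and IH: "eqv w' (subst_tm (case_nat t ?\<sigma>) (add (Var 0) (suc_tm (Var 1))))
      (subst_tm (case_nat t ?\<sigma>) (suc_tm (add (Var 0) (Var 1))))"
    have "eqv w' (add (suc_tm t) (suc_tm x)) (suc_tm (add t (suc_tm x)))"
      using assms t by (simp add: add_suc)
    also have "eqv w' \<dots> (suc_tm (suc_tm (add t x)))" using IH by (simp add: eqv_suc)
    also have "eqv w' \<dots> (suc_tm (add (suc_tm t) x))"
      using assms t by (intro eqv_suc eqv_sym[OF add_suc])
    finally show "eqv w' (subst_tm (case_nat (suc_tm t) ?\<sigma>) (add (Var 0) (suc_tm (Var 1))))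
      (subst_tm (case_nat (suc_tm t) ?\<sigma>) (suc_tm (add (Var 0) (Var 1))))" by simp
  qed (use assms in auto)
  then show ?thesis by simp
qed

lemma sub_suc_suc:
  assumes "wf_tm n" "wf_tm x"
  shows "eqv w (sub (suc_tm n) (suc_tm x)) (sub n x)"
proof -
  let ?\<sigma> = "\<lambda>_ :: nat. x"
  have "eqv w (subst_tm (case_nat n ?\<sigma>) (sub (suc_tm (Var 0)) (suc_tm (Var 1))))
    (subst_tm (case_nat n ?\<sigma>) (sub (Var 0) (Var 1)))"
  proof (rule eqv_induct)
    have "eqv w (sub (suc_tm zero_tm) (suc_tm x)) (pred (sub zero_tm (suc_tm x)))"
      using assms by (simp add: sub_suc)
    also have "eqv w \<dots> (pred (suc_tm x))" using assms by (intro eqv_Fn1 sub_zero) auto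
    also have "eqv w \<dots> x" using assms by (simp add: pred_suc)
    also have "eqv w x (sub zero_tm x)" using assms by (intro eqv_sym[OF sub_zero])
    finally show "eqv w (subst_tm (case_nat zero_tm ?\<sigma>) (sub (suc_tm (Var 0)) (suc_tm (Var 1))))
      (subst_tm (case_nat zero_tm ?\<sigma>) (sub (Var 0) (Var 1)))" by simp
  next
    fix w' t
    assume t: "wf_tm t" and IH: "eqv w' (subst_tm (case_nat t ?\<sigma>) (sub (suc_tm (Var 0)) (suc_tm (Var 1))))
      (subst_tm (case_nat t ?\<sigma>) (sub (Var 0) (Var 1)))"
    have "eqv w' (sub (suc_tm (suc_tm t)) (suc_tm x)) (pred (sub (suc_tm t) (suc_tm x)))"
      using assms t by (simp add: sub_suc)
    also have "eqv w' \<dots> (pred (sub t x))" using IH by (intro eqv_Fn1) auto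
    also have "eqv w' \<dots> (sub (suc_tm t) x)" using assms t by (intro eqv_sym[OF sub_suc])
    finally show "eqv w' (subst_tm (case_nat (suc_tm t) ?\<sigma>) (sub (suc_tm (Var 0)) (suc_tm (Var 1))))
      (subst_tm (case_nat (suc_tm t) ?\<sigma>) (sub (Var 0) (Var 1)))" by simp
  qed (use assms in auto)
  then show ?thesis by simp
qed

lemma sub_add_left:
  assumes "wf_tm n" "wf_tm x"
  shows "eqv w (sub n (add n x)) x"
proof -
  let ?\<sigma> = "\<lambda>_ :: nat. x"
  have "eqv w (subst_tm (case_nat n ?\<sigma>) (sub (Var 0) (add (Var 0) (Var 1))))
    (subst_tm (case_nat n ?\<sigma>) (Var 1))"
  proof (rule eqv_induct)
    have "eqv w (sub zero_tm (add zero_tm x)) (add zero_tm x)" using assms by (simp add: sub_zero)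
    also have "eqv w \<dots> x" using assms by (simp add: add_zero)
    finally show "eqv w (subst_tm (case_nat zero_tm ?\<sigma>) (sub (Var 0) (add (Var 0) (Var 1))))
      (subst_tm (case_nat zero_tm ?\<sigma>) (Var 1))" by simp
  next
    fix w' t
    assume t: "wf_tm t" and IH: "eqv w' (subst_tm (case_nat t ?\<sigma>) (sub (Var 0) (add (Var 0) (Var 1))))
      (subst_tm (case_nat t ?\<sigma>) (Var 1))"
    have "eqv w' (sub (suc_tm t) (add (suc_tm t) x)) (sub (suc_tm t) (suc_tm (add t x)))"
      using assms t by (intro eqv_Fn2 add_suc eqv_refl) auto
    also have "eqv w' \<dots> (sub t (add t x))" using assms t by (simp add: sub_suc_suc)
    also have "eqv w' \<dots> x" using IH by simp
    finally show "eqv w' (subst_tm (case_nat (suc_tm t) ?\<sigma>) (sub (Var 0) (add (Var 0) (Var 1))))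
      (subst_tm (case_nat (suc_tm t) ?\<sigma>) (Var 1))" by simp
  qed (use assms in auto)
  then show ?thesis by simp
qed

lemma sub_add_right:
  assumes "wf_tm n" "wf_tm x"
  shows "eqv w (sub n (add x n)) x"
proof -
  let ?\<sigma> = "\<lambda>_ :: nat. x"
  have "eqv w (subst_tm (case_nat n ?\<sigma>) (sub (Var 0) (add (Var 1) (Var 0))))
    (subst_tm (case_nat n ?\<sigma>) (Var 1))"
  proof (rule eqv_induct)
    have "eqv w (sub zero_tm (add x zero_tm)) (add x zero_tm)" using assms by (simp add: sub_zero)
    also have "eqv w \<dots> x" using assms by (simp add: add_right_zero)
    finally show "eqv w (subst_tm (case_nat zero_tm ?\<sigma>) (sub (Var 0) (add (Var 1) (Var 0))))
      (subst_tm (case_nat zero_tm ?\<sigma>) (Var 1))" by simp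
  next
    fix w' t
    assume t: "wf_tm t" and IH: "eqv w' (subst_tm (case_nat t ?\<sigma>) (sub (Var 0) (add (Var 1) (Var 0))))
      (subst_tm (case_nat t ?\<sigma>) (Var 1))"
    have "eqv w' (sub (suc_tm t) (add x (suc_tm t))) (sub (suc_tm t) (suc_tm (add x t)))"
      using assms t by (intro eqv_Fn2 add_right_suc eqv_refl) auto
    also have "eqv w' \<dots> (sub t (add x t))" using assms t by (simp add: sub_suc_suc)
    also have "eqv w' \<dots> x" using IH by simp
    finally show "eqv w' (subst_tm (case_nat (suc_tm t) ?\<sigma>) (sub (Var 0) (add (Var 1) (Var 0))))
      (subst_tm (case_nat (suc_tm t) ?\<sigma>) (Var 1))" by simp
  qed (use assms in auto)
  then show ?thesis by simp
qed

subsection \<open>Pairing\<close>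

text \<open>One step of \<open>root\<close> from the code \<open>z = b + tri s\<close> of the pair \<open>(a, b)\<close> with \<open>b + a = s\<close>.\<close>

lemma root_suc_code:
  assumes "wf_tm a" "wf_tm b" "wf_tm s" "eqv w (add b a) s" "eqv w (root (add b (tri s))) s"
  shows "eqv w (root (suc_tm (add b (tri s)))) (add (is_zero a) s)"
proof -
  let ?z = "add b (tri s)"
  have "eqv w (sub (tri (root ?z)) ?z) (sub (tri s) ?z)"
    using assms by (intro eqv_Fn2 eqv_Fn1 eqv_refl) auto
  also have "eqv w \<dots> b" using assms by (intro sub_add_right) auto
  finally have "eqv w (sub (sub (tri (root ?z)) ?z) (root ?z)) (sub b s)"
    using assms by (intro eqv_Fn2) auto
  also have "eqv w \<dots> (sub b (add b a))" using assms by (intro eqv_Fn2 eqv_refl eqv_sym[OF assms(4)]) auto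
  also have "eqv w \<dots> a" using assms by (intro sub_add_left)
  finally have *: "eqv w (sub (sub (tri (root ?z)) ?z) (root ?z)) a" .
  have "eqv w (root (suc_tm ?z)) (add (is_zero (sub (sub (tri (root ?z)) ?z) (root ?z))) (root ?z))"
    using assms by (intro root_suc) auto
  also have "eqv w \<dots> (add (is_zero a) s)"
    using * assms(5) by (intro eqv_Fn2 eqv_Fn1) auto
  finally show ?thesis .
qed

text \<open>Walks along a diagonal: the code of (a, b + 1) is the successor of the code of (a + 1,
  b), and since a + 1 is not zero the root stays the same.\<close>

lemma root_code_within_diagonal:
  assumes "wf_tm a" "wf_tm b" "wf_tm s" "eqv w (root (tri s)) s" "eqv w (add b a) s"
  shows "eqv w (root (add b (tri s))) s"
proof -
  \<comment> \<open>The first component is quantified inside the induction formula because it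
    changes from \<open>a\<close> to \<open>suc_tm a\<close> when the hypothesis is used.\<close>
  let ?\<phi> = "Forall (Imp (Eq (add (Var 1) (Var 0)) (Var 2)) (Eq (root (add (Var 1) (tri (Var 2)))) (Var 2)))"
  let ?\<sigma> = "\<lambda>_ :: nat. s"
  have unfold: "w \<Turnstile> subst (case_nat b ?\<sigma>) ?\<phi> \<longleftrightarrow>
      (\<forall>a. wf_tm a \<longrightarrow> (\<forall>w'\<ge>w. eqv w' (add b a) s \<longrightarrow> eqv w' (root (add b (tri s))) s))"
    if "wf_tm b" for w b
    using that assms(3) by (simp add: up_def forces_Forall inst_def forces_Imp eqv_def numeral_2_eq_2)
  have "w \<Turnstile> subst (case_nat b ?\<sigma>) ?\<phi>"
  proof (rule forces_induct)
    have "eqv w (root (add zero_tm (tri s))) s"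
      by (rule eqv_trans[OF eqv_Fn1[OF _ _ add_zero] assms(4)]) (use assms in auto)
    then show "w \<Turnstile> subst (case_nat zero_tm ?\<sigma>) ?\<phi>"
      by (auto simp only: unfold[OF zero_tm_simps(2)] intro: eqv_mono)
  next
    fix w' t
    assume t: "wf_tm t" and IH: "w' \<Turnstile> subst (case_nat t ?\<sigma>) ?\<phi>"
    have "eqv v (root (add (suc_tm t) (tri s))) s"
      if a: "wf_tm a" and v: "w' \<le> v" "eqv v (add (suc_tm t) a) s" for a v
    proof -
      have "eqv v (add t (suc_tm a)) (suc_tm (add t a))" using t a by (intro add_right_suc)
      also have "eqv v \<dots> (add (suc_tm t) a)" using t a by (intro eqv_sym[OF add_suc])
      also note v(2)
      finally have *: "eqv v (add t (suc_tm a)) s" .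
      then have r: "eqv v (root (add t (tri s))) s"
        using IH[unfolded unfold[OF t], rule_format, of "suc_tm a" v] a v(1) by simp
      have "eqv v (root (add (suc_tm t) (tri s))) (root (suc_tm (add t (tri s))))"
        using t assms(3) by (intro eqv_Fn1 add_suc) auto
      also have "eqv v \<dots> (add (is_zero (suc_tm a)) s)"
        using t a assms(3) * r by (intro root_suc_code) auto
      also have "eqv v \<dots> (add zero_tm s)"
        using a assms(3) by (intro eqv_Fn2 is_zero_suc eqv_refl) auto
      also have "eqv v \<dots> s" using assms(3) by (rule add_zero)
      finally show ?thesis .
    qed
    moreover have "wf_tm (suc_tm t)" using t by simp
    ultimately show "w' \<Turnstile> subst (case_nat (suc_tm t) ?\<sigma>) ?\<phi>"
      by (simp only: unfold) blast
  qed (use assms in auto)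
  from this[unfolded unfold[OF assms(2)]] show ?thesis using assms by blast
qed

text \<open>The last code on diagonal \<open>t\<close> belongs to the pair (0, t), and its successor
  is the first code on the next diagonal; there the increment is \<open>is_zero zero_tm\<close>,
  that is, one.\<close>

lemma root_tri:
  assumes "wf_tm s"
  shows "eqv w (root (tri s)) s"
proof -
  have "eqv w (subst_tm (case_nat s Var) (root (tri (Var 0)))) (subst_tm (case_nat s Var) (Var 0))"
  proof (rule eqv_induct)
    show "eqv w (subst_tm (case_nat zero_tm Var) (root (tri (Var 0)))) (subst_tm (case_nat zero_tm Var) (Var 0))"
      using eqv_trans[OF eqv_Fn1[of root_pr, OF _ _ tri_zero] root_zero] by simp
  next
    fix w' t
    assume t: "wf_tm t" and "eqv w' (subst_tm (case_nat t Var) (root (tri (Var 0)))) (subst_tm (case_nat t Var) (Var 0))"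
    then have IH: "eqv w' (root (tri t)) t" by simp
    have z: "eqv w' (add t zero_tm) t" using t by (rule add_right_zero)
    have "eqv w' (root (tri (suc_tm t))) (root (suc_tm (add t (tri t))))"
      using t by (intro eqv_Fn1 tri_suc) auto
    also have "eqv w' \<dots> (add (is_zero zero_tm) t)"
      using t z IH by (intro root_suc_code root_code_within_diagonal[OF _ _ _ IH z]) auto
    also have "eqv w' \<dots> (add (suc_tm zero_tm) t)"
      using t by (intro eqv_Fn2 is_zero_zero eqv_refl) auto
    also have "eqv w' \<dots> (suc_tm (add zero_tm t))" using t by (intro add_suc) auto
    also have "eqv w' \<dots> (suc_tm t)" using t by (intro eqv_suc add_zero)
    finally show "eqv w' (subst_tm (case_nat (suc_tm t) Var) (root (tri (Var 0))))
      (subst_tm (case_nat (suc_tm t) Var) (Var 0))" by simp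
  qed (use assms in auto)
  then show ?thesis by simp
qed

lemma root_pair: "wf_tm s \<Longrightarrow> wf_tm t \<Longrightarrow> eqv w (root (pair s t)) (add t s)"
  unfolding pair_def
  by (rule root_code_within_diagonal[of s]) (auto intro: root_tri eqv_refl)

lemma pair_snd_pair:
  assumes "wf_tm s" "wf_tm t"
  shows "eqv w (pair_snd (pair s t)) t"
proof -
  have "eqv w (pair_snd (pair s t)) (sub (tri (add t s)) (pair s t))"
    unfolding pair_snd_def using assms
    by (intro eqv_Fn2 eqv_Fn1 root_pair eqv_refl) (auto simp: pair_def)
  also have "eqv w \<dots> t" unfolding pair_def using assms by (intro sub_add_right) auto
  finally show ?thesis .
qed

lemma pair_fst_pair:
  assumes "wf_tm s" "wf_tm t"
  shows "eqv w (pair_fst (pair s t)) s"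
proof -
  have "eqv w (pair_fst (pair s t)) (sub t (add t s))"
    unfolding pair_fst_def using assms by (intro eqv_Fn2 pair_snd_pair root_pair) auto
  also have "eqv w \<dots> s" using assms by (intro sub_add_left)
  finally show ?thesis .
qed

subsection \<open>Decidability of quantifier-free formulas\<close>

lemma Eq_decidable:
  assumes "wf_tm s" "wf_tm t"
  shows "w \<Turnstile> Disj (Eq s t) (Neg (Eq s t))"
proof -
  let ?D = "\<lambda>s t. Disj (Eq s t) (Neg (Eq s t))"
  have zero_suc: "w \<Turnstile> ?D zero_tm (suc_tm t)" if "wf_tm t" for w t
    using that by (auto simp: forces_Neg eqv_def intro!: forces_DisjI2 eqv_suc_zero[OF eqv_sym])
  have suc_zero: "w \<Turnstile> ?D (suc_tm t) zero_tm" if "wf_tm t" for w t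
    using that by (auto simp: forces_Neg eqv_def intro!: forces_DisjI2 eqv_suc_zero)
  have suc_suc: "w \<Turnstile> ?D (suc_tm s) (suc_tm t)" if "w \<Turnstile> ?D s t" "wf_tm s" "wf_tm t" for w s t
    using that(1)
  proof (rule forces_DisjE)
    fix w' assume "w \<le> w'" "w' \<Turnstile> Eq s t"
    then show "w' \<Turnstile> ?D (suc_tm s) (suc_tm t)"
      using that by (intro forces_DisjI1) (auto simp: eqv_suc[unfolded eqv_def])
  next
    fix w' assume "w \<le> w'" "w' \<Turnstile> Neg (Eq s t)"
    then show "w' \<Turnstile> ?D (suc_tm s) (suc_tm t)"
      using that eqv_suc_inject by (intro forces_DisjI2) (auto simp: forces_Neg eqv_def)
  qed
  have "w \<Turnstile> subst (case_nat s Var) (Forall (?D (Var 1) (Var 0)))"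
  proof (rule forces_induct)
    \<comment> \<open>Induction serves only to distinguish zero from successors.\<close>
    have "w \<Turnstile> subst (case_nat t Var) (?D zero_tm (Var 0))" if "wf_tm t" for t
      by (rule forces_induct)
        (use that zero_suc forces_DisjI1[OF forces_Eq_refl[OF zero_tm_simps(2)]] in auto)
    then show "w \<Turnstile> subst (case_nat zero_tm Var) (Forall (?D (Var 1) (Var 0)))"
      by (simp add: forces_Forall inst_def up_def)
  next
    fix w' s
    assume s: "wf_tm s" and "w' \<Turnstile> subst (case_nat s Var) (Forall (?D (Var 1) (Var 0)))"
    then have IH: "w' \<Turnstile> ?D s t" if "wf_tm t" for t
      using that by (simp add: forces_Forall inst_def up_def)
    \<comment> \<open>Again only a case distinction on \<open>t\<close>: the successor case rests on
      the outer hypothesis, which holds for all second arguments.\<close>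
    have "w' \<Turnstile> subst (case_nat t (\<lambda>_. s)) (?D (suc_tm (Var 1)) (Var 0))" if "wf_tm t" for t
      by (rule forces_induct) (use that s suc_zero suc_suc[OF forces_mono[OF IH]] in auto)
    then show "w' \<Turnstile> subst (case_nat (suc_tm s) Var) (Forall (?D (Var 1) (Var 0)))"
      using s by (simp add: forces_Forall inst_def up_def)
  qed (use assms in auto)
  then show ?thesis using assms by (simp add: forces_Forall inst_def up_def)
qed

definition decidable :: "world \<Rightarrow> fm \<Rightarrow> bool" where
  "decidable w \<phi> \<longleftrightarrow> w \<Turnstile> Disj \<phi> (Neg \<phi>)"

lemma decidable_wf: "decidable w \<phi> \<Longrightarrow> wf_fm \<phi>"
  unfolding decidable_def using forces_wf by fastforce

lemma decidable_mono: "decidable w \<phi> \<Longrightarrow> w \<le> w' \<Longrightarrow> decidable w' \<phi>"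
  unfolding decidable_def by (rule forces_mono)

text \<open>The negative case has ex falso built in: above \<open>w'\<close>, every well-formed
  formula follows from \<open>\<phi>\<close>.\<close>

lemma decidable_cases:
  assumes "decidable w \<phi>"
    and "\<And>w'. w \<le> w' \<Longrightarrow> w' \<Turnstile> \<phi> \<Longrightarrow> w' \<Turnstile> \<chi>"
    and "\<And>w'. w \<le> w' \<Longrightarrow> (\<And>w'' \<psi>. w' \<le> w'' \<Longrightarrow> w'' \<Turnstile> \<phi> \<Longrightarrow> wf_fm \<psi> \<Longrightarrow> w'' \<Turnstile> \<psi>) \<Longrightarrow> w' \<Turnstile> \<chi>"
  shows "w \<Turnstile> \<chi>"
proof (rule forces_DisjE[OF assms(1)[unfolded decidable_def] assms(2)])
  fix w' assume w': "w \<le> w'" "w' \<Turnstile> Neg \<phi>"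
  have "w'' \<Turnstile> \<psi>" if "w' \<le> w''" "w'' \<Turnstile> \<phi>" "wf_fm \<psi>" for w'' \<psi>
    using w' that decidable_wf[OF assms(1)] by (auto simp: forces_Neg intro: forces_Bot)
  then show "w' \<Turnstile> \<chi>" by (rule assms(3)[OF w'(1)])
qed

lemma decidable_NegI: "wf_fm \<phi> \<Longrightarrow> (\<And>w'. w \<le> w' \<Longrightarrow> w' \<Turnstile> \<phi> \<Longrightarrow> w' \<Turnstile> Bot) \<Longrightarrow> decidable w \<phi>"
  unfolding decidable_def by (rule forces_DisjI2) (simp_all add: forces_Neg)

lemma decidableI: "w \<Turnstile> \<phi> \<Longrightarrow> decidable w \<phi>"
  unfolding decidable_def using forces_wf by (auto intro: forces_DisjI1)

lemma qfree_decidable: "qfree \<phi> \<Longrightarrow> wf_fm \<phi> \<Longrightarrow> decidable w \<phi>"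
proof (induction \<phi>)
  case (Eq s t)
  then show ?case by (simp add: decidable_def Eq_decidable)
next
  case Bot
  then show ?case by (simp add: decidable_NegI)
next
  case (Imp \<phi> \<psi>)
  then have d: "decidable w \<phi>" "decidable w \<psi>" and wf: "wf_fm \<phi>" "wf_fm \<psi>" by auto
  show ?case
    unfolding decidable_def
  proof (rule decidable_cases[OF d(1)]; fold decidable_def)
    fix w' assume w': "w \<le> w'" "w' \<Turnstile> \<phi>"
    show "decidable w' (Imp \<phi> \<psi>)"
      unfolding decidable_def
    proof (rule decidable_cases[OF decidable_mono[OF d(2) w'(1)]]; fold decidable_def)
      fix w'' assume "w' \<le> w''" "w'' \<Turnstile> \<psi>"
      then show "decidable w'' (Imp \<phi> \<psi>)"
        using wf by (auto intro!: decidableI forces_ImpI intro: forces_mono)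
    next
      fix w'' assume w'': "w' \<le> w''"
        and n: "\<And>v \<psi>'. w'' \<le> v \<Longrightarrow> v \<Turnstile> \<psi> \<Longrightarrow> wf_fm \<psi>' \<Longrightarrow> v \<Turnstile> \<psi>'"
      show "decidable w'' (Imp \<phi> \<psi>)"
      proof (rule decidable_NegI)
        fix v assume v: "w'' \<le> v" "v \<Turnstile> Imp \<phi> \<psi>"
        have "v \<Turnstile> \<phi>" using w' w'' v by (meson forces_mono)
        from n[OF v(1) forces_mp[OF v(2) this]] show "v \<Turnstile> Bot" by simp
      qed (use wf in simp)
    qed
  next
    fix w' assume "w \<le> w'" and n: "\<And>v \<psi>'. w' \<le> v \<Longrightarrow> v \<Turnstile> \<phi> \<Longrightarrow> wf_fm \<psi>' \<Longrightarrow> v \<Turnstile> \<psi>'"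
    show "decidable w' (Imp \<phi> \<psi>)"
      by (rule decidableI, rule forces_ImpI, rule wf, rule n) (use wf in simp_all)
  qed
next
  case (Conj \<phi> \<psi>)
  then have d: "decidable w \<phi>" "decidable w \<psi>" and wf: "wf_fm \<phi>" "wf_fm \<psi>" by auto
  show ?case
    unfolding decidable_def
  proof (rule decidable_cases[OF d(1)]; fold decidable_def)
    fix w' assume w': "w \<le> w'" "w' \<Turnstile> \<phi>"
    show "decidable w' (Conj \<phi> \<psi>)"
      unfolding decidable_def
    proof (rule decidable_cases[OF decidable_mono[OF d(2) w'(1)]]; fold decidable_def)
      fix w'' assume "w' \<le> w''" "w'' \<Turnstile> \<psi>"
      then show "decidable w'' (Conj \<phi> \<psi>)"
        using w'(2) by (intro decidableI) (auto simp: forces_Conj intro: forces_mono)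
    next
      fix w'' assume "w' \<le> w''" and n: "\<And>v \<psi>'. w'' \<le> v \<Longrightarrow> v \<Turnstile> \<psi> \<Longrightarrow> wf_fm \<psi>' \<Longrightarrow> v \<Turnstile> \<psi>'"
      show "decidable w'' (Conj \<phi> \<psi>)"
      proof (rule decidable_NegI)
        fix v assume "w'' \<le> v" "v \<Turnstile> Conj \<phi> \<psi>"
        then show "v \<Turnstile> Bot" by - (rule n, simp_all add: forces_Conj)
      qed (use wf in simp)
    qed
  next
    fix w' assume "w \<le> w'" and n: "\<And>v \<psi>'. w' \<le> v \<Longrightarrow> v \<Turnstile> \<phi> \<Longrightarrow> wf_fm \<psi>' \<Longrightarrow> v \<Turnstile> \<psi>'"
    show "decidable w' (Conj \<phi> \<psi>)"
    proof (rule decidable_NegI)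
      fix v assume "w' \<le> v" "v \<Turnstile> Conj \<phi> \<psi>"
      then show "v \<Turnstile> Bot" by - (rule n, simp_all add: forces_Conj)
    qed (use wf in simp)
  qed
next
  case (Disj \<phi> \<psi>)
  then have d: "decidable w \<phi>" "decidable w \<psi>" and wf: "wf_fm \<phi>" "wf_fm \<psi>" by auto
  show ?case
    unfolding decidable_def
  proof (rule decidable_cases[OF d(1)]; fold decidable_def)
    fix w' assume w': "w \<le> w'" and n: "\<And>v \<psi>'. w' \<le> v \<Longrightarrow> v \<Turnstile> \<phi> \<Longrightarrow> wf_fm \<psi>' \<Longrightarrow> v \<Turnstile> \<psi>'"
    show "decidable w' (Disj \<phi> \<psi>)"
      unfolding decidable_def
    proof (rule decidable_cases[OF decidable_mono[OF d(2) w']]; fold decidable_def)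
      fix w'' assume w'': "w' \<le> w''"
        and n': "\<And>v \<psi>'. w'' \<le> v \<Longrightarrow> v \<Turnstile> \<psi> \<Longrightarrow> wf_fm \<psi>' \<Longrightarrow> v \<Turnstile> \<psi>'"
      show "decidable w'' (Disj \<phi> \<psi>)"
      proof (rule decidable_NegI)
        fix v assume v: "w'' \<le> v" "v \<Turnstile> Disj \<phi> \<psi>"
        show "v \<Turnstile> Bot"
          by (rule forces_DisjE[OF v(2) n[OF order_trans[OF w'' order_trans[OF v(1)]]]
                n'[OF order_trans[OF v(1)]]]) simp_all
      qed (use wf in simp)
    qed (use wf in \<open>auto intro: decidableI forces_DisjI2\<close>)
  qed (use wf in \<open>auto intro: decidableI forces_DisjI1\<close>)
qed auto

end

section \<open>Alternation paths and the prenex classes\<close>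

fun quantify :: "sign \<Rightarrow> fm \<Rightarrow> fm" where
  "quantify Minus = Forall"
| "quantify Plus = Exists"

text \<open>Indexing both hierarchies by the sign of the leading block lets one argument serve for
  both, with \<open>swap_sign\<close> as duality.\<close>

fun prenex_class :: "sign \<Rightarrow> nat \<Rightarrow> fm set" where
  "prenex_class Minus k = Pi_class k"
| "prenex_class Plus k = Sigma_class k"

text \<open>\<open>alt_bound Minus k\<close> and \<open>alt_bound Plus k\<close> describe the classes written U and E with superscript +.\<close>

definition alt_bound :: "sign \<Rightarrow> nat \<Rightarrow> fm \<Rightarrow> bool" where
  "alt_bound a k \<phi> \<longleftrightarrow>
     (\<forall>s\<in>Alt \<phi>. length s \<le> k \<and> (length s = k \<longrightarrow> k = 0 \<or> initial s = Some a))"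

lemma swap_swap [simp]: "swap_sign (swap_sign a) = a"
  by (cases a) auto

lemma length_dual [simp]: "length (dual s) = length s"
  by (simp add: dual_def)

lemma initial_dual: "initial (dual s) = Some a \<longleftrightarrow> initial s = Some (swap_sign a)"
  by (cases s; cases a; cases "hd s") (auto simp: dual_def)

lemma Alt_quantify:
  "Alt (quantify a \<phi>) = {s \<in> Alt \<phi>. initial s = Some a} \<union> {a # s | s. s \<in> Alt \<phi> \<and> initial s \<noteq> Some a}"
  by (cases a) auto

lemma wf_quantify [simp]: "wf_fm (quantify a \<phi>) = wf_fm \<phi>"
  by (cases a) auto

lemma FV_quantify [simp]: "FV (quantify a \<phi>) = {n. Suc n \<in> FV \<phi>}"
  by (cases a) auto

lemma subst_quantify [simp]: "subst \<sigma> (quantify a \<phi>) = quantify a (subst (up \<sigma>) \<phi>)"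
  by (cases a) auto

lemma deg_le_iff: "deg \<phi> \<le> k \<longleftrightarrow> (\<forall>s\<in>Alt \<phi>. length s \<le> k)"
  unfolding deg_def by (subst Max_le_iff) (auto simp: finite_Alt Alt_nonempty)

lemma deg_subst [simp]: "deg (subst \<sigma> \<phi>) = deg \<phi>"
  by (simp add: deg_def)

lemma alt_bound_subst [simp]: "alt_bound a k (subst \<sigma> \<phi>) = alt_bound a k \<phi>"
  by (simp add: alt_bound_def)

lemma deg_inst [simp]: "deg (inst t \<phi>) = deg \<phi>"
  by (simp add: inst_def)

lemma alt_bound_inst [simp]: "alt_bound a k (inst t \<phi>) = alt_bound a k \<phi>"
  by (simp add: inst_def)

lemma alt_bound_deg: "alt_bound a k \<phi> \<Longrightarrow> deg \<phi> \<le> k"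
  by (auto simp: alt_bound_def deg_le_iff)

lemma deg_alt_bound: "deg \<phi> < k \<Longrightarrow> alt_bound a k \<phi>"
proof -
  assume "deg \<phi> < k"
  then have "\<forall>s\<in>Alt \<phi>. length s < k" using deg_le_iff[of \<phi> "deg \<phi>"] by auto
  then show ?thesis by (auto simp: alt_bound_def)
qed

lemma alt_bound_Suc: "alt_bound a k \<phi> \<Longrightarrow> alt_bound b (Suc k) \<phi>"
  using alt_bound_deg[of a k \<phi>] deg_alt_bound[of \<phi> "Suc k" b] by simp

lemma alt_bound_Bot: "alt_bound a k Bot"
  by (simp add: alt_bound_def)

lemma alt_bound_Conj: "alt_bound a k (Conj \<phi> \<psi>) \<longleftrightarrow> alt_bound a k \<phi> \<and> alt_bound a k \<psi>"
  by (auto simp: alt_bound_def)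

lemma alt_bound_Disj: "alt_bound a k (Disj \<phi> \<psi>) \<longleftrightarrow> alt_bound a k \<phi> \<and> alt_bound a k \<psi>"
  by (auto simp: alt_bound_def)

lemma alt_bound_Imp: "alt_bound a k (Imp \<phi> \<psi>) \<longleftrightarrow> alt_bound (swap_sign a) k \<phi> \<and> alt_bound a k \<psi>"
proof (cases "\<psi> = Bot")
  \<comment> \<open>The clause for negations leaves out the empty path of \<open>Bot\<close>, which
    meets every bound.\<close>
  case True
  then show ?thesis using alt_bound_Bot by (auto simp: alt_bound_def initial_dual)
next
  case False
  then show ?thesis by (auto simp: alt_bound_def initial_dual ball_Un)
qed

lemma alt_bound_Neg: "alt_bound a k (Neg \<phi>) \<longleftrightarrow> alt_bound (swap_sign a) k \<phi>"
  by (simp add: Neg_def alt_bound_Imp alt_bound_Bot)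

text \<open>A quantifier lengthens only paths that do not begin with its own sign, and the bound
  says that these are shorter than \<open>k\<close>.\<close>

lemma alt_bound_quantify: "alt_bound a k (quantify a \<phi>) \<longleftrightarrow> 0 < k \<and> alt_bound a k \<phi>"
proof
  assume *: "alt_bound a k (quantify a \<phi>)"
  obtain s where "s \<in> Alt (quantify a \<phi>)" using Alt_nonempty by blast
  then have "length s \<noteq> 0" "length s \<le> k" using * by (auto simp: Alt_quantify alt_bound_def)
  then have "0 < k" by (cases k) auto
  moreover have "length s \<le> k \<and> (length s = k \<longrightarrow> k = 0 \<or> initial s = Some a)" if "s \<in> Alt \<phi>" for s
  proof (cases "initial s = Some a")
    case True
    then show ?thesis using that * by (auto simp: Alt_quantify alt_bound_def)
  next
    case False
    then have "a # s \<in> Alt (quantify a \<phi>)" using that by (simp add: Alt_quantify)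
    then have "length (a # s) \<le> k" using * by (auto simp: alt_bound_def)
    then show ?thesis by simp
  qed
  ultimately show "0 < k \<and> alt_bound a k \<phi>" by (simp add: alt_bound_def)
next
  assume "0 < k \<and> alt_bound a k \<phi>"
  then show "alt_bound a k (quantify a \<phi>)"
    by (auto simp: alt_bound_def Alt_quantify)
qed

lemma initial_quantify: "s \<in> Alt (quantify a \<phi>) \<Longrightarrow> initial s = Some a"
  by (auto simp: Alt_quantify)

text \<open>All paths of a quantified formula begin with its sign, so a bound on their length
  already is the signed bound.\<close>

lemma deg_quantify: "deg (quantify a \<phi>) \<le> k \<longleftrightarrow> 0 < k \<and> alt_bound a k \<phi>"
  unfolding alt_bound_quantify[symmetric]
  by (auto simp: deg_le_iff alt_bound_def initial_quantify)

lemma deg_Forall: "deg (Forall \<phi>) \<le> k \<longleftrightarrow> 0 < k \<and> alt_bound Minus k \<phi>"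
  using deg_quantify[of Minus] by simp

lemma deg_Exists: "deg (Exists \<phi>) \<le> k \<longleftrightarrow> 0 < k \<and> alt_bound Plus k \<phi>"
  using deg_quantify[of Plus] by simp

text \<open>Every path begins with \<open>a\<close>, whereas paths of maximal length would have to
  begin with the opposite sign; hence none has length \<open>k\<close>, and one level is
  gained.\<close>

lemma alt_bound_swap_quantify:
  "alt_bound (swap_sign a) k (quantify a \<phi>) \<Longrightarrow> \<exists>k'. k = Suc k' \<and> alt_bound a k' (quantify a \<phi>)"
proof -
  assume *: "alt_bound (swap_sign a) k (quantify a \<phi>)"
  obtain s where s: "s \<in> Alt (quantify a \<phi>)" using Alt_nonempty by blast
  then have "length s \<noteq> 0" "length s \<le> k"
    using * initial_quantify[OF s] by (auto simp: alt_bound_def)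
  then obtain k' where k: "k = Suc k'" by (cases k) auto
  have "length s < k" if "s \<in> Alt (quantify a \<phi>)" for s
  proof -
    have "swap_sign a \<noteq> a" by (cases a) auto
    then have "length s \<le> k" "length s \<noteq> k"
      using * that initial_quantify[OF that] k unfolding alt_bound_def by fastforce+
    then show ?thesis by simp
  qed
  then have "deg (quantify a \<phi>) \<le> k'" using k by (auto simp: deg_le_iff less_Suc_eq_le)
  then show ?thesis using k by (auto simp: alt_bound_quantify deg_quantify)
qed

lemma deg_Imp: "deg (Imp \<phi> \<psi>) \<le> k \<longleftrightarrow> deg \<phi> \<le> k \<and> deg \<psi> \<le> k"
  by (cases "\<psi> = Bot") (auto simp: deg_le_iff ball_Un)

lemma deg_Conj: "deg (Conj \<phi> \<psi>) \<le> k \<longleftrightarrow> deg \<phi> \<le> k \<and> deg \<psi> \<le> k"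
  by (auto simp: deg_le_iff)

lemma deg_Disj: "deg (Disj \<phi> \<psi>) \<le> k \<longleftrightarrow> deg \<phi> \<le> k \<and> deg \<psi> \<le> k"
  by (auto simp: deg_le_iff)

lemma deg_Neg [simp]: "deg (Neg \<phi>) = deg \<phi>"
  by (simp add: deg_def Neg_def image_image)

lemma deg_zero_qfree: "deg \<phi> = 0 \<Longrightarrow> qfree \<phi>"
proof -
  have "deg \<phi> \<le> 0 \<Longrightarrow> qfree \<phi>"
    by (induction \<phi>) (auto simp: deg_Imp deg_Conj deg_Disj deg_Forall deg_Exists simp del: le_zero_eq)
  then show "deg \<phi> = 0 \<Longrightarrow> qfree \<phi>" by simp
qed

lemma U_class_iff: "\<phi> \<in> U_class k \<longleftrightarrow> wf_fm \<phi> \<and> deg \<phi> = k \<and> alt_bound Minus k \<phi>"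
proof -
  have "deg \<phi> = k \<Longrightarrow> \<forall>s\<in>Alt \<phi>. length s \<le> k" using deg_le_iff[of \<phi> k] by blast
  then show ?thesis by (cases k) (auto simp: F_class_def alt_bound_def)
qed

lemma E_class_iff: "\<phi> \<in> E_class k \<longleftrightarrow> wf_fm \<phi> \<and> deg \<phi> = k \<and> alt_bound Plus k \<phi>"
proof -
  have "deg \<phi> = k \<Longrightarrow> \<forall>s\<in>Alt \<phi>. length s \<le> k" using deg_le_iff[of \<phi> k] by blast
  then show ?thesis by (cases k) (auto simp: F_class_def alt_bound_def)
qed

lemma U_plus_iff: "\<phi> \<in> U_plus k \<longleftrightarrow> wf_fm \<phi> \<and> alt_bound Minus k \<phi>"
proof -
  have "\<phi> \<in> U_plus k \<longleftrightarrow> wf_fm \<phi> \<and> (deg \<phi> = k \<and> alt_bound Minus k \<phi> \<or> deg \<phi> < k)"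
    by (auto simp: U_plus_def U_class_iff F_class_def)
  then show ?thesis using alt_bound_deg[of Minus k \<phi>] deg_alt_bound[of \<phi> k Minus] by auto
qed

lemma Neg_in_U_class: "Neg \<phi> \<in> U_class k \<longleftrightarrow> \<phi> \<in> E_class k"
  by (simp add: U_class_iff E_class_iff alt_bound_Neg)

lemma Neg_in_E_class: "Neg \<phi> \<in> E_class k \<longleftrightarrow> \<phi> \<in> U_class k"
  by (simp add: U_class_iff E_class_iff alt_bound_Neg)

text \<open>Makes (2) applicable to any universal formula, at the index that is its exact
  degree.\<close>

lemma Forall_in_U_class: "wf_fm \<phi> \<Longrightarrow> Forall \<phi> \<in> U_class (deg (Forall \<phi>))"
  using alt_bound_quantify[of Minus "deg (Forall \<phi>)" \<phi>] deg_Forall[of \<phi> "deg (Forall \<phi>)"]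
  by (simp add: U_class_iff)

section \<open>The prenex hierarchies\<close>

lemma prenex_class_0: "prenex_class a 0 = {\<phi>. wf_fm \<phi> \<and> qfree \<phi>}"
  by (cases a) auto

lemma prenex_class_Suc:
  "prenex_class a (Suc k) = {(quantify a ^^ n) \<phi> | n \<phi>. \<phi> \<in> prenex_class (swap_sign a) k}"
  by (cases a) auto

lemma prenex_class_swap: "prenex_class (swap_sign a) k \<subseteq> prenex_class a (Suc k)"
  \<comment> \<open>The new leading block is empty.\<close>
  unfolding prenex_class_Suc by (auto intro!: exI[of _ 0])

lemma prenex_class_mono_Suc: "prenex_class a k \<subseteq> prenex_class a (Suc k)"
proof (induction k arbitrary: a)
  case 0
  then show ?case using prenex_class_swap[of a 0] by (simp add: prenex_class_0)
next
  case (Suc k)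
  then show ?case unfolding prenex_class_Suc[of a] by blast
qed

lemma prenex_class_mono: "k \<le> k' \<Longrightarrow> prenex_class a k \<subseteq> prenex_class a k'"
  by (induction k' rule: dec_induct) (use prenex_class_mono_Suc in blast)+

lemma qfree_prenex_class: "wf_fm \<phi> \<Longrightarrow> qfree \<phi> \<Longrightarrow> \<phi> \<in> prenex_class a k"
  using prenex_class_mono[of 0 k a] by (auto simp: prenex_class_0)

lemma quantify_prenex_class: "\<phi> \<in> prenex_class a (Suc k) \<Longrightarrow> quantify a \<phi> \<in> prenex_class a (Suc k)"
  unfolding prenex_class_Suc by (auto, metis comp_apply funpow.simps(2))

lemma subst_quantify_funpow: "subst \<sigma> ((quantify a ^^ n) \<phi>) = (quantify a ^^ n) (subst ((up ^^ n) \<sigma>) \<phi>)"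
  by (induction n arbitrary: \<sigma>) (simp_all add: funpow_swap1[of up])

lemma wf_up_funpow: "(\<And>i. wf_tm (\<sigma> i)) \<Longrightarrow> wf_tm ((up ^^ n) \<sigma> i)"
  by (induction n arbitrary: i) (auto simp: wf_up)

lemma prenex_class_subst:
  "\<phi> \<in> prenex_class a k \<Longrightarrow> (\<And>i. wf_tm (\<sigma> i)) \<Longrightarrow> subst \<sigma> \<phi> \<in> prenex_class a k"
proof (induction k arbitrary: a \<phi> \<sigma>)
  case 0
  then show ?case by (simp add: prenex_class_0 wf_subst)
next
  case (Suc k)
  then obtain n \<psi> where \<phi>: "\<phi> = (quantify a ^^ n) \<psi>" and \<psi>: "\<psi> \<in> prenex_class (swap_sign a) k"
    by (auto simp: prenex_class_Suc)
  have "subst ((up ^^ n) \<sigma>) \<psi> \<in> prenex_class (swap_sign a) k"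
    by (rule Suc.IH[OF \<psi> wf_up_funpow[OF Suc.prems(2)]])
  then show ?case unfolding \<phi> subst_quantify_funpow prenex_class_Suc by blast
qed

lemma prenex_class_inst: "\<phi> \<in> prenex_class a k \<Longrightarrow> wf_tm t \<Longrightarrow> inst t \<phi> \<in> prenex_class a k"
  unfolding inst_def by (rule prenex_class_subst) auto

lemma prenex_class_lift: "\<phi> \<in> prenex_class a k \<Longrightarrow> lift \<phi> \<in> prenex_class a k"
  unfolding lift_def by (rule prenex_class_subst) auto

lemma prenex_class_bound: "\<phi> \<in> prenex_class a k \<Longrightarrow> wf_fm \<phi> \<and> alt_bound a k \<phi>"
proof (induction k arbitrary: a \<phi>)
  case 0
  then show ?case by (simp add: prenex_class_0 alt_bound_def Alt_qfree)
next
  case (Suc k)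
  then obtain n \<psi> where \<phi>: "\<phi> = (quantify a ^^ n) \<psi>" and \<psi>: "\<psi> \<in> prenex_class (swap_sign a) k"
    by (auto simp: prenex_class_Suc)
  have "wf_fm \<psi> \<and> alt_bound a (Suc k) \<psi>" using Suc.IH[OF \<psi>] alt_bound_Suc by blast
  then show ?case unfolding \<phi> by (induction n) (auto simp: alt_bound_quantify)
qed

lemma prenex_class_deg: "\<phi> \<in> prenex_class a k \<Longrightarrow> deg \<phi> \<le> k"
  using prenex_class_bound alt_bound_deg by blast

section \<open>Prenex normal forms in classical arithmetic\<close>

context arithmetic
begin

text \<open>Equivalence at all worlds is a theorem, and theorems are closed under substitution. At a
  single world the variables may occur in its assumptions.\<close>

lemma equivalent_inst:
  assumes "\<And>w. w \<Turnstile> \<phi> \<longleftrightarrow> w \<Turnstile> \<psi>" "wf_fm \<phi>" "wf_fm \<psi>" "wf_tm t"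
  shows "w \<Turnstile> inst t \<phi> \<longleftrightarrow> w \<Turnstile> inst t \<psi>"
proof -
  have "deriv T {} (Iff \<phi> \<psi>)" using assms by (simp add: theorem_Iff)
  then have "w \<Turnstile> subst (case_nat t Var) (Iff \<phi> \<psi>)" by (rule forces_theorem_subst) (use assms in simp)
  then have "w \<Turnstile> Iff (inst t \<phi>) (inst t \<psi>)" by (simp add: Iff_def inst_def)
  then show ?thesis using assms by (auto simp: forces_Iff)
qed

lemma equivalent_quantify:
  assumes "\<And>w. w \<Turnstile> \<phi> \<longleftrightarrow> w \<Turnstile> \<psi>" "wf_fm \<phi>" "wf_fm \<psi>"
  shows "w \<Turnstile> quantify a \<phi> \<longleftrightarrow> w \<Turnstile> quantify a \<psi>"
proof (cases a)
  case Minus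
  then show ?thesis using equivalent_inst[OF assms] by (auto simp: forces_Forall)
next
  case Plus
  have "w \<Turnstile> Exists \<chi>'" if "w \<Turnstile> Exists \<chi>" "\<And>w t. wf_tm t \<Longrightarrow> w \<Turnstile> inst t \<chi> \<Longrightarrow> w \<Turnstile> inst t \<chi>'" for w \<chi> \<chi>'
    by (rule forces_ExistsE[OF that(1)]) (use that(2) in \<open>auto intro: forces_ExistsI\<close>)
  then show ?thesis using Plus equivalent_inst[OF assms] by (auto, metis+)
qed

end

section \<open>Pulling out quantifiers with excluded middle\<close>

locale classical_arithmetic = arithmetic +
  assumes excluded_middle: "wf_fm \<phi> \<Longrightarrow> decidable w \<phi>"
begin

lemma Imp_Exists_left: "wf_fm \<phi> \<Longrightarrow> wf_fm \<psi> \<Longrightarrow> w \<Turnstile> Imp (Exists \<phi>) \<psi> \<longleftrightarrow> w \<Turnstile> Forall (Imp \<phi> (lift \<psi>))"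
  by (auto simp: forces_Imp forces_Forall intro: forces_ExistsI elim!: forces_ExistsE)

lemma Imp_Forall_right: "wf_fm \<phi> \<Longrightarrow> wf_fm \<psi> \<Longrightarrow> w \<Turnstile> Imp \<psi> (Forall \<phi>) \<longleftrightarrow> w \<Turnstile> Forall (Imp (lift \<psi>) \<phi>)"
  by (auto simp: forces_Imp forces_Forall)

text \<open>From left to right this is the drinker argument: if no witness exists, every instance of
  \<open>\<phi>\<close> holds, hence \<open>\<psi>\<close> does.\<close>

lemma Imp_Forall_left:
  assumes wf: "wf_fm \<phi>" "wf_fm \<psi>"
  shows "w \<Turnstile> Imp (Forall \<phi>) \<psi> \<longleftrightarrow> w \<Turnstile> Exists (Imp \<phi> (lift \<psi>))"
proof
  let ?E = "Exists (Imp \<phi> (lift \<psi>))"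
  assume *: "w \<Turnstile> Imp (Forall \<phi>) \<psi>"
  have witness: "w \<Turnstile> ?E" if "w \<Turnstile> Imp (inst t \<phi>) \<psi>" "wf_tm t" for w t
    using that by (intro forces_ExistsI[of _ t]) auto
  have "decidable w ?E" using wf by (intro excluded_middle) simp
  then show "w \<Turnstile> ?E"
  proof (rule decidable_cases)
    fix w' assume w': "w \<le> w'" and n: "\<And>v \<chi>. w' \<le> v \<Longrightarrow> v \<Turnstile> ?E \<Longrightarrow> wf_fm \<chi> \<Longrightarrow> v \<Turnstile> \<chi>"
    have "w' \<Turnstile> inst t \<phi>" if t: "wf_tm t" for t
    proof -
      have "decidable w' (inst t \<phi>)" using wf t by (intro excluded_middle) simp
      then show ?thesis
      proof (rule decidable_cases)
        fix v assume v: "w' \<le> v" and m: "\<And>u \<chi>. v \<le> u \<Longrightarrow> u \<Turnstile> inst t \<phi> \<Longrightarrow> wf_fm \<chi> \<Longrightarrow> u \<Turnstile> \<chi>"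
        have "v \<Turnstile> Imp (inst t \<phi>) \<psi>"
          by (rule forces_ImpI) (use wf t m in simp_all)
        from n[OF v witness[OF this t]] show "v \<Turnstile> inst t \<phi>" using wf t by simp
      qed
    qed
    then have "w' \<Turnstile> \<psi>" using forces_mp[OF forces_mono[OF * w']] by (simp add: forces_Forall)
    \<comment> \<open>As \<open>\<psi>\<close> holds, any term is a witness, so zero is.\<close>
    then have "w' \<Turnstile> Imp (inst zero_tm \<phi>) \<psi>" using wf by (auto intro!: forces_ImpI intro: forces_mono)
    then show "w' \<Turnstile> ?E" by (rule witness) simp
  qed
next
  assume *: "w \<Turnstile> Exists (Imp \<phi> (lift \<psi>))"
  show "w \<Turnstile> Imp (Forall \<phi>) \<psi>"
  proof (rule forces_ImpI)
    fix w' assume w': "w \<le> w'" "w' \<Turnstile> Forall \<phi>"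
    show "w' \<Turnstile> \<psi>"
    proof (rule forces_ExistsE[OF forces_mono[OF * w'(1)]])
      fix v t assume "w' \<le> v" "wf_tm t" "v \<Turnstile> inst t (Imp \<phi> (lift \<psi>))"
      then show "v \<Turnstile> \<psi>" using forces_mono[OF w'(2)] by (auto simp: forces_Forall intro: forces_mp)
    qed
  qed (use wf in simp)
qed

text \<open>Classically \<open>\<psi>\<close> is decided: if it holds, it supplies the witness, and
  otherwise zero is a vacuous one.\<close>

lemma Imp_Exists_right:
  assumes wf: "wf_fm \<phi>" "wf_fm \<psi>"
  shows "w \<Turnstile> Imp \<psi> (Exists \<phi>) \<longleftrightarrow> w \<Turnstile> Exists (Imp (lift \<psi>) \<phi>)"
proof
  let ?E = "Exists (Imp (lift \<psi>) \<phi>)"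
  assume *: "w \<Turnstile> Imp \<psi> (Exists \<phi>)"
  have witness: "w \<Turnstile> ?E" if "w \<Turnstile> Imp \<psi> (inst t \<phi>)" "wf_tm t" for w t
    using that by (intro forces_ExistsI[of _ t]) auto
  show "w \<Turnstile> ?E"
  proof (rule decidable_cases[OF excluded_middle[OF wf(2)]])
    fix w' assume w': "w \<le> w'" "w' \<Turnstile> \<psi>"
    show "w' \<Turnstile> ?E"
    proof (rule forces_ExistsE[OF forces_mp[OF forces_mono[OF * w'(1)] w'(2)]])
      fix v t assume "wf_tm t" "v \<Turnstile> inst t \<phi>"
      then show "v \<Turnstile> ?E" using wf by (intro witness[of _ t] forces_ImpI) (auto intro: forces_mono)
    qed
  next
    fix w' assume "\<And>v \<chi>. w' \<le> v \<Longrightarrow> v \<Turnstile> \<psi> \<Longrightarrow> wf_fm \<chi> \<Longrightarrow> v \<Turnstile> \<chi>"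
    then have "w' \<Turnstile> Imp \<psi> (inst zero_tm \<phi>)" using wf by (intro forces_ImpI) simp_all
    then show "w' \<Turnstile> ?E" by (rule witness) simp
  qed
next
  assume *: "w \<Turnstile> Exists (Imp (lift \<psi>) \<phi>)"
  show "w \<Turnstile> Imp \<psi> (Exists \<phi>)"
  proof (rule forces_ImpI)
    fix w' assume w': "w \<le> w'" "w' \<Turnstile> \<psi>"
    show "w' \<Turnstile> Exists \<phi>"
    proof (rule forces_ExistsE[OF forces_mono[OF * w'(1)]])
      fix v t assume "w' \<le> v" "wf_tm t" "v \<Turnstile> inst t (Imp (lift \<psi>) \<phi>)"
      then show "v \<Turnstile> Exists \<phi>"
        using forces_mono[OF w'(2)] forces_mp[of v \<psi> "inst t \<phi>"] by (auto intro: forces_ExistsI[of _ t])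
    qed
  qed (use wf in simp)
qed

lemma Imp_quantify_left:
  "wf_fm \<phi> \<Longrightarrow> wf_fm \<psi> \<Longrightarrow>
    w \<Turnstile> Imp (quantify (swap_sign a) \<phi>) \<psi> \<longleftrightarrow> w \<Turnstile> quantify a (Imp \<phi> (lift \<psi>))"
  using Imp_Exists_left Imp_Forall_left by (cases a) auto

lemma Imp_quantify_right:
  "wf_fm \<phi> \<Longrightarrow> wf_fm \<psi> \<Longrightarrow>
    w \<Turnstile> Imp \<psi> (quantify a \<phi>) \<longleftrightarrow> w \<Turnstile> quantify a (Imp (lift \<psi>) \<phi>)"
  using Imp_Exists_right Imp_Forall_right by (cases a) auto

definition has_prenex :: "sign \<Rightarrow> nat \<Rightarrow> fm \<Rightarrow> bool" where
  "has_prenex a k \<phi> \<longleftrightarrow> (\<exists>\<psi>\<in>prenex_class a k. FV \<psi> = FV \<phi> \<and> (\<forall>w. w \<Turnstile> \<phi> \<longleftrightarrow> w \<Turnstile> \<psi>))"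

lemma has_prenex_cong:
  "has_prenex a k \<phi> \<Longrightarrow> FV \<phi> = FV \<psi> \<Longrightarrow> (\<And>w. w \<Turnstile> \<psi> \<longleftrightarrow> w \<Turnstile> \<phi>) \<Longrightarrow> has_prenex a k \<psi>"
  by (auto simp: has_prenex_def)

lemma has_prenex_class: "\<phi> \<in> prenex_class a k \<Longrightarrow> has_prenex a k \<phi>"
  by (auto simp: has_prenex_def)

lemma has_prenex_swap: "has_prenex (swap_sign a) k \<phi> \<Longrightarrow> has_prenex a (Suc k) \<phi>"
  unfolding has_prenex_def using prenex_class_swap by blast

lemma has_prenex_quantify:
  assumes "has_prenex a (Suc k) \<phi>" "wf_fm \<phi>"
  shows "has_prenex a (Suc k) (quantify a \<phi>)"
proof -
  from assms(1) obtain \<psi> where \<psi>: "\<psi> \<in> prenex_class a (Suc k)" "FV \<psi> = FV \<phi>" "\<And>w. w \<Turnstile> \<phi> \<longleftrightarrow> w \<Turnstile> \<psi>"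
    unfolding has_prenex_def by blast
  have "w \<Turnstile> quantify a \<phi> \<longleftrightarrow> w \<Turnstile> quantify a \<psi>" for w
    by (rule equivalent_quantify[OF \<psi>(3)]) (use assms prenex_class_bound[OF \<psi>(1)] in auto)
  then show ?thesis
    using quantify_prenex_class[OF \<psi>(1)] \<psi>(2) unfolding has_prenex_def by (intro bexI[of _ "quantify a \<psi>"]) auto
qed

text \<open>Both sides offer quantifiers that come out with sign \<open>a\<close>. Once these are
  out, the rest is the same situation one level lower with the signs exchanged, which drives the
  induction on \<open>k\<close>.\<close>

lemma has_prenex_Imp_class:
  assumes "\<phi> \<in> prenex_class (swap_sign a) k" "\<psi> \<in> prenex_class a k"
  shows "has_prenex a k (Imp \<phi> \<psi>)"
  using assms
proof (induction k arbitrary: a \<phi> \<psi>)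
  case 0
  then show ?case by (intro has_prenex_class) (auto simp: prenex_class_0)
next
  case (Suc k)
  have base: "has_prenex a (Suc k) (Imp \<phi> \<psi>)"
    if "\<phi> \<in> prenex_class a k" "\<psi> \<in> prenex_class (swap_sign a) k" for \<phi> \<psi>
    using Suc.IH[of \<phi> "swap_sign a" \<psi>] that by (simp add: has_prenex_swap)
  have right: "has_prenex a (Suc k) (Imp \<phi> ((quantify a ^^ m) \<psi>))"
    if "\<phi> \<in> prenex_class a k" "\<psi> \<in> prenex_class (swap_sign a) k" for \<phi> \<psi> m
    using that
  proof (induction m arbitrary: \<phi>)
    case 0
    then show ?case by (simp add: base)
  next
    case (Suc m)
    let ?\<psi> = "(quantify a ^^ m) \<psi>"
    have "?\<psi> \<in> prenex_class a (Suc k)" using Suc.prems by (auto simp: prenex_class_Suc)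
    then have wf: "wf_fm \<phi>" "wf_fm ?\<psi>" using Suc.prems prenex_class_bound by blast+
    have "has_prenex a (Suc k) (Imp (lift \<phi>) ?\<psi>)" by (rule Suc.IH[OF prenex_class_lift]) fact+
    then have "has_prenex a (Suc k) (quantify a (Imp (lift \<phi>) ?\<psi>))"
      by (rule has_prenex_quantify) (use wf in simp)
    then show ?case by (rule has_prenex_cong) (use wf in \<open>auto simp: Imp_quantify_right\<close>)
  qed
  have left: "has_prenex a (Suc k) (Imp ((quantify (swap_sign a) ^^ n) \<phi>) \<psi>)"
    if "\<phi> \<in> prenex_class a k" "\<psi> \<in> prenex_class a (Suc k)" for \<phi> \<psi> n
    using that
  proof (induction n arbitrary: \<psi>)
    case 0
    then show ?case using right by (auto simp: prenex_class_Suc)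
  next
    case (Suc n)
    let ?\<phi> = "(quantify (swap_sign a) ^^ n) \<phi>"
    have "?\<phi> \<in> prenex_class (swap_sign a) (Suc k)" using Suc.prems by (auto simp: prenex_class_Suc)
    then have wf: "wf_fm ?\<phi>" "wf_fm \<psi>" using Suc.prems prenex_class_bound by blast+
    have "has_prenex a (Suc k) (Imp ?\<phi> (lift \<psi>))" by (rule Suc.IH[OF _ prenex_class_lift]) fact+
    then have "has_prenex a (Suc k) (quantify a (Imp ?\<phi> (lift \<psi>)))"
      by (rule has_prenex_quantify) (use wf in simp)
    then show ?case by (rule has_prenex_cong) (use wf in \<open>auto simp: Imp_quantify_left\<close>)
  qed
  from Suc.prems(1) obtain n \<chi> where "\<phi> = (quantify (swap_sign a) ^^ n) \<chi>" "\<chi> \<in> prenex_class a k"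
    by (auto simp: prenex_class_Suc)
  then show ?case using left Suc.prems(2) by simp
qed

lemma has_prenex_Imp:
  assumes "has_prenex (swap_sign a) k \<phi>" "has_prenex a k \<psi>" "wf_fm \<phi>"
  shows "has_prenex a k (Imp \<phi> \<psi>)"
proof -
  from assms obtain \<phi>' \<psi>' where *: "\<phi>' \<in> prenex_class (swap_sign a) k" "FV \<phi>' = FV \<phi>" "\<And>w. w \<Turnstile> \<phi> \<longleftrightarrow> w \<Turnstile> \<phi>'"
    "\<psi>' \<in> prenex_class a k" "FV \<psi>' = FV \<psi>" "\<And>w. w \<Turnstile> \<psi> \<longleftrightarrow> w \<Turnstile> \<psi>'"
    unfolding has_prenex_def by blast
  show ?thesis
    by (rule has_prenex_cong[OF has_prenex_Imp_class[OF *(1,4)]])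
      (use * assms(3) prenex_class_bound[OF *(1)] in \<open>auto simp: forces_Imp\<close>)
qed

text \<open>Conjunction and disjunction are rewritten classically with implication and
  \<open>Bot\<close>, so implication is the only connective across which quantifiers have to be
  merged.\<close>

lemma prenex_normal_form:
  assumes "wf_fm \<phi>" "alt_bound a k \<phi>"
  shows "has_prenex a k \<phi>"
  using assms
proof (induction \<phi> arbitrary: a k)
  case (Eq s t)
  then show ?case by (intro has_prenex_class qfree_prenex_class) auto
next
  case Bot
  then show ?case by (intro has_prenex_class qfree_prenex_class) auto
next
  case (Imp \<phi> \<psi>)
  then show ?case by (auto simp: alt_bound_Imp intro: has_prenex_Imp)
next
  case (Conj \<phi> \<psi>)
  have Bot: "has_prenex a k Bot" for a k by (intro has_prenex_class qfree_prenex_class) auto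
  have wf: "wf_fm \<phi>" "wf_fm \<psi>" and p: "has_prenex a k \<phi>" "has_prenex a k \<psi>"
    using Conj by (auto simp: alt_bound_Conj)
  have 1: "has_prenex (swap_sign a) k (Neg \<psi>)"
    unfolding Neg_def by (rule has_prenex_Imp) (use p wf Bot in auto)
  have 2: "has_prenex (swap_sign a) k (Imp \<phi> (Neg \<psi>))"
    by (rule has_prenex_Imp[OF _ 1]) (use p wf in auto)
  have "has_prenex a k (Neg (Imp \<phi> (Neg \<psi>)))"
    unfolding Neg_def[of "Imp _ _"] by (rule has_prenex_Imp[OF 2 Bot]) (use wf in auto)
  then show ?case
  proof (rule has_prenex_cong)
    fix w
    show "w \<Turnstile> Conj \<phi> \<psi> \<longleftrightarrow> w \<Turnstile> Neg (Imp \<phi> (Neg \<psi>))"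
    proof
      assume "w \<Turnstile> Conj \<phi> \<psi>"
      then show "w \<Turnstile> Neg (Imp \<phi> (Neg \<psi>))"
        using wf by (simp add: forces_Conj forces_Neg forces_Imp) (meson forces_mono order_refl)
    next
      assume neg: "w \<Turnstile> Neg (Imp \<phi> (Neg \<psi>))"
      \<comment> \<open>Proof by contradiction for either conjunct: refuting it would give the
        implication that is negated.\<close>
      have c: "w \<Turnstile> \<chi>" if \<chi>: "wf_fm \<chi>" and
        *: "\<And>v. (\<And>u \<xi>. v \<le> u \<Longrightarrow> u \<Turnstile> \<chi> \<Longrightarrow> wf_fm \<xi> \<Longrightarrow> u \<Turnstile> \<xi>) \<Longrightarrow> v \<Turnstile> Imp \<phi> (Neg \<psi>)" for \<chi>
        using excluded_middle[OF \<chi>]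
      proof (rule decidable_cases)
        fix w' assume w': "w \<le> w'" and n: "\<And>u \<xi>. w' \<le> u \<Longrightarrow> u \<Turnstile> \<chi> \<Longrightarrow> wf_fm \<xi> \<Longrightarrow> u \<Turnstile> \<xi>"
        have "w' \<Turnstile> Imp \<phi> (Neg \<psi>)" by (rule *) (rule n)
        then have "w' \<Turnstile> Bot" using neg w' wf by (auto simp: forces_Neg)
        then show "w' \<Turnstile> \<chi>" using \<chi> by (rule forces_Bot)
      qed
      have "w \<Turnstile> \<phi>"
      proof (rule c[OF wf(1)])
        fix v assume "\<And>u \<xi>. v \<le> u \<Longrightarrow> u \<Turnstile> \<phi> \<Longrightarrow> wf_fm \<xi> \<Longrightarrow> u \<Turnstile> \<xi>"
        then show "v \<Turnstile> Imp \<phi> (Neg \<psi>)" using wf by (simp add: forces_Imp)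
      qed
      moreover have "w \<Turnstile> \<psi>"
      proof (rule c[OF wf(2)])
        fix v assume n: "\<And>u \<xi>. v \<le> u \<Longrightarrow> u \<Turnstile> \<psi> \<Longrightarrow> wf_fm \<xi> \<Longrightarrow> u \<Turnstile> \<xi>"
        have "v \<Turnstile> Neg \<psi>" using wf(2) n[of _ Bot] by (simp add: forces_Neg)
        then show "v \<Turnstile> Imp \<phi> (Neg \<psi>)" using wf(1) by (auto intro: forces_ImpI forces_mono)
      qed
      ultimately show "w \<Turnstile> Conj \<phi> \<psi>" by (simp add: forces_Conj)
    qed
  qed simp
next
  case (Disj \<phi> \<psi>)
  have Bot: "has_prenex a k Bot" for a k by (intro has_prenex_class qfree_prenex_class) auto
  have wf: "wf_fm \<phi>" "wf_fm \<psi>" and p: "has_prenex a k \<phi>" "has_prenex a k \<psi>"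
    using Disj by (auto simp: alt_bound_Disj)
  have 1: "has_prenex (swap_sign a) k (Neg \<phi>)"
    unfolding Neg_def by (rule has_prenex_Imp) (use p wf Bot in auto)
  have "has_prenex a k (Imp (Neg \<phi>) \<psi>)"
    by (rule has_prenex_Imp[OF 1 p(2)]) (use wf in auto)
  then show ?case
  proof (rule has_prenex_cong)
    fix w
    show "w \<Turnstile> Disj \<phi> \<psi> \<longleftrightarrow> w \<Turnstile> Imp (Neg \<phi>) \<psi>"
    proof
      assume *: "w \<Turnstile> Disj \<phi> \<psi>"
      show "w \<Turnstile> Imp (Neg \<phi>) \<psi>"
      proof (rule forces_ImpI)
        fix w' assume w': "w \<le> w'" "w' \<Turnstile> Neg \<phi>"
        show "w' \<Turnstile> \<psi>"
          by (rule forces_DisjE[OF forces_mono[OF * w'(1)]])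
            (use w'(2) wf in \<open>auto simp: forces_Neg intro: forces_Bot\<close>)
      qed (use wf in simp)
    next
      assume *: "w \<Turnstile> Imp (Neg \<phi>) \<psi>"
      show "w \<Turnstile> Disj \<phi> \<psi>"
        by (rule forces_DisjE[OF excluded_middle[OF wf(1), unfolded decidable_def]])
          (use wf forces_mp[OF forces_mono[OF *]] in \<open>auto intro: forces_DisjI1 forces_DisjI2\<close>)
    qed
  qed simp
next
  case (Forall \<phi>)
  have *: "has_prenex Minus k (Forall \<phi>)" if "alt_bound Minus k (Forall \<phi>)" for k
  proof -
    have "alt_bound Minus k \<phi>" "k > 0" using that alt_bound_quantify[of Minus k \<phi>] by auto
    then obtain k' where "k = Suc k'" "has_prenex Minus k \<phi>" using Forall by (cases k) auto
    then show ?thesis using has_prenex_quantify[of Minus k' \<phi>] Forall.prems(1) by simp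
  qed
  show ?case
  proof (cases a)
    case Minus
    then show ?thesis using * Forall.prems by simp
  next
    case Plus
    \<comment> \<open>The quantifier has the wrong sign, so the bound drops by one level; an empty
      leading block restores it.\<close>
    then obtain k' where "k = Suc k'" "has_prenex Minus k' (Forall \<phi>)"
      using alt_bound_swap_quantify[of Minus k \<phi>] Forall.prems * by auto
    then show ?thesis using Plus has_prenex_swap[of Plus k'] by simp
  qed
next
  case (Exists \<phi>)
  have *: "has_prenex Plus k (Exists \<phi>)" if "alt_bound Plus k (Exists \<phi>)" for k
  proof -
    have "alt_bound Plus k \<phi>" "k > 0" using that alt_bound_quantify[of Plus k \<phi>] by auto
    then obtain k' where "k = Suc k'" "has_prenex Plus k \<phi>" using Exists by (cases k) auto
    then show ?thesis using has_prenex_quantify[of Plus k' \<phi>] Exists.prems(1) by simp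
  qed
  show ?case
  proof (cases a)
    case Plus
    then show ?thesis using * Exists.prems by simp
  next
    case Minus
    then obtain k' where "k = Suc k'" "has_prenex Plus k' (Exists \<phi>)"
      using alt_bound_swap_quantify[of Plus k \<phi>] Exists.prems * by auto
    then show ?thesis using Minus has_prenex_swap[of Minus k'] by simp
  qed
qed

end

interpretation PA: classical_arithmetic PA
proof
  show "wf_fm \<phi>" if "\<phi> \<in> PA" for \<phi> using that by (rule PA_wf)
  show HA_PA: "deriv PA {} \<phi>" if "deriv HA {} \<phi>" for \<phi>
    using that by (rule deriv_axioms) (auto simp: PA_def intro: deriv.Axiom)
  \<comment> \<open>Excluded middle is stated through \<open>decidable\<close>, a notion of the
    smaller locale, which therefore has to be available for PA beforehand.\<close>
  interpret PA: arithmetic PA by standard (use PA_wf HA_PA in auto)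
  show "arithmetic.decidable PA w \<phi>" if "wf_fm \<phi>" for w \<phi>
    unfolding PA.decidable_def using that
    by (intro PA.forces_theorem deriv.Axiom) (auto simp: PA_def)
qed

lemma PA_prenex:
  assumes "wf_fm \<phi>" "alt_bound a k \<phi>"
  shows "\<exists>\<psi>\<in>prenex_class a k. FV \<psi> = FV \<phi> \<and> deriv PA {} (Iff \<phi> \<psi>)"
  using PA.prenex_normal_form[OF assms] assms(1) prenex_class_bound
  unfolding PA.has_prenex_def by (metis PA.theorem_Iff)

section \<open>Translation and double negation\<close>

context arithmetic
begin

text \<open>
  On the connectives other than implication and universal quantification the translation always
  amounts to a double negation relative to \<open>A\<close>.
\<close>

lemma ntr_iff_dneg:
  assumes A: "wf_fm A"
    and C: "\<And>\<phi> \<psi>. C (Imp \<phi> \<psi>) \<Longrightarrow> C \<phi> \<and> C \<psi>" "\<And>\<phi> \<psi>. C (Conj \<phi> \<psi>) \<Longrightarrow> C \<phi> \<and> C \<psi>"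
      "\<And>\<phi> \<psi>. C (Disj \<phi> \<psi>) \<Longrightarrow> C \<phi> \<and> C \<psi>"
      "\<And>\<phi> t. C (Forall \<phi>) \<Longrightarrow> wf_tm t \<Longrightarrow> C (inst t \<phi>)" "\<And>\<phi> t. C (Exists \<phi>) \<Longrightarrow> wf_tm t \<Longrightarrow> C (inst t \<phi>)"
    and Imp: "\<And>w \<phi> \<psi>. v \<le> w \<Longrightarrow> C (Imp \<phi> \<psi>) \<Longrightarrow> wf_fm (Imp \<phi> \<psi>) \<Longrightarrow>
      w \<Turnstile> Imp (dneg A \<phi>) (dneg A \<psi>) \<Longrightarrow> w \<Turnstile> dneg A (Imp \<phi> \<psi>)"
    and Forall: "\<And>w \<phi>. v \<le> w \<Longrightarrow> C (Forall \<phi>) \<Longrightarrow> wf_fm \<phi> \<Longrightarrow>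
      (\<And>t. wf_tm t \<Longrightarrow> w \<Turnstile> dneg A (inst t \<phi>)) \<Longrightarrow> w \<Turnstile> dneg A (Forall \<phi>)"
    and "v \<le> w" "C \<phi>" "wf_fm \<phi>"
  shows "w \<Turnstile> ntr A \<phi> \<longleftrightarrow> w \<Turnstile> dneg A \<phi>"
  using \<open>v \<le> w\<close> \<open>C \<phi>\<close> \<open>wf_fm \<phi>\<close>
\<comment> \<open>The class \<open>C\<close> and the base world \<open>v\<close> are left open
  because the hypotheses on implication and on the universal quantifier are discharged in two ways:
  by excluded middle holding from \<open>v\<close> on, or by DNS with \<open>A\<close>
  falsity.\<close>
proof (induction \<phi> arbitrary: w rule: fm_inst_induct)
  case (Eq s t)
  then show ?case by (simp add: dneg_def)
next
  case Bot
  then show ?case using A dneg_A[of w A Bot] dneg_Bot dnegE[of w A Bot] forces_Bot by auto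
next
  case (Imp \<phi> \<psi>)
  have wf: "wf_fm \<phi>" "wf_fm \<psi>" using Imp.prems by auto
  have IH: "w' \<Turnstile> ntr A \<phi> \<longleftrightarrow> w' \<Turnstile> dneg A \<phi>" "w' \<Turnstile> ntr A \<psi> \<longleftrightarrow> w' \<Turnstile> dneg A \<psi>" if "w \<le> w'" for w'
    using Imp.IH[OF order_trans[OF Imp.prems(1) that]] C(1)[OF Imp.prems(2)] wf by blast+
  have "w \<Turnstile> ntr A (Imp \<phi> \<psi>) \<longleftrightarrow> w \<Turnstile> Imp (dneg A \<phi>) (dneg A \<psi>)"
    using IH wf A by (simp add: forces_Imp)
  also have "\<dots> \<longleftrightarrow> w \<Turnstile> dneg A (Imp \<phi> \<psi>)"
  proof
    assume *: "w \<Turnstile> dneg A (Imp \<phi> \<psi>)"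
    have "w' \<Turnstile> dneg A \<psi>" if w': "w \<le> w'" "w' \<Turnstile> dneg A \<phi>" for w'
    proof (rule dneg_bind[OF w'(2) wf(2)])
      fix u assume u: "w' \<le> u" "u \<Turnstile> \<phi>"
      have "u \<Turnstile> dneg A (Imp \<phi> \<psi>)" using * w'(1) u(1) by (meson forces_mono)
      then show "u \<Turnstile> dneg A \<psi>"
        by (rule dneg_map) (use wf u(2) in \<open>auto intro: forces_mp forces_mono\<close>)
    qed
    then show "w \<Turnstile> Imp (dneg A \<phi>) (dneg A \<psi>)" using wf A by (auto intro: forces_ImpI)
  qed (use assms(7)[OF Imp.prems] in simp)
  finally show ?case .
next
  case (Conj \<phi> \<psi>)
  have wf: "wf_fm \<phi>" "wf_fm \<psi>" using Conj.prems by auto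
  have IH: "w \<Turnstile> ntr A \<phi> \<longleftrightarrow> w \<Turnstile> dneg A \<phi>" "w \<Turnstile> ntr A \<psi> \<longleftrightarrow> w \<Turnstile> dneg A \<psi>"
    using Conj.IH[OF Conj.prems(1)] C(2)[OF Conj.prems(2)] wf by blast+
  show ?case
  proof
    assume "w \<Turnstile> ntr A (Conj \<phi> \<psi>)"
    then have *: "w \<Turnstile> dneg A \<phi>" "w \<Turnstile> dneg A \<psi>" using IH by (auto simp: forces_Conj)
    show "w \<Turnstile> dneg A (Conj \<phi> \<psi>)"
    proof (rule dneg_bind[OF *(1)])
      fix w' assume w': "w \<le> w'" "w' \<Turnstile> \<phi>"
      show "w' \<Turnstile> dneg A (Conj \<phi> \<psi>)"
        by (rule dneg_map[OF forces_mono[OF *(2) w'(1)]])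
          (use wf w'(2) in \<open>auto simp: forces_Conj intro: forces_mono\<close>)
    qed (use wf in simp)
  next
    assume *: "w \<Turnstile> dneg A (Conj \<phi> \<psi>)"
    have "w \<Turnstile> dneg A \<phi>" "w \<Turnstile> dneg A \<psi>"
      by (rule dneg_map[OF *]; use wf in \<open>simp add: forces_Conj\<close>)+
    then show "w \<Turnstile> ntr A (Conj \<phi> \<psi>)" using IH by (simp add: forces_Conj)
  qed
next
  case (Disj \<phi> \<psi>)
  have wf: "wf_fm \<phi>" "wf_fm \<psi>" using Disj.prems by auto
  have IH: "w' \<Turnstile> ntr A \<phi> \<longleftrightarrow> w' \<Turnstile> dneg A \<phi>" "w' \<Turnstile> ntr A \<psi> \<longleftrightarrow> w' \<Turnstile> dneg A \<psi>" if "w \<le> w'" for w'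
    using Disj.IH[OF order_trans[OF Disj.prems(1) that]] C(3)[OF Disj.prems(2)] wf by blast+
  have ntr: "w \<Turnstile> ntr A (Disj \<phi> \<psi>) \<longleftrightarrow> w \<Turnstile> dneg A (Disj (ntr A \<phi>) (ntr A \<psi>))"
    by (simp add: dneg_def)
  show ?case
    unfolding ntr
  proof
    assume "w \<Turnstile> dneg A (Disj (ntr A \<phi>) (ntr A \<psi>))"
    then show "w \<Turnstile> dneg A (Disj \<phi> \<psi>)"
    proof (rule dneg_bind)
      fix w' assume w': "w \<le> w'" "w' \<Turnstile> Disj (ntr A \<phi>) (ntr A \<psi>)"
      show "w' \<Turnstile> dneg A (Disj \<phi> \<psi>)"
        using w'(2)
      proof (rule forces_DisjE)
        fix u assume "w' \<le> u" "u \<Turnstile> ntr A \<phi>"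
        then have "u \<Turnstile> dneg A \<phi>" using IH w'(1) by (meson order_trans)
        then show "u \<Turnstile> dneg A (Disj \<phi> \<psi>)" by (rule dneg_map) (use wf in \<open>auto intro: forces_DisjI1\<close>)
      next
        fix u assume "w' \<le> u" "u \<Turnstile> ntr A \<psi>"
        then have "u \<Turnstile> dneg A \<psi>" using IH w'(1) by (meson order_trans)
        then show "u \<Turnstile> dneg A (Disj \<phi> \<psi>)" by (rule dneg_map) (use wf in \<open>auto intro: forces_DisjI2\<close>)
      qed
    qed (use wf in simp)
  next
    assume "w \<Turnstile> dneg A (Disj \<phi> \<psi>)"
    then show "w \<Turnstile> dneg A (Disj (ntr A \<phi>) (ntr A \<psi>))"
    proof (rule dneg_map)
      fix w' assume w': "w \<le> w'" "w' \<Turnstile> Disj \<phi> \<psi>"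
      show "w' \<Turnstile> Disj (ntr A \<phi>) (ntr A \<psi>)"
        using w'(2)
      proof (rule forces_DisjE)
        fix u assume u: "w' \<le> u" "u \<Turnstile> \<phi>"
        then have "u \<Turnstile> ntr A \<phi>" using IH(1)[OF order_trans[OF w'(1) u(1)]] dnegI A by simp
        then show "u \<Turnstile> Disj (ntr A \<phi>) (ntr A \<psi>)" using wf A by (auto intro: forces_DisjI1)
      next
        fix u assume u: "w' \<le> u" "u \<Turnstile> \<psi>"
        then have "u \<Turnstile> ntr A \<psi>" using IH(2)[OF order_trans[OF w'(1) u(1)]] dnegI A by simp
        then show "u \<Turnstile> Disj (ntr A \<phi>) (ntr A \<psi>)" using wf A by (auto intro: forces_DisjI2)
      qed
    qed (use wf A in simp)
  qed
next
  case (Forall \<phi>)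
  have wf: "wf_fm \<phi>" using Forall.prems by auto
  have IH: "w \<Turnstile> ntr A (inst t \<phi>) \<longleftrightarrow> w \<Turnstile> dneg A (inst t \<phi>)" if "wf_tm t" for t
    using Forall.IH[OF Forall.prems(1) C(4)[OF Forall.prems(2) that]] wf that by simp
  show ?case
  proof
    assume "w \<Turnstile> ntr A (Forall \<phi>)"
    then show "w \<Turnstile> dneg A (Forall \<phi>)"
      using IH assms(8)[OF Forall.prems(1,2) wf] by (simp add: forces_Forall)
  next
    assume *: "w \<Turnstile> dneg A (Forall \<phi>)"
    have "w \<Turnstile> dneg A (inst t \<phi>)" if "wf_tm t" for t
      by (rule dneg_map[OF *]) (use wf that in \<open>simp_all add: forces_Forall\<close>)
    then show "w \<Turnstile> ntr A (Forall \<phi>)" using IH by (simp add: forces_Forall)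
  qed
next
  case (Exists \<phi>)
  have wf: "wf_fm \<phi>" using Exists.prems by auto
  have IH: "w' \<Turnstile> ntr A (inst t \<phi>) \<longleftrightarrow> w' \<Turnstile> dneg A (inst t \<phi>)" if "wf_tm t" "w \<le> w'" for t w'
    using Exists.IH[OF order_trans[OF Exists.prems(1) that(2)] C(5)[OF Exists.prems(2) that(1)]] wf that by simp
  have ntr: "w \<Turnstile> ntr A (Exists \<phi>) \<longleftrightarrow> w \<Turnstile> dneg A (Exists (ntr (lift A) \<phi>))"
    by (simp add: dneg_def)
  show ?case
    unfolding ntr
  proof
    assume "w \<Turnstile> dneg A (Exists (ntr (lift A) \<phi>))"
    then show "w \<Turnstile> dneg A (Exists \<phi>)"
    proof (rule dneg_bind)
      fix w' assume w': "w \<le> w'" "w' \<Turnstile> Exists (ntr (lift A) \<phi>)"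
      show "w' \<Turnstile> dneg A (Exists \<phi>)"
        using w'(2)
      proof (rule forces_ExistsE)
        fix u t assume u: "w' \<le> u" "wf_tm t" "u \<Turnstile> inst t (ntr (lift A) \<phi>)"
        then have "u \<Turnstile> dneg A (inst t \<phi>)" using IH[OF u(2) order_trans[OF w'(1) u(1)]] by simp
        then show "u \<Turnstile> dneg A (Exists \<phi>)"
          by (rule dneg_map) (use wf u(2) in \<open>auto intro: forces_ExistsI\<close>)
      qed
    qed (use wf in simp)
  next
    assume "w \<Turnstile> dneg A (Exists \<phi>)"
    then show "w \<Turnstile> dneg A (Exists (ntr (lift A) \<phi>))"
    proof (rule dneg_map)
      fix w' assume w': "w \<le> w'" "w' \<Turnstile> Exists \<phi>"
      show "w' \<Turnstile> Exists (ntr (lift A) \<phi>)"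
        using w'(2)
      proof (rule forces_ExistsE)
        fix u t assume u: "w' \<le> u" "wf_tm t" "u \<Turnstile> inst t \<phi>"
        then have "u \<Turnstile> ntr A (inst t \<phi>)"
          using IH[OF u(2) order_trans[OF w'(1) u(1)]] dnegI[OF u(3) A] by simp
        then show "u \<Turnstile> Exists (ntr (lift A) \<phi>)" using u(2) by (intro forces_ExistsI[of _ t]) simp
      qed
    qed (use wf A in simp)
  qed
qed

text \<open>Particular to falsity: if the implication is absurd, so is \<open>\<psi>\<close> and
  with it \<open>\<phi>\<close>, and ex falso then yields the implication. Relative to a general
  \<open>A\<close> the last move breaks down, so \<open>em_Imp\<close> decides \<open>\<phi>\<close>
  instead.\<close>

lemma dneg_Bot_Imp:
  assumes "wf_fm \<phi>" "wf_fm \<psi>" "w \<Turnstile> Imp (dneg Bot \<phi>) (dneg Bot \<psi>)"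
  shows "w \<Turnstile> dneg Bot (Imp \<phi> \<psi>)"
proof -
  have "w' \<Turnstile> Bot" if w': "w \<le> w'" and n: "\<forall>u\<ge>w'. u \<Turnstile> Imp \<phi> \<psi> \<longrightarrow> u \<Turnstile> Bot" for w'
  proof -
    have not_\<psi>: "u \<Turnstile> Bot" if "w' \<le> u" "u \<Turnstile> \<psi>" for u
      using n that assms(1) by (auto intro: forces_mono forces_ImpI)
    have "u \<Turnstile> Bot" if u: "w' \<le> u" "u \<Turnstile> \<phi>" for u
    proof (rule dnegE)
      show "u \<Turnstile> dneg Bot \<psi>"
        using forces_mp[OF forces_mono[OF assms(3) order_trans[OF w' u(1)]] dnegI[OF u(2)]] by simp
      show "v \<Turnstile> Bot" if "u \<le> v" "v \<Turnstile> \<psi>" for v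
        using not_\<psi>[OF order_trans[OF u(1) that(1)] that(2)] .
    qed
    then have "w' \<Turnstile> Imp \<phi> \<psi>" using assms(1,2) by (intro forces_ImpI) (auto intro: forces_Bot)
    then show ?thesis using n by blast
  qed
  then show ?thesis using assms(1,2) by (simp add: forces_dneg)
qed

subsection \<open>Blocks of universal quantifiers\<close>

definition block_insts :: "nat \<Rightarrow> (nat \<Rightarrow> tm) set" where
  "block_insts n = {\<sigma>. (\<forall>i. wf_tm (\<sigma> i)) \<and> (\<forall>i\<ge>n. \<sigma> i = Var (i - n))}"

lemma block_insts_wf: "\<sigma> \<in> block_insts n \<Longrightarrow> wf_tm (\<sigma> i)"
  by (simp add: block_insts_def)

lemma block_insts_Suc:
  "(\<forall>\<sigma>\<in>block_insts (Suc n). P \<sigma>) \<longleftrightarrow> (\<forall>\<sigma>\<in>block_insts n. \<forall>t. wf_tm t \<longrightarrow> P (case_nat t \<sigma>))"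
proof
  assume *: "\<forall>\<sigma>\<in>block_insts (Suc n). P \<sigma>"
  have "case_nat t \<sigma> \<in> block_insts (Suc n)" if "\<sigma> \<in> block_insts n" "wf_tm t" for \<sigma> t
    using that by (auto simp: block_insts_def split: nat.split)
  with * show "\<forall>\<sigma>\<in>block_insts n. \<forall>t. wf_tm t \<longrightarrow> P (case_nat t \<sigma>)" by blast
next
  assume *: "\<forall>\<sigma>\<in>block_insts n. \<forall>t. wf_tm t \<longrightarrow> P (case_nat t \<sigma>)"
  have "P \<sigma>" if \<sigma>: "\<sigma> \<in> block_insts (Suc n)" for \<sigma>
  proof -
    have "(\<lambda>i. \<sigma> (Suc i)) \<in> block_insts n" "wf_tm (\<sigma> 0)" using \<sigma> by (auto simp: block_insts_def)
    moreover have "case_nat (\<sigma> 0) (\<lambda>i. \<sigma> (Suc i)) = \<sigma>" by (auto simp: fun_eq_iff split: nat.split)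
    ultimately show ?thesis using * by metis
  qed
  then show "\<forall>\<sigma>\<in>block_insts (Suc n). P \<sigma>" by blast
qed

text \<open>\<open>P\<close> is abstract in order to cover both forcing and forcing of the
  translation.\<close>

lemma block_insts_iff:
  assumes "\<And>\<phi>. P (Forall \<phi>) \<longleftrightarrow> (\<forall>t. wf_tm t \<longrightarrow> P (inst t \<phi>))"
  shows "P ((Forall ^^ n) \<phi>) \<longleftrightarrow> (\<forall>\<sigma>\<in>block_insts n. P (subst \<sigma> \<phi>))"
proof (induction n arbitrary: \<phi>)
  case 0
  have "block_insts 0 = {Var}" by (auto simp: block_insts_def)
  then show ?case by simp
next
  case (Suc n)
  then show ?case by (simp add: funpow_swap1 assms block_insts_Suc del: funpow.simps) (simp add: funpow_swap1 Suc assms)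
qed

lemma forces_Foralls: "w \<Turnstile> (Forall ^^ n) \<phi> \<longleftrightarrow> (\<forall>\<sigma>\<in>block_insts n. w \<Turnstile> subst \<sigma> \<phi>)"
  by (rule block_insts_iff) (rule forces_Forall)

lemma ntr_Foralls: "w \<Turnstile> ntr A ((Forall ^^ n) \<phi>) \<longleftrightarrow> (\<forall>\<sigma>\<in>block_insts n. w \<Turnstile> ntr A (subst \<sigma> \<phi>))"
  by (rule block_insts_iff) (simp add: forces_Forall)

section \<open>Conservation below excluded middle\<close>

definition em :: "nat \<Rightarrow> world \<Rightarrow> bool" where
  "em m w \<longleftrightarrow> (\<forall>\<phi>. wf_fm \<phi> \<longrightarrow> deg \<phi> \<le> m \<longrightarrow> decidable w \<phi>)"

lemma em_mono: "em m w \<Longrightarrow> w \<le> w' \<Longrightarrow> em m w'"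
  unfolding em_def using decidable_mono by blast

lemma em_Imp:
  assumes "em m w" "deg \<phi> \<le> m" "wf_fm (Imp \<phi> \<psi>)" "wf_fm A" "w \<Turnstile> Imp (dneg A \<phi>) (dneg A \<psi>)"
  shows "w \<Turnstile> dneg A (Imp \<phi> \<psi>)"
proof -
  have "decidable w \<phi>" using assms by (simp add: em_def)
  then show ?thesis
  proof (rule decidable_cases)
    fix w' assume w': "w \<le> w'" "w' \<Turnstile> \<phi>"
    have "w' \<Turnstile> dneg A \<psi>"
      using forces_mp[OF forces_mono[OF assms(5) w'(1)] dnegI[OF w'(2) assms(4)]] .
    then show "w' \<Turnstile> dneg A (Imp \<phi> \<psi>)"
      by (rule dneg_map) (use assms(3) in \<open>auto intro!: forces_ImpI intro: forces_mono\<close>)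
  next
    fix w' assume n: "\<And>u \<chi>. w' \<le> u \<Longrightarrow> u \<Turnstile> \<phi> \<Longrightarrow> wf_fm \<chi> \<Longrightarrow> u \<Turnstile> \<chi>"
    have "w' \<Turnstile> Imp \<phi> \<psi>" using assms(3) n[of _ \<psi>] by (simp add: forces_Imp)
    then show "w' \<Turnstile> dneg A (Imp \<phi> \<psi>)" using assms(4) by (rule dnegI)
  qed
qed

text \<open>\<open>Exists (Neg \<phi>)\<close> obeys the same degree bound as
  \<open>Forall \<phi>\<close> and is decided. A counterexample yields \<open>A\<close>; without
  one, deciding each instance proves \<open>Forall \<phi>\<close> outright.\<close>

lemma em_Forall:
  assumes "em m w" "deg (Forall \<phi>) \<le> m" "wf_fm \<phi>" "wf_fm A" "\<And>t. wf_tm t \<Longrightarrow> w \<Turnstile> dneg A (inst t \<phi>)"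
  shows "w \<Turnstile> dneg A (Forall \<phi>)"
proof -
  have \<phi>: "deg \<phi> \<le> m" and "deg (Exists (Neg \<phi>)) \<le> m"
    using assms(2) alt_bound_deg by (auto simp: deg_Forall deg_Exists alt_bound_Neg)
  then have "decidable w (Exists (Neg \<phi>))" using assms by (simp add: em_def)
  then show ?thesis
  proof (rule decidable_cases)
    fix w' assume w': "w \<le> w'" "w' \<Turnstile> Exists (Neg \<phi>)"
    from w'(2) have "w' \<Turnstile> A"
    proof (rule forces_ExistsE)
      fix u t assume u: "w' \<le> u" "wf_tm t" "u \<Turnstile> inst t (Neg \<phi>)"
      have "u \<Turnstile> dneg A (inst t \<phi>)" using assms(5)[OF u(2)] w'(1) u(1) by (meson forces_mono)
      then show "u \<Turnstile> A"
      proof (rule dnegE)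
        fix v assume "u \<le> v" "v \<Turnstile> inst t \<phi>"
        then have "v \<Turnstile> Bot" using u assms(3) by (auto simp: forces_Neg)
        then show "v \<Turnstile> A" using assms(4) by (rule forces_Bot)
      qed
    qed
    then show "w' \<Turnstile> dneg A (Forall \<phi>)" by (rule dneg_A) (use assms(3) in simp)
  next
    fix w' assume w': "w \<le> w'" and n: "\<And>u \<chi>. w' \<le> u \<Longrightarrow> u \<Turnstile> Exists (Neg \<phi>) \<Longrightarrow> wf_fm \<chi> \<Longrightarrow> u \<Turnstile> \<chi>"
    have "w' \<Turnstile> inst t \<phi>" if t: "wf_tm t" for t
    proof -
      have "decidable w' (inst t \<phi>)" using em_mono[OF assms(1) w'] \<phi> assms(3) t by (simp add: em_def)
      then show ?thesis
      proof (rule decidable_cases)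
        fix u assume u: "w' \<le> u" and "\<And>v \<chi>. u \<le> v \<Longrightarrow> v \<Turnstile> inst t \<phi> \<Longrightarrow> wf_fm \<chi> \<Longrightarrow> v \<Turnstile> \<chi>"
        then have "u \<Turnstile> inst t (Neg \<phi>)" using assms(3) t by (simp add: forces_Neg)
        from n[OF u forces_ExistsI[OF this t]] show "u \<Turnstile> inst t \<phi>" using assms(3) t by simp
      qed
    qed
    then have "w' \<Turnstile> Forall \<phi>" by (simp add: forces_Forall)
    then show "w' \<Turnstile> dneg A (Forall \<phi>)" using assms(4) by (rule dnegI)
  qed
qed

lemma Sigma_class_Suc_cases:
  assumes "\<phi> \<in> Sigma_class (Suc m)"
  shows "deg \<phi> \<le> m \<or> (\<exists>\<psi>. \<phi> = Exists \<psi> \<and> \<psi> \<in> Sigma_class (Suc m))"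
proof -
  from assms obtain n \<eta> where \<phi>: "\<phi> = (Exists ^^ n) \<eta>" and \<eta>: "\<eta> \<in> Pi_class m" by auto
  show ?thesis
  proof (cases n)
    case 0
    then show ?thesis using \<phi> \<eta> prenex_class_deg[of \<eta> Minus m] by simp
  next
    case (Suc j)
    then show ?thesis using \<phi> \<eta> by auto
  qed
qed

text \<open>Implications and universal quantifiers occur only below the leading existential block,
  where the degree is at most \<open>m\<close> and everything is decided. The block itself commutes
  with the double negation, which gains one level over \<open>m\<close>.\<close>

lemma em_ntr_iff_dneg:
  assumes "em m w" "wf_fm A" "\<phi> \<in> Sigma_class (Suc m)"
  shows "w \<Turnstile> ntr A \<phi> \<longleftrightarrow> w \<Turnstile> dneg A \<phi>"
proof (rule ntr_iff_dneg[where C = "\<lambda>\<phi>. deg \<phi> \<le> m \<or> \<phi> \<in> Sigma_class (Suc m)" and v = w])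
  note inst = prenex_class_inst[of _ Plus "Suc m", unfolded prenex_class.simps]
  show "wf_fm \<phi>" using assms(3) prenex_class_bound[of \<phi> Plus "Suc m"] by simp
  fix t :: tm
  fix \<phi>
  show "(deg \<phi> \<le> m \<or> \<phi> \<in> Sigma_class (Suc m)) \<and> (deg \<psi> \<le> m \<or> \<psi> \<in> Sigma_class (Suc m))"
    if "deg (Imp \<phi> \<psi>) \<le> m \<or> Imp \<phi> \<psi> \<in> Sigma_class (Suc m)" for \<psi>
    using that Sigma_class_Suc_cases[of "Imp \<phi> \<psi>" m] deg_Imp by blast
  show "(deg \<phi> \<le> m \<or> \<phi> \<in> Sigma_class (Suc m)) \<and> (deg \<psi> \<le> m \<or> \<psi> \<in> Sigma_class (Suc m))"
    if "deg (Conj \<phi> \<psi>) \<le> m \<or> Conj \<phi> \<psi> \<in> Sigma_class (Suc m)" for \<psi>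
    using that Sigma_class_Suc_cases[of "Conj \<phi> \<psi>" m] deg_Conj by blast
  show "(deg \<phi> \<le> m \<or> \<phi> \<in> Sigma_class (Suc m)) \<and> (deg \<psi> \<le> m \<or> \<psi> \<in> Sigma_class (Suc m))"
    if "deg (Disj \<phi> \<psi>) \<le> m \<or> Disj \<phi> \<psi> \<in> Sigma_class (Suc m)" for \<psi>
    using that Sigma_class_Suc_cases[of "Disj \<phi> \<psi>" m] deg_Disj by blast
  show "deg (inst t \<phi>) \<le> m \<or> inst t \<phi> \<in> Sigma_class (Suc m)"
    if "deg (Forall \<phi>) \<le> m \<or> Forall \<phi> \<in> Sigma_class (Suc m)"
  proof -
    have "deg (Forall \<phi>) \<le> m" using that Sigma_class_Suc_cases[of "Forall \<phi>" m] by blast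
    then show ?thesis using alt_bound_deg unfolding deg_inst deg_Forall by blast
  qed
  show "deg (inst t \<phi>) \<le> m \<or> inst t \<phi> \<in> Sigma_class (Suc m)"
    if "deg (Exists \<phi>) \<le> m \<or> Exists \<phi> \<in> Sigma_class (Suc m)" "wf_tm t"
  proof -
    have "deg (Exists \<phi>) \<le> m \<or> \<phi> \<in> Sigma_class (Suc m)"
      using that(1) Sigma_class_Suc_cases[of "Exists \<phi>" m] by blast
    then show ?thesis using alt_bound_deg inst that(2) unfolding deg_inst deg_Exists by blast
  qed
next
  fix u \<phi> \<psi>
  assume *: "w \<le> u" "deg (Imp \<phi> \<psi>) \<le> m \<or> Imp \<phi> \<psi> \<in> Sigma_class (Suc m)" "wf_fm (Imp \<phi> \<psi>)"
    "u \<Turnstile> Imp (dneg A \<phi>) (dneg A \<psi>)"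
  then have "deg (Imp \<phi> \<psi>) \<le> m" using Sigma_class_Suc_cases[of "Imp \<phi> \<psi>" m] by blast
  then have "deg \<phi> \<le> m" by (simp add: deg_Imp)
  then show "u \<Turnstile> dneg A (Imp \<phi> \<psi>)" using em_Imp[OF em_mono[OF assms(1) *(1)]] * assms(2) by blast
next
  fix u \<phi>
  assume *: "w \<le> u" "deg (Forall \<phi>) \<le> m \<or> Forall \<phi> \<in> Sigma_class (Suc m)" "wf_fm \<phi>"
    "\<And>t. wf_tm t \<Longrightarrow> u \<Turnstile> dneg A (inst t \<phi>)"
  then have "deg (Forall \<phi>) \<le> m" using Sigma_class_Suc_cases[of "Forall \<phi>" m] by blast
  then show "u \<Turnstile> dneg A (Forall \<phi>)" using em_Forall[OF em_mono[OF assms(1) *(1)]] * assms(2) by blast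
qed (use assms in auto)

text \<open>The formula \<open>A\<close> of the translation is chosen as the instance of the matrix to be proved.\<close>

lemma em_conservation:
  assumes "em m w" "\<phi> \<in> Pi_class (Suc (Suc m))" "\<psi> \<in> Pi_class (Suc (Suc m))"
    and "\<And>A. wf_fm A \<Longrightarrow> w \<Turnstile> ntr A \<phi> \<Longrightarrow> w \<Turnstile> ntr A \<psi>" "w \<Turnstile> \<phi>"
  shows "w \<Turnstile> \<psi>"
proof -
  obtain n \<chi> where \<phi>: "\<phi> = (Forall ^^ n) \<chi>" "\<chi> \<in> Sigma_class (Suc m)" using assms(2) by auto
  obtain n' \<chi>' where \<psi>: "\<psi> = (Forall ^^ n') \<chi>'" "\<chi>' \<in> Sigma_class (Suc m)" using assms(3) by auto
  note cls = prenex_class_subst[of _ Plus "Suc m", unfolded prenex_class.simps, OF _ block_insts_wf]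
  have ntr: "w \<Turnstile> ntr A \<phi>" if "wf_fm A" for A
    unfolding \<phi>(1) ntr_Foralls
  proof
    fix \<sigma> assume \<sigma>: "\<sigma> \<in> block_insts n"
    then have "w \<Turnstile> subst \<sigma> \<chi>" using assms(5) unfolding \<phi>(1) forces_Foralls by blast
    from dnegI[OF this that] show "w \<Turnstile> ntr A (subst \<sigma> \<chi>)"
      using em_ntr_iff_dneg[OF assms(1) that cls[OF \<phi>(2) \<sigma>]] by simp
  qed
  show ?thesis
    unfolding \<psi>(1) forces_Foralls
  proof
    fix \<sigma> assume \<sigma>: "\<sigma> \<in> block_insts n'"
    let ?A = "subst \<sigma> \<chi>'"
    have A: "?A \<in> Sigma_class (Suc m)" by (rule cls[OF \<psi>(2) \<sigma>])
    then have wf: "wf_fm ?A" using prenex_class_bound[of ?A Plus "Suc m"] by simp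
    have "w \<Turnstile> ntr ?A ?A" using assms(4)[OF wf ntr[OF wf]] \<sigma> unfolding \<psi>(1) ntr_Foralls by blast
    \<comment> \<open>This is the formula (A \<rightarrow> A) \<rightarrow> A, to which the identity
      is fed.\<close>
    then have "w \<Turnstile> dneg ?A ?A" using em_ntr_iff_dneg[OF assms(1) wf A] by simp
    then show "w \<Turnstile> ?A" by (rule dnegE)
  qed
qed

section \<open>Double negation shift\<close>

definition dns :: "world \<Rightarrow> fm \<Rightarrow> bool" where
  "dns w \<phi> \<longleftrightarrow> (w \<Turnstile> Forall (Neg (Neg \<phi>)) \<longrightarrow> w \<Turnstile> Neg (Neg (Forall \<phi>)))"

lemma dns_iff:
  "dns w \<phi> \<longleftrightarrow> ((\<forall>t. wf_tm t \<longrightarrow> w \<Turnstile> dneg Bot (inst t \<phi>)) \<longrightarrow> w \<Turnstile> dneg Bot (Forall \<phi>))"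
  by (simp add: dns_def forces_Forall Neg_Neg inst_dneg) (simp add: inst_def)

lemma dns_cong:
  assumes "\<And>w t. wf_tm t \<Longrightarrow> w \<Turnstile> inst t \<phi> \<longleftrightarrow> w \<Turnstile> inst t \<psi>" "wf_fm \<phi>" "wf_fm \<psi>" "dns w \<phi>"
  shows "dns w \<psi>"
proof -
  have "w \<Turnstile> dneg Bot (inst t \<phi>) \<longleftrightarrow> w \<Turnstile> dneg Bot (inst t \<psi>)" if "wf_tm t" for t
    using assms that by (simp add: forces_dneg)
  moreover have "w \<Turnstile> dneg Bot (Forall \<phi>) \<longleftrightarrow> w \<Turnstile> dneg Bot (Forall \<psi>)"
    using assms by (simp add: forces_dneg forces_Forall)
  ultimately show ?thesis using assms(4) unfolding dns_iff by blast
qed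

text \<open>Pairing merges the last two parameters into one, until only two free variables are left.\<close>

lemma DNS_parameters:
  assumes DNS: "proves_schema T (DNS (U_plus k))"
    and "\<phi> \<in> U_plus k" "FV \<phi> \<subseteq> {..Suc n}" "\<And>i. wf_tm (\<rho> i)"
  shows "dns w (subst (up \<rho>) \<phi>)"
  using assms(2-)
proof (induction n arbitrary: \<phi> \<rho> w)
  case 0
  have "FV \<phi> \<subseteq> {0, 1}" using 0(2) by auto
  then have "deriv T {} (Forall (Imp (Forall (Neg (Neg \<phi>))) (Neg (Neg (Forall \<phi>)))))"
    using DNS 0(1) unfolding proves_schema_def DNS_def provable_def by blast
  then have "w \<Turnstile> Forall (Imp (Forall (Neg (Neg \<phi>))) (Neg (Neg (Forall \<phi>))))" by (rule forces_theorem)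
  then have "w \<Turnstile> inst (\<rho> 0) (Imp (Forall (Neg (Neg \<phi>))) (Neg (Neg (Forall \<phi>))))"
    using 0(3) unfolding forces_Forall by blast
  moreover have "subst (up (case_nat (\<rho> 0) Var)) \<phi> = subst (up \<rho>) \<phi>"
    by (rule subst_cong) (use \<open>FV \<phi> \<subseteq> {0, 1}\<close> in \<open>auto simp: up_def\<close>)
  ultimately show ?case by (auto simp: dns_def inst_def intro: forces_mp)
next
  case (Suc n)
  \<comment> \<open>In the body, index \<open>0\<close> is bound and parameter \<open>i\<close> has
    index \<open>Suc i\<close>. Thus \<open>?\<tau>\<close> decodes at index \<open>Suc n\<close>
    what \<open>?\<rho>\<close> encodes as parameter \<open>n\<close>.\<close>
  let ?\<tau> = "\<lambda>i. if i \<le> n then Var i else if i = Suc n then pair_fst (Var (Suc n)) else pair_snd (Var (Suc n))"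
  let ?\<phi> = "subst ?\<tau> \<phi>"
  let ?\<rho> = "\<lambda>i. if i = n then pair (\<rho> n) (\<rho> (Suc n)) else \<rho> i"
  have wf\<tau>: "wf_tm (?\<tau> i)" for i by (simp add: pair_fst_def pair_snd_def)
  have wf\<rho>: "wf_tm (?\<rho> i)" for i using Suc.prems(3) by (simp add: pair_def)
  have wf: "wf_fm \<phi>" "wf_fm ?\<phi>" using Suc.prems(1) wf\<tau> by (auto simp: U_plus_iff wf_subst)
  have "?\<phi> \<in> U_plus k" using Suc.prems(1) wf by (simp add: U_plus_iff)
  moreover have "FV ?\<phi> \<subseteq> {..Suc n}"
    by (auto simp: FV_subst pair_fst_def pair_snd_def split: if_splits)
  ultimately have "dns w (subst (up ?\<rho>) ?\<phi>)" using wf\<rho> by (rule Suc.IH)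
  then show ?case
  proof (rule dns_cong[rotated -1])
    fix w t assume t: "wf_tm t"
    let ?\<sigma> = "\<lambda>i. subst_tm (case_nat t ?\<rho>) (?\<tau> i)"
    \<comment> \<open>Beyond the variables of \<open>\<phi>\<close> it copies
      \<open>?\<sigma>\<close>, because replacement of equals asks for provable equality at every
      index, not only at the relevant ones.\<close>
    let ?\<sigma>' = "\<lambda>i. if i \<le> Suc (Suc n) then case_nat t \<rho> i else ?\<sigma> i"
    have wf\<sigma>: "wf_tm (?\<sigma> i)" for i
      using wf\<tau>[of i] t wf\<rho> by (subst wf_subst_tm) (auto split: nat.split)
    have eq: "eqv w (?\<sigma> i) (?\<sigma>' i)" for i
    proof -
      consider "i = 0" | j where "i = Suc j" "i \<le> n" | "i = Suc n" | "i = Suc (Suc n)" | "i > Suc (Suc n)"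
        by (metis Suc_lessI le_SucE not0_implies_Suc not_le)
      then show ?thesis
      proof cases
        case 3
        then show ?thesis
          using pair_fst_pair[of "\<rho> n" "\<rho> (Suc n)" w] Suc.prems(3) by (simp add: pair_fst_def pair_snd_def)
      next
        case 4
        then show ?thesis
          using pair_snd_pair[of "\<rho> n" "\<rho> (Suc n)" w] Suc.prems(3) by (simp add: pair_snd_def)
      next
        case 5
        then show ?thesis using wf\<sigma>[of i] eqv_refl by auto
      qed (use t Suc.prems(3) in \<open>auto intro: eqv_refl\<close>)
    qed
    have "subst ?\<sigma>' \<phi> = subst (case_nat t \<rho>) \<phi>"
      by (rule subst_cong) (use Suc.prems(2) in auto)
    moreover have "w \<Turnstile> subst ?\<sigma> \<phi> \<longleftrightarrow> w \<Turnstile> subst ?\<sigma>' \<phi>"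
      using forces_subst_eqv[of w ?\<sigma> ?\<sigma>' \<phi>] forces_subst_eqv[of w ?\<sigma>' ?\<sigma> \<phi>] eq eqv_sym by blast
    ultimately show "w \<Turnstile> inst t (subst (up ?\<rho>) ?\<phi>) \<longleftrightarrow> w \<Turnstile> inst t (subst (up \<rho>) \<phi>)"
      unfolding inst_subst_up unfolding subst_subst by (simp only:)
  qed (use wf wf\<rho> Suc.prems(3) in \<open>simp_all add: wf_subst wf_up\<close>)
qed

lemma DNS_dns:
  assumes "proves_schema T (DNS (U_plus k))" "\<phi> \<in> U_plus k"
  shows "dns w \<phi>"
proof -
  obtain n where "\<forall>i\<in>FV \<phi>. i < n" using FV_bound by blast
  then have "FV \<phi> \<subseteq> {..Suc n}" by auto
  from DNS_parameters[OF assms this, of Var w] show ?thesis by simp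
qed

text \<open>At falsity implication needs no further principle, and for the universal quantifier the
  bound on the degree of \<open>Forall \<phi>\<close> is what puts \<open>\<phi>\<close> into the
  class of the schema.\<close>

lemma DNS_ntr_iff_dneg:
  assumes "proves_schema T (DNS (U_plus k))" "wf_fm \<phi>" "deg \<phi> \<le> k"
  shows "w \<Turnstile> ntr Bot \<phi> \<longleftrightarrow> w \<Turnstile> dneg Bot \<phi>"
proof (rule ntr_iff_dneg[where C = "\<lambda>\<phi>. deg \<phi> \<le> k" and v = w])
  fix u \<phi>
  assume "deg (Forall \<phi>) \<le> k" "wf_fm \<phi>" "\<And>t. wf_tm t \<Longrightarrow> u \<Turnstile> dneg Bot (inst t \<phi>)"
  moreover from this have "\<phi> \<in> U_plus k" by (simp add: U_plus_iff deg_Forall)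
  ultimately show "u \<Turnstile> dneg Bot (Forall \<phi>)" using DNS_dns[OF assms(1), of \<phi> u] unfolding dns_iff by blast
qed (use assms in \<open>auto simp: deg_Imp deg_Conj deg_Disj deg_Forall deg_Exists intro: dneg_Bot_Imp alt_bound_deg\<close>)

lemma qfree_DNS: "proves_schema T (DNS (U_plus 0))"
proof -
  have "w \<Turnstile> Imp (Forall (Neg (Neg \<phi>))) (Neg (Neg (Forall \<phi>)))" if "wf_fm \<phi>" "qfree \<phi>" for w \<phi>
  proof (rule forces_ImpI)
    fix w' assume w': "w' \<Turnstile> Forall (Neg (Neg \<phi>))"
    have "w' \<Turnstile> inst t \<phi>" if t: "wf_tm t" for t
    proof -
      have *: "w' \<Turnstile> dneg Bot (inst t \<phi>)" using w' t by (simp add: forces_Forall Neg_Neg[symmetric])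
      have "decidable w' (inst t \<phi>)"
        using \<open>wf_fm \<phi>\<close> \<open>qfree \<phi>\<close> t by (intro qfree_decidable) (simp add: inst_def, simp)
      then show ?thesis
      proof (rule decidable_cases)
        fix u assume u: "w' \<le> u" and n: "\<And>v \<chi>. u \<le> v \<Longrightarrow> v \<Turnstile> inst t \<phi> \<Longrightarrow> wf_fm \<chi> \<Longrightarrow> v \<Turnstile> \<chi>"
        have "u \<Turnstile> Bot" by (rule dnegE[OF forces_mono[OF * u]]) (use n[of _ Bot] in simp)
        then show "u \<Turnstile> inst t \<phi>" by (rule forces_Bot) (use \<open>wf_fm \<phi>\<close> t in simp)
      qed
    qed
    then have "w' \<Turnstile> Forall \<phi>" by (simp add: forces_Forall)
    then show "w' \<Turnstile> Neg (Neg (Forall \<phi>))" unfolding Neg_Neg by (rule dnegI) simp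
  qed (use that in simp)
  moreover have "wf_fm \<phi> \<and> qfree \<phi>" if "\<phi> \<in> U_plus 0" for \<phi>
    using that alt_bound_deg[of Minus 0 \<phi>] deg_zero_qfree[of \<phi>] by (simp add: U_plus_iff)
  ultimately have "deriv T {} (Imp (Forall (Neg (Neg \<phi>))) (Neg (Neg (Forall \<phi>))))" if "\<phi> \<in> U_plus 0" for \<phi>
    using that unfolding theorem_iff_forces by blast
  then show ?thesis
    using deriv_closed_Foralls[of T _ 1] unfolding proves_schema_def DNS_def provable_def by fastforce
qed

subsection \<open>Excluded middle under a double negation\<close>

text \<open>Universal closures have no free variables, so this infinite context is still a world and
  always leaves fresh variables.\<close>

definition em_closures :: "nat \<Rightarrow> fm set" where
  "em_closures m =
     {(Forall ^^ n) (Disj \<eta> (Neg \<eta>)) | n \<eta>. wf_fm \<eta> \<and> deg \<eta> \<le> m \<and> (\<forall>i\<in>FV \<eta>. i < n)}"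

lemma FV_Foralls: "FV ((Forall ^^ n) \<phi>) = {i. i + n \<in> FV \<phi>}"
  by (induction n) auto

lemma hyps_em_closures: "hyps (World (em_closures m)) = em_closures m"
proof (rule World_inverse)
  have "FV \<phi> = {}" if "\<phi> \<in> em_closures m" for \<phi>
    using that by (auto simp: em_closures_def FV_Foralls)
  then have "\<Union>(FV ` em_closures m) = {}" by blast
  then show "em_closures m \<in> {\<Gamma>. finite (\<Union>(FV ` \<Gamma>))}" by simp
qed

lemma em_em_closures: "em m (World (em_closures m))"
  unfolding em_def
proof (intro allI impI)
  fix \<eta> assume \<eta>: "wf_fm \<eta>" "deg \<eta> \<le> m"
  let ?D = "Disj \<eta> (Neg \<eta>)"
  obtain n where n: "\<forall>i\<in>FV \<eta>. i < n" using FV_bound by blast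
  then have "(Forall ^^ n) ?D \<in> em_closures m" using \<eta> by (auto simp: em_closures_def)
  then have "deriv T (em_closures m) ((Forall ^^ n) ?D)" by (rule deriv.Assm) (use \<eta> in simp)
  \<comment> \<open>Each bound variable is instantiated by the variable of the same index, which
    restores the open formula.\<close>
  then have "deriv T (em_closures m) (subst (\<lambda>i. if i < n then Var i else Var (i - n)) ?D)"
    by (rule deriv_instances) simp
  also have "subst (\<lambda>i. if i < n then Var i else Var (i - n)) ?D = subst Var ?D"
    by (rule subst_cong) (use n in auto)
  finally show "decidable (World (em_closures m)) \<eta>"
    by (simp add: decidable_def forces_def hyps_em_closures)
qed

lemma dneg_excluded_middle: "wf_fm \<eta> \<Longrightarrow> w \<Turnstile> dneg Bot (Disj \<eta> (Neg \<eta>))"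
proof -
  assume wf: "wf_fm \<eta>"
  have "w' \<Turnstile> Bot" if n: "\<forall>u\<ge>w'. u \<Turnstile> Disj \<eta> (Neg \<eta>) \<longrightarrow> u \<Turnstile> Bot" for w'
  proof -
    have "u \<Turnstile> Bot" if "w' \<le> u" "u \<Turnstile> \<eta>" for u
      using n that(1) forces_DisjI1[OF that(2), of "Neg \<eta>"] wf by simp
    then have "w' \<Turnstile> Neg \<eta>" using wf by (simp add: forces_Neg)
    from forces_DisjI2[OF this wf] show ?thesis using n by simp
  qed
  then show ?thesis using wf by (simp add: forces_dneg)
qed

text \<open>The open instance is doubly negated in any case. Prefixing universal quantifiers to a
  formula of degree at most \<open>m\<close> stays inside U with superscript + at
  \<open>Suc m\<close>, so the double negation moves outward one quantifier at a time.\<close>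

lemma DNS_em_closures:
  assumes "proves_schema T (DNS (U_plus (Suc m)))" "\<phi> \<in> em_closures m"
  shows "deriv T {} (dneg Bot \<phi>)"
proof -
  from assms(2) obtain n \<eta> where \<phi>: "\<phi> = (Forall ^^ n) (Disj \<eta> (Neg \<eta>))" and \<eta>: "wf_fm \<eta>" "deg \<eta> \<le> m"
    by (auto simp: em_closures_def)
  let ?D = "Disj \<eta> (Neg \<eta>)"
  have bound: "alt_bound Minus (Suc m) ((Forall ^^ j) ?D)" for j
  proof (induction j)
    case 0
    then show ?case using \<eta> deg_alt_bound by (simp add: alt_bound_Disj alt_bound_Neg)
  next
    case (Suc j)
    then show ?case using alt_bound_quantify[of Minus "Suc m"] by simp
  qed
  have "deriv T {} (dneg Bot ((Forall ^^ j) ?D))" for j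
  proof (induction j)
    case 0
    then show ?case using \<eta> by (simp add: theorem_iff_forces dneg_excluded_middle)
  next
    case (Suc j)
    have "w \<Turnstile> dneg Bot (inst t ((Forall ^^ j) ?D))" if "wf_tm t" for w t
      using forces_theorem_subst[OF Suc, of "case_nat t Var" w] that by (simp add: dneg_def inst_def)
    moreover have "(Forall ^^ j) ?D \<in> U_plus (Suc m)" using \<eta> bound by (simp add: U_plus_iff)
    ultimately show ?case
      using DNS_dns[OF assms(1)] unfolding dns_iff theorem_iff_forces by simp
  qed
  then show ?thesis unfolding \<phi> .
qed

text \<open>Finitely many assumptions are used, and the monad absorbs them one by one.\<close>

lemma deriv_dneg_assumptions:
  assumes "deriv T L \<phi>" "\<And>\<psi>. \<psi> \<in> L \<Longrightarrow> deriv T {} (dneg Bot \<psi>)"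
  shows "deriv T {} (dneg Bot \<phi>)"
proof -
  obtain \<Delta> where "finite \<Delta>" "\<Delta> \<subseteq> L" "deriv T \<Delta> \<phi>" using deriv_finite[OF assms(1)] by blast
  then show ?thesis
  proof (induction \<Delta> arbitrary: \<phi>)
    case empty
    then show ?case by (simp add: theorem_iff_forces dnegI)
  next
    case (insert \<psi> \<Delta>)
    have \<psi>: "deriv T {} (dneg Bot \<psi>)" using insert.prems assms(2) by simp
    have "wf_fm (dneg Bot \<psi>)" using deriv_wf[OF \<psi>] wf_T by blast
    then have wf: "wf_fm \<psi>" by simp
    have "deriv T \<Delta> (Imp \<psi> \<phi>)" using deriv.ImpI[OF wf insert.prems(2)] .
    then have imp: "deriv T {} (dneg Bot (Imp \<psi> \<phi>))" using insert by blast
    have "wf_fm (dneg Bot (Imp \<psi> \<phi>))" using deriv_wf[OF imp] wf_T by blast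
    then have wf': "wf_fm \<phi>" by simp
    have "w \<Turnstile> dneg Bot \<phi>" for w
    proof (rule dneg_bind[OF forces_theorem[OF imp] wf'])
      fix w' assume w': "w' \<Turnstile> Imp \<psi> \<phi>"
      show "w' \<Turnstile> dneg Bot \<phi>"
        by (rule dneg_map[OF forces_theorem[OF \<psi>] wf']) (use w' in \<open>blast intro: forces_mp forces_mono\<close>)
    qed
    then show ?case by (simp add: theorem_iff_forces)
  qed
qed

end

section \<open>The equivalence\<close>

locale between = arithmetic +
  assumes T_PA: "deriv T {} \<phi> \<Longrightarrow> deriv PA {} \<phi>"
begin

text \<open>The bridge by which classical equivalences become equivalences in
  \<open>T\<close>.\<close>

lemma PA_equivalent_ntr:
  assumes "deriv PA {} (Iff \<phi> \<psi>)" "wf_fm \<phi>" "wf_fm \<psi>" "wf_fm A"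
  shows "w \<Turnstile> ntr A \<phi> \<longleftrightarrow> w \<Turnstile> ntr A \<psi>"
proof -
  have "w \<Turnstile> ntr A (Iff \<phi> \<psi>)" using ntr_sound assms(1,4) by blast
  then show ?thesis using assms by (auto simp: Iff_def forces_Conj intro: forces_mp)
qed

lemma DNS_PNFT:
  assumes "proves_schema T (DNS (U_plus k))" "k' \<le> k"
  shows "PNFT T ((Neg \<circ> Neg) ` U_class k') ((Neg \<circ> Neg) ` Pi_class k')"
  unfolding PNFT_def
proof clarify
  fix \<phi> assume \<phi>: "\<phi> \<in> U_class k'"
  then have wf: "wf_fm \<phi>" and b: "deg \<phi> = k'" "alt_bound Minus k' \<phi>" by (auto simp: U_class_iff)
  from PA_prenex[OF wf b(2)] obtain \<psi> where \<psi>: "\<psi> \<in> Pi_class k'" "FV \<psi> = FV \<phi>" "deriv PA {} (Iff \<phi> \<psi>)"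
    by auto
  have wf': "wf_fm \<psi>" "deg \<psi> \<le> k'"
    using \<psi>(1) prenex_class_bound[of \<psi> Minus k'] prenex_class_deg[of \<psi> Minus k'] by auto
  have "w \<Turnstile> dneg Bot \<phi> \<longleftrightarrow> w \<Turnstile> dneg Bot \<psi>" for w
    using PA_equivalent_ntr[OF \<psi>(3) wf wf'(1), of Bot w] DNS_ntr_iff_dneg[OF assms(1), of _ w] wf b wf' assms(2)
    by simp
  then have "T \<turnstile> Iff (dneg Bot \<phi>) (dneg Bot \<psi>)"
    unfolding provable_def using wf wf' by (simp add: theorem_Iff)
  then show "\<exists>\<phi>'\<in>(Neg \<circ> Neg) ` Pi_class k'. FV ((Neg \<circ> Neg) \<phi>) = FV \<phi>' \<and> T \<turnstile> Iff ((Neg \<circ> Neg) \<phi>) \<phi>'"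
    using \<psi> by (auto simp: Neg_Neg[symmetric] intro!: bexI[of _ \<psi>])
qed

text \<open>Packages the two uses of one instance of (2): as an equivalence of double negations in
  \<open>T\<close>, and, since \<open>T\<close> is contained in PA and the translation ignores
  double negation, as an equivalence of all translations.\<close>

lemma PNFT_Pi:
  assumes "PNFT T ((Neg \<circ> Neg) ` U_class k') ((Neg \<circ> Neg) ` Pi_class k')" "\<phi> \<in> U_class k'" "k' \<le> k"
  obtains \<psi> where "\<psi> \<in> Pi_class k" "\<And>w. w \<Turnstile> dneg Bot \<phi> \<longleftrightarrow> w \<Turnstile> dneg Bot \<psi>"
    "\<And>w A. wf_fm A \<Longrightarrow> w \<Turnstile> ntr A \<phi> \<longleftrightarrow> w \<Turnstile> ntr A \<psi>"
proof -
  from assms(1,2) obtain \<psi> where \<psi>: "\<psi> \<in> Pi_class k'" "deriv T {} (Iff (Neg (Neg \<phi>)) (Neg (Neg \<psi>)))"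
    unfolding PNFT_def provable_def by fastforce
  have wf: "wf_fm \<phi>" "wf_fm \<psi>"
    using assms(2) \<psi>(1) prenex_class_bound[of \<psi> Minus k'] by (auto simp: U_class_iff)
  show ?thesis
  proof (rule that[of \<psi>])
    show "\<psi> \<in> Pi_class k" using \<psi>(1) prenex_class_mono[OF assms(3), of Minus] by auto
    show "w \<Turnstile> dneg Bot \<phi> \<longleftrightarrow> w \<Turnstile> dneg Bot \<psi>" for w
      using \<psi>(2) wf unfolding Neg_Neg by (simp add: theorem_Iff)
    show "w \<Turnstile> ntr A \<phi> \<longleftrightarrow> w \<Turnstile> ntr A \<psi>" if "wf_fm A" for w A
      using PA_equivalent_ntr[OF T_PA[OF \<psi>(2)], of A w] wf that by (simp add: ntr_dneg_iff)
  qed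
qed

section \<open>The induction step from (2) to (3)\<close>

context
  fixes k :: nat
  assumes PNFT: "\<And>k'. k' \<le> Suc k \<Longrightarrow> PNFT T ((Neg \<circ> Neg) ` U_class k') ((Neg \<circ> Neg) ` Pi_class k')"
    and DNS: "proves_schema T (DNS (U_plus k))"
begin

text \<open>The translation commutes with the leading universal block, and below it the degree is at
  most \<open>k\<close>, where translation and double negation agree.\<close>

lemma Pi_imp_ntr:
  assumes "\<psi> \<in> Pi_class (Suc k)" "w \<Turnstile> \<psi>"
  shows "w \<Turnstile> ntr Bot \<psi>"
proof -
  obtain n \<chi> where \<psi>: "\<psi> = (Forall ^^ n) \<chi>" "\<chi> \<in> Sigma_class k" using assms(1) by auto
  have \<chi>: "wf_fm \<chi>" "deg \<chi> \<le> k"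
    using \<psi>(2) prenex_class_bound[of \<chi> Plus k] prenex_class_deg[of \<chi> Plus k] by auto
  show ?thesis
    unfolding \<psi>(1) ntr_Foralls
  proof
    fix \<sigma> assume \<sigma>: "\<sigma> \<in> block_insts n"
    then have "w \<Turnstile> subst \<sigma> \<chi>" using assms(2) unfolding \<psi>(1) forces_Foralls by blast
    then have "w \<Turnstile> dneg Bot (subst \<sigma> \<chi>)" by (rule dnegI) simp
    then show "w \<Turnstile> ntr Bot (subst \<sigma> \<chi>)"
      using DNS_ntr_iff_dneg[OF DNS, of "subst \<sigma> \<chi>" w] \<chi> block_insts_wf[OF \<sigma>] by (simp add: wf_subst)
  qed
qed

text \<open>At degree \<open>Suc k\<close> the shift is not yet available for the formula itself, so
  the implication is taken from its prenex substitute; stability of the translation absorbs the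
  double negation.\<close>

lemma dneg_imp_ntr:
  assumes "\<phi> \<in> U_plus (Suc k)" "w \<Turnstile> dneg Bot \<phi>"
  shows "w \<Turnstile> ntr Bot \<phi>"
proof (cases "deg \<phi> \<le> k")
  case True
  then show ?thesis using DNS_ntr_iff_dneg[OF DNS] assms by (simp add: U_plus_iff)
next
  case False
  then have "deg \<phi> = Suc k" using assms(1) alt_bound_deg[of Minus "Suc k" \<phi>] by (simp add: U_plus_iff)
  then have "\<phi> \<in> U_class (Suc k)" using assms(1) by (simp only: U_plus_iff U_class_iff)
  from PNFT_Pi[OF PNFT this order_refl] obtain \<psi> where
    \<psi>: "\<psi> \<in> Pi_class (Suc k)" "\<And>w. w \<Turnstile> dneg Bot \<phi> \<longleftrightarrow> w \<Turnstile> dneg Bot \<psi>"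
      "\<And>w A. wf_fm A \<Longrightarrow> w \<Turnstile> ntr A \<phi> \<longleftrightarrow> w \<Turnstile> ntr A \<psi>" by auto
  have "wf_fm \<psi>" using \<psi>(1) prenex_class_bound[of \<psi> Minus "Suc k"] by simp
  have "w \<Turnstile> dneg Bot \<psi>" using assms(2) \<psi>(2) by simp
  then have "w \<Turnstile> ntr Bot \<psi>" by (rule ntr_bind[OF _ \<open>wf_fm \<psi>\<close>]) (use Pi_imp_ntr[OF \<psi>(1)] in blast)
  then show ?thesis using \<psi>(3) by simp
qed

text \<open>The hypothesis puts double negations inside the leading block, and moving them out is
  the very shift sought at this level. A second use of (2) supplies a prenex \<open>\<psi>2\<close>
  whose matrix carries no double negation, and this formula implies \<open>\<psi>\<close> up to a
  double negation.\<close>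

lemma ntr_imp_dneg:
  assumes "\<psi> \<in> Pi_class (Suc k)" "w \<Turnstile> ntr Bot \<psi>"
  shows "w \<Turnstile> dneg Bot \<psi>"
proof -
  obtain n \<chi> where \<psi>: "\<psi> = (Forall ^^ n) \<chi>" and \<chi>: "\<chi> \<in> Sigma_class k" using assms(1) by auto
  have wf: "wf_fm \<chi>" and deg: "deg \<chi> \<le> k"
    using \<chi> prenex_class_bound[of \<chi> Plus k] prenex_class_deg[of \<chi> Plus k] by auto
  have N: "w \<Turnstile> ntr Bot (subst \<sigma> \<chi>) \<longleftrightarrow> w \<Turnstile> dneg Bot (subst \<sigma> \<chi>)" if "\<sigma> \<in> block_insts j" for w \<sigma> j
    using DNS_ntr_iff_dneg[OF DNS, of "subst \<sigma> \<chi>" w] wf deg block_insts_wf[OF that] by (simp add: wf_subst)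
  let ?\<theta> = "(Forall ^^ n) (Neg (Neg \<chi>))"
  have "w \<Turnstile> ?\<theta>"
    using assms(2) N unfolding \<psi> ntr_Foralls forces_Foralls by (simp add: Neg_Neg[symmetric])
  show ?thesis
  \<comment> \<open>Only a nonempty block makes \<open>?\<theta>\<close> a universal formula, and so
    a member of U at its own degree.\<close>
  proof (cases "n = 0")
    case True
    then show ?thesis using assms(2) \<psi> DNS_ntr_iff_dneg[OF DNS wf deg] by simp
  next
    case n: False
    show ?thesis
    proof (cases k)
      case 0
      \<comment> \<open>No level remains below for excluded middle, but the matrix is
        quantifier-free and decidable, so its double negation can be removed on the spot.\<close>
      have "w \<Turnstile> \<psi>"
        unfolding \<psi> forces_Foralls
      proof
        fix \<sigma> assume \<sigma>: "\<sigma> \<in> block_insts n"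
        have *: "w \<Turnstile> dneg Bot (subst \<sigma> \<chi>)"
          using \<open>w \<Turnstile> ?\<theta>\<close> \<sigma> unfolding forces_Foralls by (simp add: Neg_Neg[symmetric])
        have wf': "wf_fm (subst \<sigma> \<chi>)" using wf block_insts_wf[OF \<sigma>] by (simp add: wf_subst)
        have "decidable w (subst \<sigma> \<chi>)"
          using \<chi> 0 wf' by (intro qfree_decidable) auto
        then show "w \<Turnstile> subst \<sigma> \<chi>"
        proof (rule decidable_cases)
          fix u assume u: "w \<le> u" and m: "\<And>v \<xi>. u \<le> v \<Longrightarrow> v \<Turnstile> subst \<sigma> \<chi> \<Longrightarrow> wf_fm \<xi> \<Longrightarrow> v \<Turnstile> \<xi>"
          have "u \<Turnstile> Bot" by (rule dnegE[OF forces_mono[OF * u]]) (use m[of _ Bot] in simp)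
          then show "u \<Turnstile> subst \<sigma> \<chi>" using wf' by (rule forces_Bot)
        qed
      qed
      then show ?thesis by (rule dnegI) simp
    next
      case (Suc m)
      obtain \<theta>' where \<theta>': "?\<theta> = Forall \<theta>'" using n by (cases n) auto
      have "deg ?\<theta> \<le> Suc k"
      proof -
        have "alt_bound Minus (Suc k) ((Forall ^^ j) (Neg (Neg \<chi>)))" for j
        proof (induction j)
          case 0
          then show ?case using deg deg_alt_bound by (simp add: alt_bound_Neg)
        next
          case (Suc j)
          then show ?case using alt_bound_quantify[of Minus "Suc k"] by simp
        qed
        then show ?thesis by (rule alt_bound_deg)
      qed
      moreover have "?\<theta> \<in> U_class (deg ?\<theta>)"
        unfolding \<theta>' by (rule Forall_in_U_class) (use wf \<theta>' in \<open>metis wf_Neg wf_funpow_Forall wf_fm.simps(6)\<close>)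
      ultimately obtain \<psi>2 where
        \<psi>2: "\<psi>2 \<in> Pi_class (Suc k)" "\<And>w. w \<Turnstile> dneg Bot ?\<theta> \<longleftrightarrow> w \<Turnstile> dneg Bot \<psi>2"
          "\<And>w A. wf_fm A \<Longrightarrow> w \<Turnstile> ntr A ?\<theta> \<longleftrightarrow> w \<Turnstile> ntr A \<psi>2"
        using PNFT_Pi[OF PNFT] by metis
      have wf2: "wf_fm \<psi>2" using \<psi>2(1) prenex_class_bound[of \<psi>2 Minus "Suc k"] by simp
      \<comment> \<open>Under any translation \<open>?\<theta>\<close> and \<open>\<psi>\<close>
        cannot be told apart, hence \<open>\<psi>2\<close> yields \<open>\<psi>\<close>
        there.\<close>
      have ntr: "v \<Turnstile> ntr A \<psi>" if "wf_fm A" "v \<Turnstile> ntr A \<psi>2" for v A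
      proof -
        have *: "v \<Turnstile> ntr A ?\<theta>" using \<psi>2(3) that by simp
        show ?thesis
          unfolding \<psi> ntr_Foralls
        proof
          fix \<sigma> assume \<sigma>: "\<sigma> \<in> block_insts n"
          have "v \<Turnstile> ntr A (Neg (Neg (subst \<sigma> \<chi>)))" using * \<sigma> unfolding ntr_Foralls by simp
          then show "v \<Turnstile> ntr A (subst \<sigma> \<chi>)"
            using ntr_dneg_iff[OF that(1)] wf block_insts_wf[OF \<sigma>] by (simp add: wf_subst)
        qed
      qed
      let ?L = "World (em_closures m)"
      \<comment> \<open>Proved with excluded middle as an extra context, which is discharged
        afterwards at the price of one double negation; the goal has one to absorb it.\<close>
      have "?L \<Turnstile> Imp \<psi>2 \<psi>"
      proof (rule forces_ImpI[OF wf2])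
        fix v assume "?L \<le> v" "v \<Turnstile> \<psi>2"
        then show "v \<Turnstile> \<psi>"
          using em_conservation[OF em_mono[OF em_em_closures]] \<psi>2(1) assms(1) ntr Suc by blast
      qed
      then have "deriv T (em_closures m) (Imp \<psi>2 \<psi>)" by (simp add: forces_def hyps_em_closures)
      then have "deriv T {} (dneg Bot (Imp \<psi>2 \<psi>))"
        by (rule deriv_dneg_assumptions) (use DNS_em_closures DNS Suc in blast)
      then have "w \<Turnstile> dneg Bot (Imp \<psi>2 \<psi>)" by (rule forces_theorem)
      then show ?thesis
      proof (rule dneg_bind)
        show "wf_fm \<psi>" using wf \<psi> by simp
        fix v assume v: "w \<le> v" "v \<Turnstile> Imp \<psi>2 \<psi>"
        have "w \<Turnstile> dneg Bot \<psi>2" using dnegI[OF \<open>w \<Turnstile> ?\<theta>\<close>, of Bot] \<psi>2(2) by simp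
        then show "v \<Turnstile> dneg Bot \<psi>"
          by (rule dneg_map[OF forces_mono[OF _ v(1)] \<open>wf_fm \<psi>\<close>])
            (use v(2) in \<open>blast intro: forces_mp forces_mono\<close>)
      qed
    qed
  qed
qed

text \<open>The translation commutes with the quantifier on the nose, so the shift is made there:
  each instance is translated, quantified, and only then turned back into a double negation by way
  of a prenex substitute.\<close>

lemma PNFT_dns:
  assumes "\<phi> \<in> U_plus (Suc k)"
  shows "dns w \<phi>"
  unfolding dns_iff
proof
  assume *: "\<forall>t. wf_tm t \<longrightarrow> w \<Turnstile> dneg Bot (inst t \<phi>)"
  have wf: "wf_fm \<phi>" and b: "alt_bound Minus (Suc k) \<phi>" using assms by (auto simp: U_plus_iff)
  have "w \<Turnstile> ntr Bot (inst t \<phi>)" if "wf_tm t" for t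
    by (rule dneg_imp_ntr) (use * that wf b in \<open>auto simp: U_plus_iff\<close>)
  then have ntr: "w \<Turnstile> ntr Bot (Forall \<phi>)" by (simp add: forces_Forall lift_def flip: inst_ntr)
  have "deg (Forall \<phi>) \<le> Suc k" using b by (simp add: deg_Forall)
  with PNFT_Pi[OF PNFT Forall_in_U_class[OF wf]] obtain \<psi> where
    \<psi>: "\<psi> \<in> Pi_class (Suc k)" "\<And>w. w \<Turnstile> dneg Bot (Forall \<phi>) \<longleftrightarrow> w \<Turnstile> dneg Bot \<psi>"
      "\<And>w A. wf_fm A \<Longrightarrow> w \<Turnstile> ntr A (Forall \<phi>) \<longleftrightarrow> w \<Turnstile> ntr A \<psi>" by metis
  have "w \<Turnstile> dneg Bot \<psi>" by (rule ntr_imp_dneg[OF \<psi>(1)]) (use ntr \<psi>(3) in simp)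
  then show "w \<Turnstile> dneg Bot (Forall \<phi>)" using \<psi>(2) by simp
qed

lemma PNFT_DNS_step: "proves_schema T (DNS (U_plus (Suc k)))"
proof -
  have "deriv T {} (Imp (Forall (Neg (Neg \<phi>))) (Neg (Neg (Forall \<phi>))))" if "\<phi> \<in> U_plus (Suc k)" for \<phi>
    unfolding theorem_iff_forces using PNFT_dns[OF that] that
    by (auto simp: dns_def U_plus_iff intro!: forces_ImpI)
  then show ?thesis
    using deriv_closed_Foralls[of T _ 1] unfolding proves_schema_def DNS_def provable_def by fastforce
qed

end

lemma PNFT_DNS:
  assumes "\<forall>k'\<le>k. PNFT T ((Neg \<circ> Neg) ` U_class k') ((Neg \<circ> Neg) ` Pi_class k')"
  shows "proves_schema T (DNS (U_plus k))"
  using assms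
proof (induction k)
  case 0
  then show ?case using qfree_DNS by simp
next
  case (Suc k)
  then show ?case by (intro PNFT_DNS_step) auto
qed

section \<open>Equivalence of (1) and (2)\<close>

lemma theorem_Neg3:
  assumes "wf_fm \<phi>" "wf_fm \<psi>"
  shows "T \<turnstile> Iff (Neg (Neg (Neg \<phi>))) \<psi> \<longleftrightarrow> T \<turnstile> Iff (Neg \<phi>) \<psi>"
proof -
  have "w \<Turnstile> Neg (Neg (Neg \<phi>)) \<longleftrightarrow> w \<Turnstile> Neg \<phi>" for w
  proof
    assume *: "w \<Turnstile> Neg (Neg (Neg \<phi>))"
    have "w' \<Turnstile> Bot" if w': "w \<le> w'" "w' \<Turnstile> \<phi>" for w'
    proof -
      have "w' \<Turnstile> Neg (Neg \<phi>)" unfolding Neg_Neg using w'(2) by (rule dnegI) simp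
      then show ?thesis using * w'(1) assms by (simp add: forces_Neg[of "Neg (Neg \<phi>)"])
    qed
    then show "w \<Turnstile> Neg \<phi>" using assms by (simp add: forces_Neg)
  next
    assume "w \<Turnstile> Neg \<phi>"
    then show "w \<Turnstile> Neg (Neg (Neg \<phi>))" unfolding Neg_Neg[of "Neg \<phi>"] by (rule dnegI) simp
  qed
  then show ?thesis unfolding provable_def using assms by (simp add: theorem_Iff)
qed

lemma PNFT_subset: "PNFT T G G' \<Longrightarrow> H \<subseteq> G \<Longrightarrow> PNFT T H G'"
  unfolding PNFT_def by (meson subsetD)

text \<open>Negation exchanges E and U. Hence doubly negated U formulas are negated E formulas, and
  conversely a negated E formula is equivalent to its own double negation, which has the form
  required in (2).\<close>

lemma PNFT_E_iff_U:
  "PNFT T (Neg ` E_class k) ((Neg \<circ> Neg) ` Pi_class k) \<longleftrightarrow>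
   PNFT T ((Neg \<circ> Neg) ` U_class k) ((Neg \<circ> Neg) ` Pi_class k)"
proof
  assume *: "PNFT T (Neg ` E_class k) ((Neg \<circ> Neg) ` Pi_class k)"
  have "(Neg \<circ> Neg) ` U_class k \<subseteq> Neg ` E_class k" by (auto simp: Neg_in_E_class)
  with * show "PNFT T ((Neg \<circ> Neg) ` U_class k) ((Neg \<circ> Neg) ` Pi_class k)"
    by (rule PNFT_subset)
next
  assume *: "PNFT T ((Neg \<circ> Neg) ` U_class k) ((Neg \<circ> Neg) ` Pi_class k)"
  show "PNFT T (Neg ` E_class k) ((Neg \<circ> Neg) ` Pi_class k)"
    unfolding PNFT_def
  proof clarify
    fix \<phi> assume \<phi>: "\<phi> \<in> E_class k"
    then have "Neg (Neg (Neg \<phi>)) \<in> (Neg \<circ> Neg) ` U_class k" by (auto simp: Neg_in_U_class)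
    from bspec[OF *[unfolded PNFT_def] this]
    obtain \<psi> where \<psi>: "\<psi> \<in> Pi_class k" "FV \<phi> = FV \<psi>" "T \<turnstile> Iff (Neg (Neg (Neg \<phi>))) (Neg (Neg \<psi>))"
      by auto
    have "wf_fm \<phi>" "wf_fm \<psi>"
      using \<phi> \<psi>(1) prenex_class_bound[of \<psi> Minus k] by (auto simp: E_class_iff)
    then have "T \<turnstile> Iff (Neg \<phi>) (Neg (Neg \<psi>))" using \<psi>(3) by (simp add: theorem_Neg3)
    then show "\<exists>\<phi>'\<in>(Neg \<circ> Neg) ` Pi_class k. FV (Neg \<phi>) = FV \<phi>' \<and> T \<turnstile> Iff (Neg \<phi>) \<phi>'"
      using \<psi> by auto
  qed
qed

end

theorem theorem7p7:
  fixes k :: nat and T :: "fm set"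
  assumes "in_between T HA PA"
  shows "((\<forall>k'\<le>k. PNFT T (Neg ` E_class k') ((Neg \<circ> Neg) ` Pi_class k')) \<longleftrightarrow>
          (\<forall>k'\<le>k. PNFT T ((Neg \<circ> Neg) ` U_class k') ((Neg \<circ> Neg) ` Pi_class k'))) \<and>
         ((\<forall>k'\<le>k. PNFT T ((Neg \<circ> Neg) ` U_class k') ((Neg \<circ> Neg) ` Pi_class k')) \<longleftrightarrow>
          proves_schema T (DNS (U_plus k))) \<and>
         ((\<forall>k'\<le>k. PNFT T (Neg ` E_class k') ((Neg \<circ> Neg) ` Pi_class k')) \<longleftrightarrow>
          proves_schema T (DNS (U_plus k)))"
proof -
  interpret between T
    by standard (use assms in \<open>auto simp: in_between_def provable_def\<close>)
  have "(\<forall>k'\<le>k. PNFT T ((Neg \<circ> Neg) ` U_class k') ((Neg \<circ> Neg) ` Pi_class k')) \<longleftrightarrow>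
      proves_schema T (DNS (U_plus k))"
    using PNFT_DNS DNS_PNFT by blast
  then show ?thesis unfolding PNFT_E_iff_U by blast
qed

end
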